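(* Let triangle $ABC$ be $N$-tiled by a tile with sides $(a,b,c)$ and angles $(\alpha,\beta,\gamma)$. Suppose $3\alpha+2\beta=\pi$ and $ABC$ is not similar to the tile. Then the tile is rational; specifically, $s=a/c$ is rational and $b/c$ is rational.
   Context: An $N$-tiling of a triangle $ABC$ by a triangle $T$ (the tile) is a way of writing $ABC$ as a union of $N$ triangles congruent to $T$ (reflections allowed) overlapping only at their boundaries; tiles need not meet edge-to-edge. The sides $a,b,c$ of the tile are opposite its angles $\alpha,\beta,\gamma$ respectively. The tile is called rational if the ratios of its sides are rational numbers. *)

theory Defs
  imports "HOL-Analysis.Analysis"
begin

definition is_triangle :: "real^2 \<Rightarrow> real^2 \<Rightarrow> real^2 \<Rightarrow> bool"
  where "is_triangle P Q R \<longleftrightarrow> \<not> collinear {P, Q, R}"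

text \<open>The closed triangular region spanned by the three vertices.\<close>

definition triangle_region :: "real^2 \<Rightarrow> real^2 \<Rightarrow> real^2 \<Rightarrow> (real^2) set"
  where "triangle_region P Q R = convex hull {P, Q, R}"

text \<open>The interior angle at the middle argument \<open>Q\<close>, in radians; meaningful
  when \<open>Q\<close> differs from \<open>P\<close> and \<open>R\<close>.\<close>

definition angle_at :: "real^2 \<Rightarrow> real^2 \<Rightarrow> real^2 \<Rightarrow> real"
  where "angle_at P Q R =
    arccos (((P - Q) \<bullet> (R - Q)) / (norm (P - Q) * norm (R - Q)))"

text \<open>Distance-scaling maps of the plane may reverse orientation, so reflections
  are allowed in both of the following notions.\<close>

definition similar_sets :: "(real^2) set \<Rightarrow> (real^2) set \<Rightarrow> bool"
  where "similar_sets S T \<longleftrightarrow>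
    (\<exists>f k. k > 0 \<and> (\<forall>x y. dist (f x) (f y) = k * dist x y) \<and> f ` S = T)"

definition congruent_sets :: "(real^2) set \<Rightarrow> (real^2) set \<Rightarrow> bool"
  where "congruent_sets S T \<longleftrightarrow>
    (\<exists>f. (\<forall>x y. dist (f x) (f y) = dist x y) \<and> f ` S = T)"

text \<open>The set \<open>\<T>\<close> consists of \<open>N\<close> congruent copies of the tile \<open>T\<close> with union \<open>S\<close>,
  overlapping only at their boundaries. Edge-to-edge contact is not required.\<close>

definition is_tiling :: "nat \<Rightarrow> (real^2) set \<Rightarrow> (real^2) set \<Rightarrow> (real^2) set set \<Rightarrow> bool"
  where "is_tiling N S T \<T> \<longleftrightarrow>
    finite \<T> \<and> card \<T> = N \<and>
    (\<forall>K\<in>\<T>. congruent_sets T K) \<and>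
    pairwise (\<lambda>K L. K \<inter> L \<subseteq> frontier K \<inter> frontier L) \<T> \<and>
    \<Union>\<T> = S"

definition N_tiled_by :: "nat \<Rightarrow> (real^2) set \<Rightarrow> (real^2) set \<Rightarrow> bool"
  where "N_tiled_by N S T \<longleftrightarrow> (\<exists>\<T>. is_tiling N S T \<T>)"

text \<open>The remaining ratios of two sides are reciprocals of these three.\<close>

definition rational_sides :: "real \<Rightarrow> real \<Rightarrow> real \<Rightarrow> bool"
  where "rational_sides a b c \<longleftrightarrow> a / b \<in> \<rat> \<and> b / c \<in> \<rat> \<and> a / c \<in> \<rat>"

end

theory Submission
  imports Defs "HOL-Computational_Algebra.Computational_Algebra"
begin

text \<open>
  Normalise \<open>c = 1\<close> and put \<open>\<delta> = \<alpha> / 2\<close>, \<open>\<omega> = cis (pi / 2 + \<delta>)\<close>. Then \<open>s = a / c = 2 * sin \<delta>\<close> is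
  \<open>- (\<omega> + cnj \<omega>)\<close>, \<open>b / c = 1 - s\<^sup>2\<close>, and the edge directions of a tile differ by powers of \<open>\<omega>\<close>
  up to sign. So it suffices to show that \<open>ABC\<close> is similar to the tile if \<open>s\<close> is irrational.

  The main tool is a cocycle identity. Let \<open>\<psi> d x\<close> be an arbitrary real function of a direction
  and a point with \<open>\<psi> (- d) x = \<psi> d x\<close>, and sum \<open>\<psi> d q - \<psi> d p\<close> over the oriented edges from \<open>p\<close>
  to \<open>q\<close>, of direction \<open>d\<close>, of a triangle. This is additive over tilings, edge-to-edge or not.
  Special choices of \<open>\<psi>\<close> give the angle sums at the vertices, the lengths of the sides as sums of
  edges, and the area. As \<open>\<psi>\<close> need not be continuous, it can also be composed with an embedding of
  the ring \<open>\<int>[\<omega>]\<close>, which gives the same identities for the conjugate tiles.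

  Let \<open>P, Q, R\<close> be the numbers of angles \<open>\<alpha>, \<beta>, \<gamma>\<close> of tiles at the vertices of \<open>ABC\<close>. If \<open>\<omega>\<close> is not a
  root of unity, then \<open>(P, Q, R)\<close> is \<open>(1, 1, 1)\<close>, which means similarity, or \<open>(3, 2, 0)\<close>. The
  latter is refuted for each distribution of the angles by the area and by the two characters
  \<open>\<omega> \<mapsto> 1\<close> and \<open>\<omega> \<mapsto> -1\<close> of the group of directions. If \<open>\<omega>\<close> is a root of unity, a conjugate of \<open>s\<close>
  with modulus \<open>2 * cos \<theta> > 1\<close> belongs to a tile with angles \<open>2 * \<theta>\<close>, \<open>pi - 3 * \<theta>\<close>, \<open>\<theta>\<close>, and two different
  such \<open>\<theta>\<close> again force \<open>(1, 1, 1)\<close>. If there is only one, then the norms of \<open>s\<close> and \<open>1 - s\<^sup>2\<close>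
  leave \<open>\<alpha> = pi / 5\<close>, where \<open>\<alpha> = \<beta>\<close> and \<open>ABC\<close> is similar to the tile, and \<open>\<alpha> = pi / 6\<close>, \<open>\<alpha> = pi / 4\<close>, where
  \<open>ABC\<close> would consist of multiples of \<open>\<alpha>\<close>, which area and side lengths exclude.
\<close>

section \<open>Circulation around triangles\<close>

text \<open>Tiles need not meet edge-to-edge, so inner edges do not cancel in pairs. What adds up is
  local: a short arc leaving a point lies in exactly one tile or outside \<open>ABC\<close>, so the
  difference between the two sides of a ray is additive over the tiling, and every edge sum can be
  written through such differences. A ring embedding maps vertices injectively and so keeps their
  incidences with \<open>A\<close>, \<open>B\<close>, \<open>C\<close>. The same counts therefore
  satisfy a second linear equation, with the angles of the conjugate tile as coefficients. An
  embedding ignores the order of the reals, so lengths may become negative; it is enough that the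
  tiles keep their orientations, which is one sign condition on the image of \<omega>. Of the two
  unit numbers above a conjugate of \<open>s\<close>, the one with the right sign is taken. Since
  \<open>\<gamma> = 2 * \<alpha> + \<beta>\<close>, one distribution of type
  \<open>(3, 2, 0)\<close> is again similar to the tile; only the other distributions need refuting.
  Norms enter because \<open>s\<close> and \<open>1 \<plusminus> s\<close> are nonzero algebraic
  integers if \<omega> is a root of unity: too many conjugates of modulus below 1 would make an
  integral norm smaller than 1.\<close>

definition crs :: "complex \<Rightarrow> complex \<Rightarrow> real"
  where "crs x y = Re x * Im y - Im x * Re y"

definition orient :: "complex \<Rightarrow> complex \<Rightarrow> complex \<Rightarrow> real"
  where "orient p q r = crs (q - p) (r - p)"

definition tri :: "complex \<Rightarrow> complex \<Rightarrow> complex \<Rightarrow> complex set"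
  where "tri p q r = convex hull {p, q, r}"

lemma crs_alt: "crs x y = Im (cnj x * y)"
  by (simp add: crs_def)

lemma crs_simps [simp]: "crs x x = 0" "crs 0 x = 0" "crs x 0 = 0"
    "crs (- x) y = - crs x y" "crs x (- y) = - crs x y"
  by (simp_all add: crs_def)

lemma crs_add: "crs (x + x') y = crs x y + crs x' y" "crs x (y + y') = crs x y + crs x y'"
  and crs_scaleR: "crs (of_real t * x) y = t * crs x y" "crs x (of_real t * y) = t * crs x y"
  by (simp_all add: crs_def algebra_simps)

lemma crs_ii: "crs d (\<i> * d) = (norm d)\<^sup>2"
  unfolding cmod_power2 by (simp add: crs_def power2_eq_square)

lemma orient_cyc: "orient q r p = orient p q r"
  by (simp add: orient_def crs_def algebra_simps)

lemma orient_swap: "orient p r q = - orient p q r"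
  by (simp add: orient_def crs_def algebra_simps)

lemma orient_sum: "orient p q z + orient q r z + orient r p z = orient p q r"
  by (simp add: orient_def crs_def algebra_simps)

lemma tri_cyc: "tri q r p = tri p q r" and tri_swap: "tri p r q = tri p q r"
  unfolding tri_def by (simp_all add: insert_commute)

lemma orient_barycentric:
  assumes "x + y + z = (1::real)"
  shows "orient p q (of_real x * p + of_real y * q + of_real z * r) = z * orient p q r"
proof -
  have x: "x = 1 - y - z" using assms by simp
  show ?thesis unfolding x by (simp add: orient_def crs_def algebra_simps)
qed

lemma mem_tri_iff:
  assumes "orient p q r > 0"
  shows "z \<in> tri p q r \<longleftrightarrow> orient p q z \<ge> 0 \<and> orient q r z \<ge> 0 \<and> orient r p z \<ge> 0"
proof
  assume "z \<in> tri p q r"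
  then obtain u v w where uvw: "0 \<le> u" "0 \<le> v" "0 \<le> w" "u + v + w = 1"
    and z: "z = of_real u * p + of_real v * q + of_real w * r"
    by (auto simp: tri_def convex_hull_3 scaleR_conv_of_real)
  have "orient p q z = w * orient p q r"
    unfolding z by (rule orient_barycentric) (use uvw in simp)
  moreover have "orient q r z = u * orient q r p"
    using orient_barycentric[of v w u q r p] uvw unfolding z by (simp add: add_ac)
  moreover have "orient r p z = v * orient r p q"
    using orient_barycentric[of w u v r p q] uvw unfolding z by (simp add: add_ac)
  ultimately show "orient p q z \<ge> 0 \<and> orient q r z \<ge> 0 \<and> orient r p z \<ge> 0"
    using uvw assms by (simp add: orient_cyc[of p q r] orient_cyc[of q r p])
next
  define D where "D = orient p q r"
  assume h: "orient p q z \<ge> 0 \<and> orient q r z \<ge> 0 \<and> orient r p z \<ge> 0"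
  have D: "D > 0" using assms D_def by simp
  \<comment> \<open>Cramer's rule: the three signed areas at \<open>z\<close> are its barycentric
    coordinates times \<open>D\<close>.\<close>
  have "of_real D * z = of_real (orient q r z) * p + of_real (orient r p z) * q + of_real (orient p q z) * r"
    unfolding D_def by (simp add: complex_eq_iff orient_def crs_def algebra_simps)
  then have "z = (orient q r z / D) *\<^sub>R p + (orient r p z / D) *\<^sub>R q + (orient p q z / D) *\<^sub>R r"
    using D by (simp add: scaleR_conv_of_real field_simps)
  moreover have "orient q r z / D + orient r p z / D + orient p q z / D = 1"
    using orient_sum[of p q z r] D unfolding D_def by (simp add: field_simps)
  ultimately show "z \<in> tri p q r"
    using h D unfolding tri_def convex_hull_3 by (smt (verit, best) divide_nonneg_pos mem_Collect_eq)
qed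

lemma continuous_on_orient [continuous_intros]: "continuous_on S (\<lambda>z. orient p q z)"
  unfolding orient_def crs_def by (intro continuous_intros)

lemma interior_tri:
  assumes "orient p q r > 0" "orient p q z > 0" "orient q r z > 0" "orient r p z > 0"
  shows "z \<in> interior (tri p q r)"
proof (rule interiorI)
  let ?U = "{z. orient p q z > 0} \<inter> {z. orient q r z > 0} \<inter> {z. orient r p z > 0}"
  show "open ?U"
    by (intro open_Int open_Collect_less continuous_intros)
  show "z \<in> ?U" using assms by simp
  show "?U \<subseteq> tri p q r" using assms(1) by (auto simp: mem_tri_iff)
qed

section \<open>Germs of arcs and jumps across rays\<close>

definition lexpos :: "real \<Rightarrow> real \<Rightarrow> real \<Rightarrow> bool"
  where "lexpos L l m \<longleftrightarrow> L > 0 \<or> L = 0 \<and> (l > 0 \<or> l = 0 \<and> m > 0)"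

lemma eventually_quadratic_pos:
  assumes "lexpos L l m"
  shows "\<forall>\<^sub>F t in at_right 0. L + t * l + t\<^sup>2 * m > 0"
proof -
  have pos: "\<forall>\<^sub>F t in at_right 0. (t::real) > 0"
    by (simp add: eventually_at_right_less)
  have lin: "\<forall>\<^sub>F t in at_right 0. x + t * y > 0" if "x > 0" for x y :: real
  proof -
    have "((\<lambda>t. x + t * y) \<longlongrightarrow> x + 0 * y) (at_right 0)"
      by (intro tendsto_intros)
    then show ?thesis using that by (intro order_tendstoD(1)) auto
  qed
  consider "L > 0" | "L = 0" "l > 0" | "L = 0" "l = 0" "m > 0"
    using assms by (auto simp: lexpos_def)
  then show ?thesis
  proof cases
    case 1
    have "((\<lambda>t. L + t * l + t\<^sup>2 * m) \<longlongrightarrow> L + 0 * l + 0\<^sup>2 * m) (at_right 0)"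
      by (intro tendsto_intros)
    then show ?thesis using 1 by (intro order_tendstoD(1)) auto
  next
    case 2
    show ?thesis using lin[OF 2(2), of m] pos
    proof eventually_elim
      case (elim t)
      have "L + t * l + t\<^sup>2 * m = t * (l + t * m)" using 2 by (simp add: algebra_simps power2_eq_square)
      then show ?case using elim by simp
    qed
  next
    case 3
    then show ?thesis using pos by (auto elim!: eventually_mono)
  qed
qed

lemma lexpos_total: "lexpos L l m \<or> lexpos (- L) (- l) (- m) \<or> L = 0 \<and> l = 0 \<and> m = 0"
  unfolding lexpos_def by linarith

text \<open>The quadratic term \<open>m\<close> selects the side of the line through \<open>x\<close> with direction \<open>d\<close>, so
  that a germ never runs along an edge.\<close>

definition germ :: "complex set \<Rightarrow> complex \<Rightarrow> complex \<Rightarrow> complex \<Rightarrow> bool"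
  where "germ S x d m \<longleftrightarrow> (\<forall>\<^sub>F t in at_right 0. x + of_real t * d + of_real (t\<^sup>2) * m \<in> S)"

text \<open>The arc leaving \<open>x\<close> with first-order term \<open>d\<close> and second-order
  term \<open>m\<close> starts strictly to the left of the line from \<open>p\<close> to
  \<open>q\<close>; \<open>orient_curve\<close> supplies the three coefficients.\<close>

definition lexor :: "complex \<Rightarrow> complex \<Rightarrow> complex \<Rightarrow> complex \<Rightarrow> complex \<Rightarrow> bool"
  where "lexor x d m p q \<longleftrightarrow> lexpos (orient p q x) (crs (q - p) d) (crs (q - p) m)"

lemma orient_curve:
  "orient p q (x + of_real t * d + of_real (t\<^sup>2) * m) = orient p q x + t * crs (q - p) d + t\<^sup>2 * crs (q - p) m"
  by (simp add: orient_def crs_def algebra_simps del: of_real_power)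

lemma crs_both_0:
  assumes "crs w d = 0" "crs w m = 0" "crs d m \<noteq> 0"
  shows "w = 0"
proof -
  have "of_real (crs d m) * w = of_real (crs w m) * d - of_real (crs w d) * m"
    by (simp add: complex_eq_iff crs_def algebra_simps)
  then show ?thesis using assms by simp
qed

text \<open>As \<open>d\<close> and \<open>m\<close> are independent, the arc stays on no side line,
  so each of the three signs is eventually constant and nonzero. One negative sign already puts the
  arc outside.\<close>

lemma germ_tri:
  assumes D: "orient p q r > 0" and dm: "crs d m \<noteq> 0"
  shows "if lexor x d m p q \<and> lexor x d m q r \<and> lexor x d m r p
    then germ (interior (tri p q r)) x d m else germ (- tri p q r) x d m"
proof -
  have ne: "p \<noteq> q" "q \<noteq> r" "r \<noteq> p" using D by (auto simp: orient_def crs_def)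
  have ev: "\<forall>\<^sub>F t in at_right 0. orient a b (x + of_real t * d + of_real (t\<^sup>2) * m) > 0"
    if "lexor x d m a b" for a b
    unfolding orient_curve using that by (intro eventually_quadratic_pos) (simp add: lexor_def)
  have ev': "\<forall>\<^sub>F t in at_right 0. orient a b (x + of_real t * d + of_real (t\<^sup>2) * m) < 0"
    if "\<not> lexor x d m a b" "a \<noteq> b" for a b
  proof -
    have "lexpos (- orient a b x) (- crs (b - a) d) (- crs (b - a) m)"
      using lexpos_total[of "orient a b x" "crs (b - a) d" "crs (b - a) m"] that
        crs_both_0[of "b - a" d m] dm unfolding lexor_def by auto
    from eventually_quadratic_pos[OF this] show ?thesis
      unfolding orient_curve by eventually_elim (simp add: algebra_simps)
  qed
  show ?thesis
  proof (cases "lexor x d m p q \<and> lexor x d m q r \<and> lexor x d m r p")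
    case True
    then have "germ (interior (tri p q r)) x d m"
      unfolding germ_def
      using eventually_conj[OF ev[of p q] eventually_conj[OF ev[of q r] ev[of r p]]]
      by (auto elim!: eventually_mono intro!: interior_tri[OF D] simp del: of_real_power)
    then show ?thesis using True by simp
  next
    case False
    then consider "\<not> lexor x d m p q" | "\<not> lexor x d m q r" | "\<not> lexor x d m r p" by blast
    then have "germ (- tri p q r) x d m"
      unfolding germ_def
    proof cases
      case 1 then show "\<forall>\<^sub>F t in at_right 0. x + of_real t * d + of_real (t\<^sup>2) * m \<in> - tri p q r"
        using ev'[of p q] ne by (auto elim!: eventually_mono simp: mem_tri_iff[OF D])
    next
      case 2 then show "\<forall>\<^sub>F t in at_right 0. x + of_real t * d + of_real (t\<^sup>2) * m \<in> - tri p q r"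
        using ev'[of q r] ne by (auto elim!: eventually_mono simp: mem_tri_iff[OF D])
    next
      case 3 then show "\<forall>\<^sub>F t in at_right 0. x + of_real t * d + of_real (t\<^sup>2) * m \<in> - tri p q r"
        using ev'[of r p] ne by (auto elim!: eventually_mono simp: mem_tri_iff[OF D])
    qed
    then show ?thesis using False by auto
  qed
qed

lemma germ_tri_iff:
  assumes D: "orient p q r > 0" and dm: "crs d m \<noteq> 0"
  shows "germ (tri p q r) x d m \<longleftrightarrow> lexor x d m p q \<and> lexor x d m q r \<and> lexor x d m r p"
    and "germ (interior (tri p q r)) x d m \<longleftrightarrow> germ (tri p q r) x d m"
    and "germ (- tri p q r) x d m \<longleftrightarrow> \<not> germ (tri p q r) x d m"
proof -
  have 1: "germ (tri p q r) x d m" if "germ (interior (tri p q r)) x d m"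
    using that interior_subset unfolding germ_def by (auto elim!: eventually_mono)
  have 2: "\<not> germ (tri p q r) x d m" if "germ (- tri p q r) x d m"
  proof
    assume "germ (tri p q r) x d m"
    with that have "\<forall>\<^sub>F t in at_right (0::real). False"
      unfolding germ_def by eventually_elim auto
    then show False by simp
  qed
  show "germ (tri p q r) x d m \<longleftrightarrow> lexor x d m p q \<and> lexor x d m q r \<and> lexor x d m r p"
    and "germ (interior (tri p q r)) x d m \<longleftrightarrow> germ (tri p q r) x d m"
    and "germ (- tri p q r) x d m \<longleftrightarrow> \<not> germ (tri p q r) x d m"
    using germ_tri[OF D dm, of x] 1 2 by (metis (full_types))+
qed

text \<open>Compares the left and the right bank of the ray from \<open>x\<close> in direction
  \<open>d\<close>. For a triangle it vanishes unless the ray starts along an edge, yet unlike an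
  edge it is additive over tilings.\<close>

definition jump :: "complex set \<Rightarrow> complex \<Rightarrow> complex \<Rightarrow> real"
  where "jump S x d = of_bool (germ S x d (\<i> * d)) - of_bool (germ S x d (- (\<i> * d)))"

definition edge_coord :: "complex \<Rightarrow> complex \<Rightarrow> complex \<Rightarrow> real"
  where "edge_coord p q z = Re (cnj (q - p) * z) / (norm (q - p))\<^sup>2"

text \<open>The conditions say that the ray from \<open>x\<close> in direction \<open>d\<close>
  starts inside the edge: only forwards at \<open>p\<close>, only backwards at \<open>q\<close>,
  both ways in between. The sign records whether the ray runs with the edge or against it.\<close>

definition edge_jump :: "complex \<Rightarrow> complex \<Rightarrow> complex \<Rightarrow> complex \<Rightarrow> real"
  where "edge_jump p q x d =
    (if crs (q - p) d = 0 \<and> orient p q x = 0 \<and>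
        (edge_coord p q (x - p) > 0 \<or> edge_coord p q (x - p) = 0 \<and> edge_coord p q d > 0) \<and>
        (edge_coord p q (x - p) < 1 \<or> edge_coord p q (x - p) = 1 \<and> edge_coord p q d < 0)
     then sgn (edge_coord p q d) else 0)"

lemma edge_coord_eq:
  assumes "p \<noteq> q" "crs (q - p) z = 0"
  shows "z = of_real (edge_coord p q z) * (q - p)"
proof -
  define w where "w = q - p"
  define \<rho> where "\<rho> = Re (cnj w * z)"
  have "cnj w * z = of_real \<rho>"
    using assms(2) by (simp add: complex_eq_iff crs_alt w_def \<rho>_def)
  then have "(cnj w * w) * z = of_real \<rho> * w"
    by (metis mult.assoc mult.commute)
  moreover have "cnj w * w = of_real ((norm w)\<^sup>2)"
    by (metis complex_norm_square mult.commute)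
  ultimately have "of_real ((norm w)\<^sup>2) * z = of_real \<rho> * w" by simp
  moreover have "w \<noteq> 0" using assms(1) w_def by simp
  ultimately show ?thesis
    unfolding edge_coord_def w_def[symmetric] \<rho>_def[symmetric] by (simp add: field_simps)
qed

text \<open>On the line of the edge, the other two sides only decide whether the ray starts inside
  the edge; the sign of \<open>l\<close> decides which bank lies in the triangle.\<close>

lemma jump_critical:
  assumes D: "orient p q r > 0" and x: "orient p q x = 0" and d: "crs (q - p) d = 0" "d \<noteq> 0"
  shows "jump (tri p q r) x d = edge_jump p q x d" "edge_jump q r x d = 0" "edge_jump r p x d = 0"
proof -
  define w where "w = q - p"
  define \<tau> where "\<tau> = edge_coord p q (x - p)"
  define l where "l = edge_coord p q d"
  define E where "E = orient p q r"
  have E: "E > 0" using D E_def by simp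
  have pq: "p \<noteq> q" using D by (auto simp: orient_def)
  have w: "w \<noteq> 0" using pq w_def by simp
  have dw: "d = of_real l * w"
    unfolding l_def w_def by (rule edge_coord_eq[OF pq d(1)])
  have "x - p = of_real \<tau> * w"
    unfolding \<tau>_def w_def by (rule edge_coord_eq[OF pq]) (use x in \<open>simp add: orient_def\<close>)
  then have xw: "x = p + of_real \<tau> * w" by (simp add: algebra_simps)
  have l: "l \<noteq> 0" using dw d(2) by auto
  have qr: "orient q r x = (1 - \<tau>) * E" "crs (r - q) d = - l * E"
    unfolding E_def dw xw w_def by (simp_all add: orient_def crs_def algebra_simps)
  have rp: "orient r p x = \<tau> * E" "crs (p - r) d = l * E"
    unfolding E_def dw xw w_def by (simp_all add: orient_def crs_def algebra_simps)
  show "edge_jump q r x d = 0" "edge_jump r p x d = 0"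
    using qr(2) rp(2) l E by (simp_all add: edge_jump_def)
  have m: "crs (q - p) (\<i> * d) = l * (norm w)\<^sup>2"
    unfolding dw w_def[symmetric] cmod_power2 by (simp add: crs_def algebra_simps power2_eq_square)
  have dm: "crs d (\<i> * d) \<noteq> 0" "crs d (- (\<i> * d)) \<noteq> 0"
    using d(2) by (simp_all add: crs_ii)
  let ?ok = "(\<tau> > 0 \<or> \<tau> = 0 \<and> l > 0) \<and> (\<tau> < 1 \<or> \<tau> = 1 \<and> l < 0)"
  have lp: "lexor x d (\<i> * d) p q \<longleftrightarrow> l > 0" "lexor x d (- (\<i> * d)) p q \<longleftrightarrow> l < 0"
    using x d(1) w by (simp_all add: lexor_def lexpos_def m mult_less_0_iff zero_less_mult_iff)
  have lo: "lexor x d m' q r \<and> lexor x d m' r p \<longleftrightarrow> ?ok" for m'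
    using E l by (auto simp: lexor_def lexpos_def qr rp zero_less_mult_iff mult_less_0_iff)
  have "jump (tri p q r) x d = (if ?ok then sgn l else 0)"
    unfolding jump_def germ_tri_iff(1)[OF D dm(1)] germ_tri_iff(1)[OF D dm(2)] lo lp
    using l by (auto simp: sgn_if)
  also have "\<dots> = edge_jump p q x d"
    using x d(1) unfolding edge_jump_def \<tau>_def[symmetric] l_def[symmetric] by simp
  finally show "jump (tri p q r) x d = edge_jump p q x d" .
qed

lemma jump_tri:
  assumes D: "orient p q r > 0" and d: "d \<noteq> 0"
  shows "jump (tri p q r) x d = edge_jump p q x d + edge_jump q r x d + edge_jump r p x d"
proof -
  have D': "orient q r p > 0" "orient r p q > 0"
    using D by (simp_all add: orient_cyc[of p q r] orient_cyc[of q r p])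
  have dm: "crs d (\<i> * d) \<noteq> 0" "crs d (- (\<i> * d)) \<noteq> 0"
    using d by (simp_all add: crs_ii)
  let ?crit = "\<lambda>a b. orient a b x = 0 \<and> crs (b - a) d = 0"
  consider "?crit p q" | "?crit q r" | "?crit r p" | "\<not> ?crit p q" "\<not> ?crit q r" "\<not> ?crit r p"
    by blast
  then show ?thesis
  proof cases
    case 1 then show ?thesis using jump_critical[OF D _ _ d, of x] by simp
  next
    case 2 then show ?thesis using jump_critical[OF D'(1) _ _ d, of x] by (simp add: tri_cyc)
  next
    case 3 then show ?thesis using jump_critical[OF D'(2) _ _ d, of x] by (simp add: tri_cyc[of p q r] tri_cyc[of q r p])
  next
    case 4
    have "lexor x d (\<i> * d) a b \<longleftrightarrow> lexor x d (- (\<i> * d)) a b" if "\<not> ?crit a b" for a b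
      using that by (auto simp: lexor_def lexpos_def)
    with 4 have "jump (tri p q r) x d = 0"
      unfolding jump_def germ_tri_iff(1)[OF D dm(1)] germ_tri_iff(1)[OF D dm(2)] by simp
    with 4 show ?thesis by (auto simp: edge_jump_def)
  qed
qed

text \<open>At inner points of the edge the forward and the backward ray cancel. What is left is the
  forward ray at \<open>p\<close> and the backward ray at \<open>q\<close>.\<close>

lemma edge_jump_pair:
  assumes "p \<noteq> q"
  shows "edge_jump p q x (sgn (q - p)) + edge_jump p q x (- sgn (q - p)) = of_bool (x = p) - of_bool (x = q)"
proof -
  let ?e = "sgn (q - p)"
  define \<tau> where "\<tau> = edge_coord p q (x - p)"
  have n: "norm (q - p) > 0" using assms by simp
  have "cnj (q - p) * ?e = of_real (norm (q - p))"
    using n complex_norm_square[of "q - p"]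
    by (simp add: sgn_eq field_simps power2_eq_square)
  then have c: "edge_coord p q ?e = 1 / norm (q - p)" "edge_coord p q (- ?e) = - 1 / norm (q - p)"
    using n by (simp_all add: edge_coord_def field_simps power2_eq_square del: complex_cnj_diff)
  have par: "crs (q - p) ?e = 0" "crs (q - p) (- ?e) = 0"
    by (simp_all add: crs_def sgn_eq)
  show ?thesis
  proof (cases "orient p q x = 0")
    case False
    then have "x \<noteq> p" "x \<noteq> q" by (auto simp: orient_def)
    with False show ?thesis by (simp add: edge_jump_def)
  next
    case True
    have "x - p = of_real \<tau> * (q - p)"
      unfolding \<tau>_def by (rule edge_coord_eq[OF assms]) (use True in \<open>simp add: orient_def\<close>)
    then have x: "x = p + of_real \<tau> * (q - p)" by (simp add: algebra_simps)
    have "x = p \<longleftrightarrow> \<tau> = 0" "x = q \<longleftrightarrow> \<tau> = 1"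
    proof -
      show "x = p \<longleftrightarrow> \<tau> = 0" unfolding x using assms by simp
      have "x = q \<longleftrightarrow> of_real (\<tau> - 1) * (q - p) = 0" unfolding x by (auto simp: algebra_simps)
      then show "x = q \<longleftrightarrow> \<tau> = 1" using assms by simp
    qed
    then show ?thesis
      using n unfolding edge_jump_def par c \<tau>_def[symmetric] by (auto simp: True)
  qed
qed

section \<open>Potentials of edges and the cocycle identity\<close>

definition edge_pot :: "(complex \<Rightarrow> complex \<Rightarrow> real) \<Rightarrow> complex \<Rightarrow> complex \<Rightarrow> real"
  where "edge_pot \<psi> p q = \<psi> (sgn (q - p)) q - \<psi> (sgn (q - p)) p"

definition circulation :: "(complex \<Rightarrow> complex \<Rightarrow> real) \<Rightarrow> complex \<Rightarrow> complex \<Rightarrow> complex \<Rightarrow> real"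
  where "circulation \<psi> p q r = edge_pot \<psi> p q + edge_pot \<psi> q r + edge_pot \<psi> r p"

text \<open>\<open>V\<close> may contain further points of the edge, such as vertices of other
  tiles. Evenness of \<open>\<psi>\<close> gives both rays at such a point the same weight, so their
  jumps cancel by \<open>edge_jump_pair\<close>.\<close>

lemma sum_edge_jump:
  assumes fin: "finite V" "finite E" and pq: "p \<in> V" "q \<in> V" "p \<noteq> q"
    and E: "\<And>d. d \<in> E \<Longrightarrow> norm d = 1" "\<And>d. d \<in> E \<Longrightarrow> - d \<in> E" "sgn (q - p) \<in> E"
    and \<psi>: "\<And>d x. \<psi> (- d) x = \<psi> d x"
  shows "(\<Sum>x\<in>V. \<Sum>d\<in>E. edge_jump p q x d * \<psi> d x) = - edge_pot \<psi> p q"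
proof -
  let ?e = "sgn (q - p)"
  have e: "?e \<noteq> 0" using pq by (simp add: sgn_zero_iff)
  have par: "d = ?e \<or> d = - ?e" if "crs (q - p) d = 0" "norm d = 1" for d
  proof -
    have d: "d = of_real (edge_coord p q d) * (q - p)"
      by (rule edge_coord_eq) (use that pq in auto)
    have "norm d = norm (of_real (edge_coord p q d) * (q - p))" using d by simp
    then have "\<bar>edge_coord p q d\<bar> * norm (q - p) = 1" using that by (simp add: norm_mult)
    then have "edge_coord p q d = inverse (norm (q - p)) \<or> edge_coord p q d = - inverse (norm (q - p))"
      using pq by (auto simp: field_simps abs_if split: if_splits)
    then show ?thesis
      using d by (auto simp: sgn_div_norm scaleR_conv_of_real)
  qed
  have "(\<Sum>d\<in>E. edge_jump p q x d * \<psi> d x) = \<psi> ?e x * (of_bool (x = p) - of_bool (x = q))" for x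
  proof -
    have "(\<Sum>d\<in>E. edge_jump p q x d * \<psi> d x) = (\<Sum>d\<in>{?e, - ?e}. edge_jump p q x d * \<psi> d x)"
      by (rule sum.mono_neutral_right) (use E par fin in \<open>auto simp: edge_jump_def\<close>)
    also have "\<dots> = \<psi> ?e x * (edge_jump p q x ?e + edge_jump p q x (- ?e))"
      using e by (simp add: \<psi> algebra_simps)
    finally show ?thesis by (simp add: edge_jump_pair[OF pq(3)])
  qed
  then have "(\<Sum>x\<in>V. \<Sum>d\<in>E. edge_jump p q x d * \<psi> d x)
    = (\<Sum>x\<in>V. \<psi> ?e x * of_bool (x = p)) - (\<Sum>x\<in>V. \<psi> ?e x * of_bool (x = q))"
    by (simp add: right_diff_distrib sum_subtractf)
  also have "\<dots> = \<psi> ?e p - \<psi> ?e q"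
    using fin pq by (simp add: of_bool_def if_distrib cong: if_cong)
  finally show ?thesis by (simp add: edge_pot_def)
qed

lemma edge_pot_swap:
  assumes \<psi>: "\<And>d x. \<psi> (- d) x = \<psi> d x"
  shows "edge_pot \<psi> q p = - edge_pot \<psi> p q"
  unfolding edge_pot_def using \<psi>[of "sgn (q - p)"] sgn_minus[of "q - p"] by simp

lemma circulation_swap:
  assumes \<psi>: "\<And>d x. \<psi> (- d) x = \<psi> d x"
  shows "circulation \<psi> p r q = - circulation \<psi> p q r"
  unfolding circulation_def
  using edge_pot_swap[of \<psi> q p] edge_pot_swap[of \<psi> r q] edge_pot_swap[of \<psi> p r] \<psi> by simp

lemma circulation_cyc: "circulation \<psi> q r p = circulation \<psi> p q r"
  by (simp add: circulation_def)

lemma circulation_jump_pos: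
  assumes fin: "finite V" "finite E" and V: "{p, q, r} \<subseteq> V"
    and E: "\<And>d. d \<in> E \<Longrightarrow> norm d = 1" "\<And>d. d \<in> E \<Longrightarrow> - d \<in> E"
      "{sgn (q - p), sgn (r - q), sgn (p - r)} \<subseteq> E"
    and \<psi>: "\<And>d x. \<psi> (- d) x = \<psi> d x" and D: "orient p q r > 0"
  shows "circulation \<psi> p q r = - (\<Sum>x\<in>V. \<Sum>d\<in>E. jump (tri p q r) x d * \<psi> d x)"
proof -
  have ne: "p \<noteq> q" "q \<noteq> r" "r \<noteq> p" using D by (auto simp: orient_def crs_def)
  have "(\<Sum>x\<in>V. \<Sum>d\<in>E. jump (tri p q r) x d * \<psi> d x) =
     (\<Sum>x\<in>V. \<Sum>d\<in>E. edge_jump p q x d * \<psi> d x + edge_jump q r x d * \<psi> d x + edge_jump r p x d * \<psi> d x)"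
    by (intro sum.cong refl, subst jump_tri[OF D]) (use E(1) in \<open>force simp: algebra_simps\<close>)+
  also have "\<dots> = - edge_pot \<psi> p q - edge_pot \<psi> q r - edge_pot \<psi> r p"
    using sum_edge_jump[OF fin, of p q \<psi>] sum_edge_jump[OF fin, of q r \<psi>] sum_edge_jump[OF fin, of r p \<psi>]
      V E ne \<psi> by (simp add: sum.distrib)
  finally show ?thesis by (simp add: circulation_def)
qed

lemma circulation_jump:
  assumes fin: "finite V" "finite E" and V: "{p, q, r} \<subseteq> V"
    and E: "\<And>d. d \<in> E \<Longrightarrow> norm d = 1" "\<And>d. d \<in> E \<Longrightarrow> - d \<in> E"
      "{sgn (q - p), sgn (r - q), sgn (p - r)} \<subseteq> E"
    and \<psi>: "\<And>d x. \<psi> (- d) x = \<psi> d x" and D: "orient p q r \<noteq> 0"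
  shows "sgn (orient p q r) * circulation \<psi> p q r = - (\<Sum>x\<in>V. \<Sum>d\<in>E. jump (tri p q r) x d * \<psi> d x)"
proof (cases "orient p q r > 0")
  case True
  have "circulation \<psi> p q r = - (\<Sum>x\<in>V. \<Sum>d\<in>E. jump (tri p q r) x d * \<psi> d x)"
    by (rule circulation_jump_pos) (use assms True in auto)
  then show ?thesis using True by simp
next
  case False
  then have D': "orient p r q > 0" using D by (simp add: orient_swap[of p q r])
  have "sgn (r - p) \<in> E" "sgn (q - r) \<in> E" "sgn (p - q) \<in> E"
    using E(2)[of "sgn (p - r)"] E(2)[of "sgn (r - q)"] E(2)[of "sgn (q - p)"] E(3)
    by (simp_all flip: sgn_minus)
  then have "circulation \<psi> p r q = - (\<Sum>x\<in>V. \<Sum>d\<in>E. jump (tri p r q) x d * \<psi> d x)"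
    using V E \<psi> by (intro circulation_jump_pos fin D') auto
  then show ?thesis
    using D D' circulation_swap[of \<psi> p r q, OF \<psi>] by (simp add: tri_swap orient_swap[of p q r])
qed

definition tiling :: "'i set \<Rightarrow> ('i \<Rightarrow> complex) \<Rightarrow> ('i \<Rightarrow> complex) \<Rightarrow> ('i \<Rightarrow> complex) \<Rightarrow>
    complex \<Rightarrow> complex \<Rightarrow> complex \<Rightarrow> bool"
  where "tiling I u v w A B C \<longleftrightarrow> finite I \<and> orient A B C > 0 \<and>
    (\<forall>i\<in>I. orient (u i) (v i) (w i) \<noteq> 0) \<and>
    (\<Union>i\<in>I. tri (u i) (v i) (w i)) = tri A B C \<and>
    (\<forall>i\<in>I. \<forall>j\<in>I. i \<noteq> j \<longrightarrow> interior (tri (u i) (v i) (w i)) \<inter> interior (tri (u j) (v j) (w j)) = {})"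

lemma germ_dichotomy:
  assumes "orient p q r \<noteq> 0" and "crs d m \<noteq> 0"
  shows "germ (interior (tri p q r)) x d m \<longleftrightarrow> germ (tri p q r) x d m"
    and "germ (- tri p q r) x d m \<longleftrightarrow> \<not> germ (tri p q r) x d m"
proof -
  have "orient p q r > 0 \<or> orient p r q > 0" using assms(1) orient_swap[of p q r] by linarith
  then show "germ (interior (tri p q r)) x d m \<longleftrightarrow> germ (tri p q r) x d m"
    and "germ (- tri p q r) x d m \<longleftrightarrow> \<not> germ (tri p q r) x d m"
    using germ_tri_iff[of p q r d m x] germ_tri_iff[of p r q d m x] assms(2) by (auto simp: tri_swap)
qed

text \<open>An arc germ in a tile lies in its interior, so disjoint interiors allow at most one
  tile. If no tile contains it, finiteness makes it avoid all tiles at once, hence their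
  union.\<close>

lemma sum_germ_tiling:
  assumes T: "tiling I u v w A B C" and dm: "crs d m \<noteq> 0"
  shows "(\<Sum>i\<in>I. of_bool (germ (tri (u i) (v i) (w i)) x d m)) = (of_bool (germ (tri A B C) x d m) :: real)"
proof -
  let ?T = "\<lambda>i. tri (u i) (v i) (w i)"
  let ?z = "\<lambda>t. x + of_real t * d + of_real (t\<^sup>2) * m"
  have fin: "finite I" and nz: "\<And>i. i \<in> I \<Longrightarrow> orient (u i) (v i) (w i) \<noteq> 0"
    and un: "(\<Union>i\<in>I. ?T i) = tri A B C"
    and disj: "\<And>i j. i \<in> I \<Longrightarrow> j \<in> I \<Longrightarrow> i \<noteq> j \<Longrightarrow> interior (?T i) \<inter> interior (?T j) = {}"
    using T by (auto simp: tiling_def)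
  have uniq: "i = j" if "i \<in> I" "j \<in> I" "germ (?T i) x d m" "germ (?T j) x d m" for i j
  proof (rule ccontr)
    assume "i \<noteq> j"
    have "germ (interior (?T i)) x d m" "germ (interior (?T j)) x d m"
      using that germ_dichotomy(1)[OF nz dm] by auto
    then have "\<forall>\<^sub>F t in at_right (0::real). False"
      unfolding germ_def by eventually_elim (use disj[OF that(1,2) \<open>i \<noteq> j\<close>] in blast)
    then show False by simp
  qed
  show ?thesis
  proof (cases "\<exists>i\<in>I. germ (?T i) x d m")
    case True
    then obtain i where i: "i \<in> I" "germ (?T i) x d m" by blast
    have "germ (tri A B C) x d m"
      using i un unfolding germ_def by (auto elim!: eventually_mono)
    moreover have "(\<Sum>j\<in>I. of_bool (germ (?T j) x d m)) = (\<Sum>j\<in>I. if j = i then 1 else 0 :: real)"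
      by (intro sum.cong refl) (use i uniq in auto)
    ultimately show ?thesis using i fin by simp
  next
    case False
    have "\<forall>i\<in>I. \<forall>\<^sub>F t in at_right 0. ?z t \<in> - ?T i"
      using False germ_dichotomy(2)[OF nz dm] by (auto simp: germ_def)
    then have ev: "\<forall>\<^sub>F t in at_right 0. \<forall>i\<in>I. ?z t \<in> - ?T i"
      using fin by (simp add: eventually_ball_finite_distrib)
    have "\<not> germ (tri A B C) x d m"
    proof
      assume "germ (tri A B C) x d m"
      then have "\<forall>\<^sub>F t in at_right 0. ?z t \<in> (\<Union>i\<in>I. ?T i)"
        unfolding germ_def un .
      with ev have "\<forall>\<^sub>F t in at_right (0::real). False" by eventually_elim blast
      then show False by simp
    qed
    then show ?thesis using False by simp
  qed
qed

lemma sum_jump_tiling: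
  assumes "tiling I u v w A B C" "d \<noteq> 0"
  shows "(\<Sum>i\<in>I. jump (tri (u i) (v i) (w i)) x d) = jump (tri A B C) x d"
proof -
  have "crs d (\<i> * d) \<noteq> 0" "crs d (- (\<i> * d)) \<noteq> 0" using assms(2) by (simp_all add: crs_ii)
  then show ?thesis unfolding jump_def by (simp add: sum_subtractf sum_germ_tiling[OF assms(1)])
qed

text \<open>Both sides are the sum of \<open>- jump S x d * \<psi> d x\<close> over all vertices \<open>x\<close> and edge
  directions \<open>d\<close>, and the jumps across a germ of a ray add up over the tiling. No
  edge-to-edge assumption enters.\<close>

theorem circulation_tiling:
  assumes T: "tiling I u v w A B C" and \<psi>: "\<And>d x. \<psi> (- d) x = \<psi> d x"
  shows "(\<Sum>i\<in>I. sgn (orient (u i) (v i) (w i)) * circulation \<psi> (u i) (v i) (w i)) = circulation \<psi> A B C"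
proof -
  define V where "V = {A, B, C} \<union> (\<Union>i\<in>I. {u i, v i, w i})"
  define E0 where "E0 = {sgn (B - A), sgn (C - B), sgn (A - C)} \<union>
     (\<Union>i\<in>I. {sgn (v i - u i), sgn (w i - v i), sgn (u i - w i)})"
  define E where "E = E0 \<union> uminus ` E0"
  have fin: "finite I" and D: "orient A B C > 0" and nz: "\<And>i. i \<in> I \<Longrightarrow> orient (u i) (v i) (w i) \<noteq> 0"
    using T by (auto simp: tiling_def)
  have finVE: "finite V" "finite E" using fin by (auto simp: V_def E_def E0_def)
  have ne: "p \<noteq> q \<and> q \<noteq> r \<and> r \<noteq> p" if "orient p q r \<noteq> 0" for p q r
    using that by (auto simp: orient_def crs_def)
  have "norm d = 1" if "d \<in> E0" for d
    using that ne[OF less_imp_neq[OF D, symmetric]] ne[OF nz] by (fastforce simp: E0_def norm_sgn)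
  then have E1: "norm d = 1" if "d \<in> E" for d using that by (auto simp: E_def)
  have E2: "- d \<in> E" if "d \<in> E" for d using that by (auto simp: E_def)
  have *: "sgn (orient p q r) * circulation \<psi> p q r = - (\<Sum>x\<in>V. \<Sum>d\<in>E. jump (tri p q r) x d * \<psi> d x)"
    if "orient p q r \<noteq> 0" "{p, q, r} \<subseteq> V" "{sgn (q - p), sgn (r - q), sgn (p - r)} \<subseteq> E0" for p q r
    by (rule circulation_jump) (use that finVE E1 E2 \<psi> in \<open>auto simp: E_def\<close>)
  have "(\<Sum>i\<in>I. sgn (orient (u i) (v i) (w i)) * circulation \<psi> (u i) (v i) (w i)) =
    (\<Sum>i\<in>I. - (\<Sum>x\<in>V. \<Sum>d\<in>E. jump (tri (u i) (v i) (w i)) x d * \<psi> d x))"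
    by (intro sum.cong refl *) (use nz in \<open>auto simp: V_def E0_def\<close>)
  also have "\<dots> = - (\<Sum>x\<in>V. \<Sum>i\<in>I. \<Sum>d\<in>E. jump (tri (u i) (v i) (w i)) x d * \<psi> d x)"
    by (simp add: sum_negf sum.swap[of _ I V])
  also have "\<dots> = - (\<Sum>x\<in>V. \<Sum>d\<in>E. (\<Sum>i\<in>I. jump (tri (u i) (v i) (w i)) x d) * \<psi> d x)"
    by (simp add: sum.swap[of _ I E] sum_distrib_right)
  also have "\<dots> = - (\<Sum>x\<in>V. \<Sum>d\<in>E. jump (tri A B C) x d * \<psi> d x)"
  proof -
    have "(\<Sum>i\<in>I. jump (tri (u i) (v i) (w i)) x d) = jump (tri A B C) x d" if "d \<in> E" for x d
      using E1[OF that] by (intro sum_jump_tiling[OF T]) auto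
    then show ?thesis by simp
  qed
  also have "\<dots> = sgn (orient A B C) * circulation \<psi> A B C"
    by (rule *[symmetric]) (use D in \<open>auto simp: V_def E0_def\<close>)
  finally show ?thesis using D by simp
qed

section \<open>Winding numbers and angle sums\<close>

text \<open>The direction of \<open>x - z\<close> up to a constant on each line of direction
  \<open>d\<close> that misses \<open>z\<close>. A quotient is used because it is unchanged by
  \<open>d \<mapsto> - d\<close>. If the line passes through \<open>z\<close>, division by zero
  makes the value 0.\<close>

definition angpot :: "complex \<Rightarrow> complex \<Rightarrow> complex \<Rightarrow> real"
  where "angpot z d x = - arctan (Re (cnj d * (x - z)) / Im (cnj d * (x - z)))"

text \<open>The value 0 on all real numbers, negative ones included, matches the default of
  \<open>angpot\<close> on lines through \<open>z\<close>: an edge whose line contains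
  \<open>z\<close> contributes nothing.\<close>

definition sang :: "complex \<Rightarrow> real"
  where "sang z = (if Im z = 0 then 0 else Arg z)"

lemma angpot_even: "angpot z (- d) x = angpot z d x"
proof -
  have "Re (cnj (- d) * (x - z)) = - Re (cnj d * (x - z))" "Im (cnj (- d) * (x - z)) = - Im (cnj d * (x - z))"
    by (simp_all add: algebra_simps)
  then show ?thesis unfolding angpot_def by (metis minus_divide_divide)
qed

lemma Arg_arctan_diff:
  fixes x y h :: real
  assumes "h \<noteq> 0" "x \<noteq> y"
  shows "Arg (Complex y h * cnj (Complex x h)) = arctan (x / h) - arctan (y / h)"
proof (rule cis_Arg_unique[OF _])
  define r where "r = sqrt (1 + (x / h)\<^sup>2) * sqrt (1 + (y / h)\<^sup>2)"
  have pos: "1 + t\<^sup>2 > 0" for t :: real by (simp add: add_pos_nonneg)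
  have r: "r > 0" unfolding r_def using pos by simp
  have c: "cis (arctan t) = Complex 1 t / of_real (sqrt (1 + t\<^sup>2))" for t
    using pos[of t] by (simp add: complex_eq_iff cos_arctan sin_arctan Re_divide_of_real Im_divide_of_real)
  have "cis (arctan (x / h) - arctan (y / h)) = cis (arctan (x / h)) * cnj (cis (arctan (y / h)))"
    by (simp add: cis_cnj cis_mult)
  also have "\<dots> = Complex 1 (x / h) * cnj (Complex 1 (y / h)) / of_real r"
    by (simp add: c r_def)
  also have "Complex 1 (x / h) * cnj (Complex 1 (y / h)) = Complex y h * cnj (Complex x h) / of_real (h\<^sup>2)"
    using assms(1) by (simp add: complex_eq_iff Re_divide_of_real Im_divide_of_real field_simps power2_eq_square del: of_real_power)
  finally have e: "Complex y h * cnj (Complex x h) = of_real (h\<^sup>2 * r) * cis (arctan (x / h) - arctan (y / h))"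
    using assms(1) r by (simp add: field_simps)
  have "h\<^sup>2 * r > 0" using assms(1) r by simp
  then show "sgn (Complex y h * cnj (Complex x h)) = cis (arctan (x / h) - arctan (y / h))"
    unfolding e sgn_mult by (simp only: sgn_of_real sgn_cis) simp
  show "- pi < arctan (x / h) - arctan (y / h)" "arctan (x / h) - arctan (y / h) \<le> pi"
    using arctan_bounded[of "x / h"] arctan_bounded[of "y / h"] by linarith+
qed

lemma edge_pot_angpot:
  assumes "p \<noteq> q"
  shows "edge_pot (angpot z) p q = sang ((q - z) * cnj (p - z))"
proof -
  define d where "d = sgn (q - p)"
  have d: "cnj d * d = 1"
    using assms by (simp add: d_def complex_norm_square[symmetric] norm_sgn mult.commute[of "cnj _"])
  have "cnj d * (q - p) = of_real (norm (q - p))"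
  proof -
    have "q - p = of_real (norm (q - p)) * d"
      using assms by (simp add: d_def sgn_div_norm scaleR_conv_of_real)
    then have "cnj d * (q - p) = (cnj d * d) * of_real (norm (q - p))" by (metis mult.assoc mult.commute)
    then show ?thesis using d by simp
  qed
  then have pq: "cnj d * (q - z) = cnj d * (p - z) + of_real (norm (q - p))"
    by (simp add: algebra_simps)
  define x where "x = Re (cnj d * (p - z))"
  define y where "y = Re (cnj d * (q - z))"
  define h where "h = Im (cnj d * (p - z))"
  have p: "cnj d * (p - z) = Complex x h" unfolding x_def h_def complex_eq_iff by (simp only: complex.sel)
  have q: "cnj d * (q - z) = Complex y h" using pq by (simp add: y_def h_def complex_eq_iff)
  have xy: "x \<noteq> y" using pq assms by (auto simp: x_def y_def)
  have "(q - z) * cnj (p - z) = (cnj d * d) * ((q - z) * cnj (p - z))" using d by simp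
  also have "\<dots> = (cnj d * (q - z)) * cnj (cnj d * (p - z))" by simp
  finally have e: "(q - z) * cnj (p - z) = Complex y h * cnj (Complex x h)" unfolding p q .
  have im: "Im (Complex y h * cnj (Complex x h)) = h * (x - y)" by (simp add: algebra_simps)
  have "edge_pot (angpot z) p q = arctan (x / h) - arctan (y / h)"
    unfolding edge_pot_def angpot_def d_def[symmetric] p q by simp
  then show ?thesis
    unfolding e sang_def im using xy Arg_arctan_diff[of h x y] by auto
qed

lemma sang_pos: "Im z > 0 \<Longrightarrow> 0 < sang z \<and> sang z < pi"
  using Arg_lt_pi[of z] by (simp add: sang_def)

lemma sang_neg:
  assumes "Im z < 0" shows "- pi < sang z \<and> sang z < 0"
  using assms Arg_lt_pi[of z] Arg_bounded[of z] Arg_neg_iff[of z] by (auto simp: sang_def)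

lemma sang_bound: "- pi < sang z \<and> sang z < pi"
  using sang_pos[of z] sang_neg[of z] by (cases "Im z" "0::real" rule: linorder_cases) (auto simp: sang_def)

lemma sang_cis: "Im z \<noteq> 0 \<Longrightarrow> z = of_real (norm z) * cis (sang z)"
  by (metis Arg_zero cis_Arg complex_norm_eq_1_exp sang_def rcis_cmod_Arg rcis_def)

text \<open>The sum is a multiple of \<open>2 * pi\<close>, and the opposite signs of the first two
  angles bound their sum by \<open>pi\<close>. A real \<open>z\<close> is treated apart because
  \<open>sang\<close> forgets its sign: then \<open>x * y\<close> is real, and its argument in
  \<open>(- pi, pi)\<close> vanishes.\<close>

lemma sang_sum_eq_0_aux:
  assumes "Im x < 0" "Im y > 0" "z \<noteq> 0" and k: "x * y * z = of_real k" "k \<ge> 0"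
  shows "sang x + sang y + sang z = 0"
proof -
  have nx: "x \<noteq> 0" "y \<noteq> 0" using assms by auto
  have xy: "x * y = of_real (norm x * norm y) * cis (sang x + sang y)"
    using sang_cis[of x] sang_cis[of y] assms(1,2) by (metis (no_types, lifting) cis_mult less_irrefl mult.assoc mult.left_commute of_real_mult)
  have bd: "- pi < sang x + sang y" "sang x + sang y < pi"
    using sang_neg[OF assms(1)] sang_pos[OF assms(2)] by linarith+
  show ?thesis
  proof (cases "Im z = 0")
    case True
    then have "z = of_real (Re z)" by (simp add: complex_eq_iff)
    then have "Im (x * y * of_real (Re z)) = 0" using k by simp
    then have "Im (x * y) = 0" using assms(3) True by (simp add: complex_eq_iff)
    then have "sin (sang x + sang y) = 0" unfolding xy using nx by simp
    then have "sang x + sang y = 0" using bd sin_eq_0_pi by blast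
    then show ?thesis using True by (simp add: sang_def)
  next
    case False
    have "x * y * z = of_real (norm x * norm y * norm z) * cis (sang x + sang y + sang z)"
    proof -
      define n where "n = norm z"
      define t where "t = sang z"
      have z: "z = of_real n * cis t" unfolding n_def t_def by (rule sang_cis[OF False])
      have "of_real a * cis b * (of_real n * cis t) = of_real (a * n) * cis (b + t)" for a b
        by (simp add: cis_mult[symmetric])
      from this[of "norm x * norm y" "sang x + sang y"] show ?thesis
        unfolding xy n_def[symmetric] t_def[symmetric] z[symmetric] .
    qed
    then have e: "of_real k = of_real (norm x * norm y * norm z) * cis (sang x + sang y + sang z)" using k by simp
    have "k = norm x * norm y * norm z"
      using arg_cong[OF e, of norm] k(2) by (simp add: norm_mult)
    then have "cis (sang x + sang y + sang z) = 1" using e nx assms(3) by simp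
    then have "cos (sang x + sang y + sang z) = 1" by (simp add: complex_eq_iff)
    then obtain n :: int where n: "sang x + sang y + sang z = of_int n * 2 * pi"
      using cos_one_2pi_int by blast
    have "\<bar>sang x + sang y + sang z\<bar> < 2 * pi" using bd sang_bound[of z] by linarith
    then have "\<bar>of_int n :: real\<bar> * (2 * pi) < 1 * (2 * pi)" unfolding n by (simp add: abs_mult)
    then have "\<bar>of_int n :: real\<bar> < 1" by (simp only: mult_less_cancel_right) simp
    then have "n = 0" by linarith
    then show ?thesis using n by simp
  qed
qed

lemma sang_sum_eq_0:
  assumes "Im x < 0" "Im x + Im y + Im z > 0" "x * y * z = of_real k" "k \<ge> 0"
    "Im y > 0 \<Longrightarrow> z \<noteq> 0" "Im z > 0 \<Longrightarrow> y \<noteq> 0"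
  shows "sang x + sang y + sang z = 0"
proof (cases "Im y > 0")
  case True
  then show ?thesis using sang_sum_eq_0_aux[OF assms(1) True _ assms(3,4)] assms(5) by blast
next
  case False
  then have "Im z > 0" using assms(1,2) by linarith
  then have "sang x + sang z + sang y = 0"
    using sang_sum_eq_0_aux[OF assms(1), of z y k] assms(3,4,6) by (simp add: mult_ac)
  then show ?thesis by simp
qed

text \<open>In radians rather than turns; the sign factor makes it independent of the orientation of
  the triangle.\<close>

definition winding :: "complex \<Rightarrow> complex \<Rightarrow> complex \<Rightarrow> complex \<Rightarrow> real"
  where "winding z p q r = sgn (orient p q r) * circulation (angpot z) p q r"

lemma winding_cyc: "winding z q r p = winding z p q r"
  by (simp add: winding_def orient_cyc circulation_cyc)

lemma winding_swap: "winding z p r q = winding z p q r"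
  using circulation_swap[of "angpot z" p q r] by (simp add: winding_def orient_swap[of p q r] angpot_even)

lemma orient_nonzero_neq:
  assumes "orient p q r \<noteq> 0" shows "p \<noteq> q" "q \<noteq> r" "r \<noteq> p"
  using assms by (auto simp: orient_def crs_def)

lemma winding_pos:
  assumes "orient p q r > 0"
  shows "winding z p q r = sang ((q - z) * cnj (p - z)) + sang ((r - z) * cnj (q - z)) + sang ((p - z) * cnj (r - z))"
  using assms orient_nonzero_neq[of p q r] by (simp add: winding_def circulation_def edge_pot_angpot)

lemma Im_orient: "Im ((q - z) * cnj (p - z)) = orient p q z"
  by (simp add: orient_def crs_def algebra_simps)

text \<open>The line \<open>pq\<close> separates \<open>z\<close> from the triangle, so one
  subtended angle is negative. In the product of the three arguments of \<open>sang\<close>, each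
  difference meets its own conjugate, which makes the product a nonnegative real.\<close>

lemma winding_outside_aux:
  assumes D: "orient p q r > 0" and z: "orient p q z < 0"
  shows "winding z p q r = 0"
  unfolding winding_pos[OF D]
proof (rule sang_sum_eq_0)
  show "Im ((q - z) * cnj (p - z)) < 0" using z by (simp only: Im_orient)
  show "Im ((q - z) * cnj (p - z)) + Im ((r - z) * cnj (q - z)) + Im ((p - z) * cnj (r - z)) > 0"
    using D by (simp only: Im_orient orient_sum)
  have "(q - z) * cnj (p - z) * ((r - z) * cnj (q - z)) * ((p - z) * cnj (r - z))
     = ((p - z) * cnj (p - z)) * ((q - z) * cnj (q - z)) * ((r - z) * cnj (r - z))" by (simp only: mult_ac)
  also have "\<dots> = of_real ((norm (p - z))\<^sup>2 * (norm (q - z))\<^sup>2 * (norm (r - z))\<^sup>2)"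
    by (simp only: complex_norm_square[symmetric] of_real_mult)
  finally show "(q - z) * cnj (p - z) * ((r - z) * cnj (q - z)) * ((p - z) * cnj (r - z))
     = of_real ((norm (p - z))\<^sup>2 * (norm (q - z))\<^sup>2 * (norm (r - z))\<^sup>2)" .
  show "(norm (p - z))\<^sup>2 * (norm (q - z))\<^sup>2 * (norm (r - z))\<^sup>2 \<ge> 0" by simp
  have pq: "p \<noteq> z" "q \<noteq> z" using z by (auto simp: orient_def crs_def)
  show "(p - z) * cnj (r - z) \<noteq> 0" if "Im ((r - z) * cnj (q - z)) > 0"
  proof -
    have "r \<noteq> z" using that by auto
    then show ?thesis using pq by simp
  qed
  show "(r - z) * cnj (q - z) \<noteq> 0" if "Im ((p - z) * cnj (r - z)) > 0"
  proof -
    have "r \<noteq> z" using that by auto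
    then show ?thesis using pq by simp
  qed
qed

lemma orient_pos_or:
  assumes "orient p q r \<noteq> 0" obtains "orient p q r > 0" | "orient p r q > 0"
  using assms orient_swap[of p q r] by linarith

lemma winding_outside:
  assumes "orient p q r \<noteq> 0" "z \<notin> tri p q r"
  shows "winding z p q r = 0"
proof -
  have *: "winding z p q r = 0" if D: "orient p q r > 0" and z: "z \<notin> tri p q r" for p q r
  proof -
    consider "orient p q z < 0" | "orient q r z < 0" | "orient r p z < 0"
      using z mem_tri_iff[OF D] by fastforce
    then show ?thesis
      using winding_outside_aux[of p q r z] winding_outside_aux[of q r p z] winding_outside_aux[of r p q z] D
      by cases (simp_all add: orient_cyc[of p q r] orient_cyc[of q r p] winding_cyc[of z p q r] winding_cyc[of z q r p])
  qed
  show ?thesis using assms(1)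
  proof (cases rule: orient_pos_or)
    case 2 then show ?thesis using *[OF 2] assms(2) by (simp add: tri_swap winding_swap)
  qed (use * assms in auto)
qed

lemma winding_nonneg:
  assumes "orient p q r \<noteq> 0" shows "winding z p q r \<ge> 0"
proof -
  have nn: "sang x \<ge> 0" if "Im x \<ge> 0" for x
    using that sang_pos[of x] by (cases "Im x = 0") (auto simp: sang_def)
  have *: "winding z p q r \<ge> 0" if D: "orient p q r > 0" for p q r
  proof (cases "z \<in> tri p q r")
    case True
    then show ?thesis unfolding winding_pos[OF D]
      by (intro add_nonneg_nonneg nn) (simp_all only: Im_orient mem_tri_iff[OF D])
  next
    case False
    then show ?thesis using winding_outside[of p q r z] D by simp
  qed
  show ?thesis using assms *[of p q r] *[of p r q] by (cases rule: orient_pos_or) (auto simp: winding_swap)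
qed

lemma winding_interior:
  assumes "orient p q r > 0" "orient p q z > 0" "orient q r z > 0" "orient r p z > 0"
  shows "winding z p q r > 0"
  unfolding winding_pos[OF assms(1)]
  using assms(2-4) by (intro add_pos_pos sang_pos[THEN conjunct1]) (simp_all only: Im_orient)

definition corner :: "complex \<Rightarrow> complex \<Rightarrow> complex \<Rightarrow> real"
  where "corner p q r = \<bar>Arg ((r - p) * cnj (q - p))\<bar>"

lemma Arg_pos_orient:
  assumes "orient p q r > 0"
  shows "0 < Arg ((r - p) * cnj (q - p))" "Arg ((r - p) * cnj (q - p)) < pi"
proof -
  have "Im ((r - p) * cnj (q - p)) > 0" using assms by (simp only: Im_orient orient_cyc)
  then show "0 < Arg ((r - p) * cnj (q - p))" "Arg ((r - p) * cnj (q - p)) < pi"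
    using Arg_lt_pi by blast+
qed

lemma corner_swap:
  assumes "orient p q r \<noteq> 0" shows "corner p r q = corner p q r"
proof -
  let ?z = "(r - p) * cnj (q - p)"
  have "Im ?z \<noteq> 0" using assms by (simp only: Im_orient orient_cyc not_False_eq_True)
  then have "Arg (cnj ?z) = - Arg ?z" using Arg_cnj[of ?z] by (auto simp: complex_is_Real_iff)
  moreover have "(q - p) * cnj (r - p) = cnj ?z" by simp
  ultimately show ?thesis unfolding corner_def by (simp only: abs_minus)
qed

lemma corner_gt_0: assumes "orient p q r \<noteq> 0" shows "corner p q r > 0"
  using assms
proof (cases rule: orient_pos_or)
  case 1 then show ?thesis using Arg_pos_orient[of p q r] by (simp add: corner_def)
next
  case 2
  then have "corner p r q > 0" using Arg_pos_orient[of p r q] by (simp add: corner_def)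
  then show ?thesis using corner_swap[OF assms] by simp
qed

text \<open>The two edges at \<open>p\<close> contribute 0 by the convention of \<open>sang\<close>;
  only the opposite edge is left.\<close>

lemma winding_vertex:
  assumes "orient p q r \<noteq> 0" shows "winding p p q r = corner p q r"
proof -
  have *: "winding p p q r = corner p q r" if "orient p q r > 0" for p q r
  proof -
    have "Im ((r - p) * cnj (q - p)) \<noteq> 0" using that by (simp only: Im_orient orient_cyc)
    then show ?thesis
      using Arg_pos_orient[OF that] by (simp add: winding_pos[OF that] sang_def corner_def)
  qed
  show ?thesis using assms
  proof (cases rule: orient_pos_or)
    case 2 then show ?thesis using *[OF 2] by (simp add: winding_swap corner_swap[OF assms])
  qed (use * in auto)
qed

text \<open>A tiling as seen by circulations. Unlike \<open>tiling\<close>, this property is visibly inherited by the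
  image of a tiling under a field embedding of the coordinates.\<close>

definition weak_tiling :: "'i set \<Rightarrow> ('i \<Rightarrow> complex) \<Rightarrow> ('i \<Rightarrow> complex) \<Rightarrow> ('i \<Rightarrow> complex) \<Rightarrow>
    complex \<Rightarrow> complex \<Rightarrow> complex \<Rightarrow> bool"
  where "weak_tiling I u v w A B C \<longleftrightarrow> finite I \<and> I \<noteq> {} \<and> A \<noteq> B \<and> B \<noteq> C \<and> C \<noteq> A \<and>
    (\<forall>i\<in>I. orient (u i) (v i) (w i) \<noteq> 0) \<and>
    (\<forall>\<psi>. (\<forall>d x. \<psi> (- d) x = \<psi> d x) \<longrightarrow>
      (\<Sum>i\<in>I. sgn (orient (u i) (v i) (w i)) * circulation \<psi> (u i) (v i) (w i)) = circulation \<psi> A B C)"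

lemma tiling_weak:
  assumes "tiling I u v w A B C" shows "weak_tiling I u v w A B C"
proof -
  have D: "orient A B C > 0" and un: "(\<Union>i\<in>I. tri (u i) (v i) (w i)) = tri A B C"
    using assms by (auto simp: tiling_def)
  have "A \<in> tri A B C" by (simp add: tri_def hull_inc)
  then have "I \<noteq> {}" using un by auto
  then show ?thesis
    using assms circulation_tiling[OF assms] orient_nonzero_neq[of A B C]
    unfolding weak_tiling_def tiling_def by auto
qed

lemma weak_tiling_cyc: "weak_tiling I u v w A B C \<Longrightarrow> weak_tiling I u v w B C A"
  unfolding weak_tiling_def by (simp add: circulation_cyc)

text \<open>The shoelace formula as a potential: along an edge of direction \<open>d\<close> the
  first factor is constant and the second grows by the length. Both factors are odd in
  \<open>d\<close>, so the product is even.\<close>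

definition areapot :: "complex \<Rightarrow> complex \<Rightarrow> real"
  where "areapot d x = crs x d * Re (cnj d * x)"

lemma areapot_even: "areapot (- d) x = areapot d x"
  by (simp add: areapot_def algebra_simps)

lemma edge_pot_areapot:
  assumes pq: "p \<noteq> q"
  shows "edge_pot areapot p q = crs p q"
proof -
  define d where "d = sgn (q - p)"
  define n where "n = norm (q - p)"
  have "q - p = of_real n * d"
    using pq by (simp add: d_def n_def sgn_div_norm scaleR_conv_of_real)
  then have q: "q = p + of_real n * d" by (simp add: algebra_simps)
  have "norm d = 1" using pq by (simp add: d_def norm_sgn)
  then have d: "Re d * Re d + Im d * Im d = 1" by (metis cmod_power2 one_power2 power2_eq_square)
  have "crs q d = crs p d" unfolding q by (simp add: crs_add crs_scaleR)
  then have "edge_pot areapot p q = crs p d * (Re (cnj d * q) - Re (cnj d * p))"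
    unfolding edge_pot_def areapot_def d_def[symmetric] by (simp add: algebra_simps)
  also have "Re (cnj d * q) - Re (cnj d * p) = n * (Re d * Re d + Im d * Im d)"
    unfolding q by (simp add: algebra_simps)
  also have "crs p d * (n * (Re d * Re d + Im d * Im d)) = crs p q"
    unfolding d unfolding q by (simp add: crs_add crs_scaleR)
  finally show ?thesis .
qed

lemma circulation_areapot:
  assumes "p \<noteq> q" "q \<noteq> r" "r \<noteq> p"
  shows "circulation areapot p q r = orient p q r"
  unfolding circulation_def using assms by (simp add: edge_pot_areapot) (simp add: orient_def crs_def algebra_simps)

context
  fixes I u v w A B C
  assumes T: "weak_tiling I u v w A B C"
begin

lemma weak_circulation:
  assumes "\<And>d x. \<psi> (- d) x = \<psi> d x"
  shows "(\<Sum>i\<in>I. sgn (orient (u i) (v i) (w i)) * circulation \<psi> (u i) (v i) (w i)) = circulation \<psi> A B C"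
  using T assms unfolding weak_tiling_def by blast

lemma weak_fin: "finite I" and weak_nz: "i \<in> I \<Longrightarrow> orient (u i) (v i) (w i) \<noteq> 0"
  using T unfolding weak_tiling_def by auto

lemma weak_area: "orient A B C = (\<Sum>i\<in>I. \<bar>orient (u i) (v i) (w i)\<bar>)"
proof -
  have "(\<Sum>i\<in>I. sgn (orient (u i) (v i) (w i)) * circulation areapot (u i) (v i) (w i)) = circulation areapot A B C"
    by (rule weak_circulation) (rule areapot_even)
  moreover have "sgn (orient (u i) (v i) (w i)) * circulation areapot (u i) (v i) (w i) = \<bar>orient (u i) (v i) (w i)\<bar>"
    if "i \<in> I" for i
    using circulation_areapot orient_nonzero_neq[OF weak_nz[OF that]] by (simp add: abs_sgn mult.commute)
  ultimately show ?thesis using circulation_areapot T by (simp add: weak_tiling_def)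
qed

lemma weak_orient_pos: "orient A B C > 0"
  unfolding weak_area using T weak_nz by (intro sum_pos) (auto simp: weak_tiling_def)

lemma weak_winding: "(\<Sum>i\<in>I. winding z (u i) (v i) (w i)) = winding z A B C"
  using weak_circulation[of "angpot z"] weak_orient_pos by (simp add: winding_def angpot_even)

lemma closed_tri: "closed (tri p q r)"
  unfolding tri_def by (intro compact_imp_closed compact_convex_hull) simp

text \<open>A weak tiling carries no covering statement, but winding numbers are nonnegative. A tile
  that leaves \<open>ABC\<close> would contain an interior point outside \<open>ABC\<close>, where
  the sum is positive while the winding of \<open>ABC\<close> is 0.\<close>

lemma weak_subset_pos:
  assumes i: "i \<in> I" and D: "orient p q r > 0" and pqr: "tri (u i) (v i) (w i) = tri p q r"
    "\<And>z. winding z (u i) (v i) (w i) = winding z p q r"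
  shows "tri p q r \<subseteq> tri A B C"
proof
  fix z assume z: "z \<in> tri p q r"
  show "z \<in> tri A B C"
  proof (rule ccontr)
    assume nz: "z \<notin> tri A B C"
    define c where "c = (p + q + r) / 3"
    define D where "D = orient p q r"
    \<comment> \<open>Moving from \<open>z\<close> towards the centroid makes all three orientations
      positive, and for small \<open>t\<close> the point is still outside the closed triangle
      \<open>ABC\<close>.\<close>
    define y where "y = (\<lambda>t::real. z + of_real t * (c - z))"
    have c: "orient p q c = D / 3" "orient q r c = D / 3" "orient r p c = D / 3"
      unfolding D_def c_def by (simp_all add: orient_def crs_def field_simps)
    have aff: "orient a b (y t) = (1 - t) * orient a b z + t * orient a b c" for a b t
      unfolding y_def by (simp add: orient_def crs_def algebra_simps)
    have "(y \<longlongrightarrow> z + of_real 0 * (c - z)) (at_right 0)"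
      unfolding y_def by (intro tendsto_intros)
    then have "(y \<longlongrightarrow> z) (at_right 0)" by simp
    then have "\<forall>\<^sub>F t in at_right 0. y t \<in> - tri A B C"
      using closed_tri[of A B C] nz by (intro topological_tendstoD) auto
    moreover have "\<forall>\<^sub>F t in at_right 0. t < (1::real)"
      by (auto simp: eventually_at_right_field intro: exI[of _ 1])
    moreover have "\<forall>\<^sub>F t in at_right 0. t > (0::real)"
      by (simp add: eventually_at_right_less)
    ultimately have "\<forall>\<^sub>F t in at_right 0. y t \<in> - tri A B C \<and> t < 1 \<and> 0 < t"
      by eventually_elim auto
    then obtain t where t: "y t \<notin> tri A B C" "t < 1" "0 < t"
      using eventually_happens'[OF trivial_limit_at_right_real] by fastforce
    have pos: "orient a b (y t) > 0" if "orient a b z \<ge> 0" "orient a b c = D / 3" for a b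
      unfolding aff using t that assms(2) D_def by (intro add_nonneg_pos mult_nonneg_nonneg mult_pos_pos) auto
    have "winding (y t) p q r > 0"
      using z c assms(2) pos unfolding mem_tri_iff[OF assms(2)]
      by (intro winding_interior) auto
    then have "winding (y t) (u i) (v i) (w i) > 0" by (simp add: pqr)
    then have "(\<Sum>i\<in>I. winding (y t) (u i) (v i) (w i)) > 0"
      using i weak_fin weak_nz winding_nonneg by (intro sum_pos2[of I i]) auto
    moreover have "winding (y t) A B C = 0"
      using t weak_orient_pos by (intro winding_outside) auto
    ultimately show False using weak_winding by simp
  qed
qed

lemma weak_subset:
  assumes i: "i \<in> I" shows "tri (u i) (v i) (w i) \<subseteq> tri A B C"
  using weak_nz[OF i]
proof (cases rule: orient_pos_or)
  case 1 then show ?thesis using weak_subset_pos[OF i 1] by simp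
next
  case 2 then show ?thesis using weak_subset_pos[OF i 2] by (simp add: tri_swap winding_swap)
qed

lemma extreme_vertex:
  assumes p: "p \<in> tri A B C" "q \<in> tri A B C" "r \<in> tri A B C" and A: "A \<in> tri p q r"
  shows "A \<in> {p, q, r}"
proof -
  have D: "orient A B C > 0" by (rule weak_orient_pos)
  \<comment> \<open>An affine function that is nonnegative on \<open>ABC\<close> and vanishes there
    only at \<open>A\<close>: the unnormalised weights of \<open>C\<close> and \<open>B\<close>
    added.\<close>
  define f where "f = (\<lambda>z. orient A B z + orient C A z)"
  have f0: "f z \<ge> 0" if "z \<in> tri A B C" for z using that by (auto simp: f_def mem_tri_iff[OF D])
  have fA: "z = A" if "z \<in> tri A B C" "f z = 0" for z
  proof -
    have "orient A B z = 0" "orient C A z = 0" using that by (auto simp: f_def mem_tri_iff[OF D])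
    then have "crs (z - A) (B - A) = 0" "crs (z - A) (C - A) = 0"
      by (simp_all add: orient_def crs_def algebra_simps)
    moreover have "crs (B - A) (C - A) \<noteq> 0" using D by (simp add: orient_def)
    ultimately show "z = A" using crs_both_0[of "z - A" "B - A" "C - A"] by simp
  qed
  obtain x y t where xyt: "x \<ge> 0" "y \<ge> 0" "t \<ge> 0" "x + y + t = 1"
    and A: "A = of_real x * p + of_real y * q + of_real t * r"
    using A by (auto simp: tri_def convex_hull_3 scaleR_conv_of_real)
  have comb: "f (of_real x * p + of_real y * q + of_real t * r) = x * f p + y * f q + t * f r"
  proof -
    have x: "x = 1 - y - t" using xyt by simp
    show ?thesis unfolding x f_def by (simp add: orient_def crs_def algebra_simps)
  qed
  have "f A = 0" by (simp add: f_def orient_def)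
  then have "x * f p + y * f q + t * f r = 0" using comb A by simp
  moreover have "x * f p \<ge> 0" "y * f q \<ge> 0" "t * f r \<ge> 0" using xyt f0 p by auto
  ultimately have "x * f p = 0" "y * f q = 0" "t * f r = 0" by linarith+
  moreover have "x \<noteq> 0 \<or> y \<noteq> 0 \<or> t \<noteq> 0" using xyt by linarith
  ultimately show ?thesis using fA p by auto
qed

text \<open>The winding identity at the point \<open>A\<close> itself. A tile containing
  \<open>A\<close> has it as a vertex, since \<open>A\<close> is extreme in \<open>ABC\<close>; all
  other tiles contribute 0.\<close>

theorem weak_corner:
  "corner A B C = (\<Sum>i\<in>I. of_bool (u i = A) * corner (u i) (v i) (w i) +
     of_bool (v i = A) * corner (v i) (w i) (u i) + of_bool (w i = A) * corner (w i) (u i) (v i))"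
proof -
  have "corner A B C = winding A A B C"
    using weak_orient_pos by (simp add: winding_vertex)
  also have "\<dots> = (\<Sum>i\<in>I. winding A (u i) (v i) (w i))"
    by (simp add: weak_winding)
  also have "\<dots> = (\<Sum>i\<in>I. of_bool (u i = A) * corner (u i) (v i) (w i) +
     of_bool (v i = A) * corner (v i) (w i) (u i) + of_bool (w i = A) * corner (w i) (u i) (v i))"
  proof (intro sum.cong refl)
    fix i assume i: "i \<in> I"
    let ?p = "u i" and ?q = "v i" and ?r = "w i"
    have nz: "orient ?p ?q ?r \<noteq> 0" "orient ?q ?r ?p \<noteq> 0" "orient ?r ?p ?q \<noteq> 0"
      using weak_nz[OF i] by (simp_all add: orient_cyc[of ?p ?q ?r] orient_cyc[of ?q ?r ?p])
    note ne = orient_nonzero_neq[OF nz(1)]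
    have inn: "?p \<in> tri A B C" "?q \<in> tri A B C" "?r \<in> tri A B C"
      using weak_subset[OF i] by (auto simp: tri_def hull_inc)
    consider "?p = A" | "?q = A" | "?r = A" | "A \<notin> {?p, ?q, ?r}" by auto
    then show "winding A ?p ?q ?r = of_bool (?p = A) * corner ?p ?q ?r +
     of_bool (?q = A) * corner ?q ?r ?p + of_bool (?r = A) * corner ?r ?p ?q"
    proof cases
      case 1 then show ?thesis using ne winding_vertex[OF nz(1)] by auto
    next
      case 2
      have "winding ?q ?p ?q ?r = corner ?q ?r ?p"
        using winding_vertex[OF nz(2)] winding_cyc by metis
      then show ?thesis using 2 ne by auto
    next
      case 3
      have "winding ?r ?p ?q ?r = corner ?r ?p ?q"
        using winding_vertex[OF nz(3)] winding_cyc by metis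
      then show ?thesis using 3 ne by auto
    next
      case 4
      then have "A \<notin> tri ?p ?q ?r" using extreme_vertex[OF inn] by auto
      then show ?thesis using 4 winding_outside[OF nz(1)] by auto
    qed
  qed
  finally show ?thesis .
qed

end

section \<open>Side lengths\<close>

definition online :: "complex \<Rightarrow> complex \<Rightarrow> complex \<Rightarrow> complex \<Rightarrow> bool"
  where "online A B p q \<longleftrightarrow> orient A B p = 0 \<and> orient A B q = 0"

text \<open>Measures abscissas along the line \<open>AB\<close> and is 0 for edges of other
  directions or off that line. The fixed direction \<open>sgn (B - A)\<close> in the value keeps it
  even in \<open>d\<close>.\<close>

definition linepot :: "complex \<Rightarrow> complex \<Rightarrow> complex \<Rightarrow> complex \<Rightarrow> real"
  where "linepot A B d x = (if (d = sgn (B - A) \<or> d = - sgn (B - A)) \<and> orient A B x = 0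
     then Re (cnj (sgn (B - A)) * x) else 0)"

text \<open>Sees only edges on the line \<open>AB\<close> with end point \<open>A\<close>. As its
  circulation around \<open>ABC\<close> is nonzero, some tile has such an edge.\<close>

definition startpot :: "complex \<Rightarrow> complex \<Rightarrow> complex \<Rightarrow> complex \<Rightarrow> real"
  where "startpot A B d x = of_bool ((d = sgn (B - A) \<or> d = - sgn (B - A)) \<and> x = A)"

lemma sgn_dir_even: "- d = a \<or> - d = - a \<longleftrightarrow> d = a \<or> d = - a" for a d :: complex
  by (metis minus_minus)

lemma linepot_even: "linepot A B (- d) x = linepot A B d x"
  unfolding linepot_def sgn_dir_even ..

lemma startpot_even: "startpot A B (- d) x = startpot A B d x"
  unfolding startpot_def sgn_dir_even ..

lemma norm_sgn_mult: "z = of_real (norm z) * sgn z" for z :: complex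
  by (cases "z = 0") (simp_all add: sgn_div_norm scaleR_conv_of_real)

lemma parallel_sgn:
  assumes "p \<noteq> q" "A \<noteq> B" "crs (B - A) (q - p) = 0"
  obtains t where "q - p = of_real t * sgn (B - A)" "\<bar>t\<bar> = norm (q - p)" "sgn (q - p) = of_real (sgn t) * sgn (B - A)"
proof -
  define l where "l = edge_coord A B (q - p)"
  have "q - p = of_real l * (B - A)"
    unfolding l_def by (rule edge_coord_eq[OF assms(2,3)])
  moreover have "B - A = of_real (norm (B - A)) * sgn (B - A)"
    by (rule norm_sgn_mult)
  ultimately have t: "q - p = of_real (l * norm (B - A)) * sgn (B - A)" by (metis mult.assoc of_real_mult)
  have n: "norm (sgn (B - A)) = 1" using assms(2) by (simp add: norm_sgn)
  show ?thesis
  proof (rule that[OF t])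
    show "\<bar>l * norm (B - A)\<bar> = norm (q - p)" unfolding t by (simp add: norm_mult n abs_mult)
    show "sgn (q - p) = of_real (sgn (l * norm (B - A))) * sgn (B - A)"
      unfolding t sgn_mult by (simp add: sgn_of_real sgn_mult)
  qed
qed

lemma sgn_parallel:
  assumes "p \<noteq> q" "sgn (q - p) = sgn (B - A) \<or> sgn (q - p) = - sgn (B - A)"
  shows "crs (B - A) (q - p) = 0"
proof -
  have "q - p = of_real (norm (q - p)) * sgn (q - p)" "B - A = of_real (norm (B - A)) * sgn (B - A)"
    by (rule norm_sgn_mult)+
  then show ?thesis using assms(2) by (metis crs_scaleR crs_simps(1) crs_simps(5) minus_zero mult_zero_right)
qed

lemma crs_orient: "crs (B - A) (q - p) = orient A B q - orient A B p"
  by (simp add: orient_def crs_def algebra_simps)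

lemma edge_pot_linepot:
  assumes "p \<noteq> q" "A \<noteq> B"
  shows "edge_pot (linepot A B) p q = (if online A B p q then Re (cnj (sgn (B - A)) * (q - p)) else 0)"
proof (cases "crs (B - A) (q - p) = 0")
  case True
  obtain t where t: "q - p = of_real t * sgn (B - A)" "\<bar>t\<bar> = norm (q - p)" "sgn (q - p) = of_real (sgn t) * sgn (B - A)"
    using parallel_sgn[OF assms True] .
  then have "t \<noteq> 0" using assms(1) by auto
  then have "sgn (q - p) = sgn (B - A) \<or> sgn (q - p) = - sgn (B - A)"
    using t(3) by (cases "t > 0") auto
  moreover have "orient A B p = orient A B q" using True crs_orient[of B A q p] by simp
  ultimately show ?thesis
    unfolding edge_pot_def linepot_def online_def by (auto simp: algebra_simps)
next
  case False
  then have "\<not> online A B p q" using crs_orient[of B A q p] by (auto simp: online_def)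
  moreover have "\<not> (sgn (q - p) = sgn (B - A) \<or> sgn (q - p) = - sgn (B - A))"
    using False sgn_parallel[OF assms(1)] by blast
  ultimately show ?thesis unfolding edge_pot_def linepot_def by auto
qed

lemma edge_pot_startpot:
  assumes "p \<noteq> q" "A \<noteq> B" "edge_pot (startpot A B) p q \<noteq> 0"
  shows "online A B p q \<and> (p = A \<or> q = A)"
proof -
  have par: "sgn (q - p) = sgn (B - A) \<or> sgn (q - p) = - sgn (B - A)" and A: "p = A \<or> q = A"
    using assms(3) unfolding edge_pot_def startpot_def by (auto simp: of_bool_def split: if_splits)
  have "crs (B - A) (q - p) = 0" by (rule sgn_parallel[OF assms(1) par])
  then have "orient A B q = orient A B p" by (simp add: crs_orient)
  moreover have "orient A B A = 0" by (simp add: orient_def)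
  ultimately show ?thesis using A by (auto simp: online_def)
qed

text \<open>A triangle to the left of \<open>AB\<close>, traversed counterclockwise, runs along
  \<open>AB\<close> in the direction of \<open>AB\<close>. Hence all tiles contribute to the side
  with a plus sign, and edge lengths add without cancellation.\<close>

lemma online_orientation:
  assumes D: "orient p q r > 0" and r: "orient A B r \<ge> 0" and on: "online A B p q" and AB: "A \<noteq> B"
  shows "Re (cnj (sgn (B - A)) * (q - p)) = norm (q - p)"
proof -
  have pq: "p \<noteq> q" using D by (auto simp: orient_def)
  have par: "crs (B - A) (q - p) = 0" using on by (simp add: crs_orient online_def)
  obtain t where t: "q - p = of_real t * sgn (B - A)" "\<bar>t\<bar> = norm (q - p)"
    using parallel_sgn[OF pq AB par] by metis
  have n: "cnj (sgn (B - A)) * sgn (B - A) = 1"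
    using AB by (simp add: complex_norm_square[symmetric] norm_sgn mult.commute[of "cnj _"])
  have "Re (cnj (sgn (B - A)) * (q - p)) = t"
    unfolding t(1) using n by (metis (no_types, lifting) Re_complex_of_real mult.left_commute mult.right_neutral)
  moreover have "t > 0"
  proof -
    have e: "of_real (norm (B - A)) * (q - p) = of_real t * (B - A)"
      unfolding t(1) using AB by (simp add: sgn_div_norm scaleR_conv_of_real)
    have "norm (B - A) * crs (q - p) (r - p) = t * crs (B - A) (r - p)"
      using arg_cong[OF e, of "\<lambda>x. crs x (r - p)"] by (simp only: crs_scaleR)
    then have "norm (B - A) * orient p q r = t * orient A B r"
      using on by (simp add: crs_orient[of B A r p] online_def orient_def[of p q r])
    moreover have "norm (B - A) * orient p q r > 0" using D AB by simp
    ultimately have "t * orient A B r > 0" by simp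
    then show "t > 0" using r by (simp add: zero_less_mult_iff)
  qed
  ultimately show ?thesis using t(2) by simp
qed

context
  fixes I u v w A B C
  assumes T: "weak_tiling I u v w A B C"
begin

lemma weak_neq: "A \<noteq> B" "B \<noteq> C" "C \<noteq> A"
  using T unfolding weak_tiling_def by auto

lemma linepot_tile:
  assumes i: "i \<in> I"
  shows "sgn (orient (u i) (v i) (w i)) * circulation (linepot A B) (u i) (v i) (w i) =
    of_bool (online A B (u i) (v i)) * norm (v i - u i) + of_bool (online A B (v i) (w i)) * norm (w i - v i)
    + of_bool (online A B (w i) (u i)) * norm (u i - w i)"
proof -
  have *: "circulation (linepot A B) p q r = of_bool (online A B p q) * norm (q - p) +
     of_bool (online A B q r) * norm (r - q) + of_bool (online A B r p) * norm (p - r)"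
    if D: "orient p q r > 0" and sub: "{p, q, r} \<subseteq> tri A B C" for p q r
  proof -
    have n: "orient A B z \<ge> 0" if "z \<in> {p, q, r}" for z
      using that sub weak_orient_pos[OF T] by (auto simp: mem_tri_iff)
    have D': "orient q r p > 0" "orient r p q > 0"
      using D by (simp_all add: orient_cyc[of p q r] orient_cyc[of q r p])
    have "p \<noteq> q" "q \<noteq> r" "r \<noteq> p" using D orient_nonzero_neq[of p q r] by auto
    then show ?thesis
      using online_orientation[OF D, of A B] online_orientation[OF D'(1), of A B] online_orientation[OF D'(2), of A B]
        n weak_neq(1) unfolding circulation_def by (simp add: edge_pot_linepot del: times_complex.sel)
  qed
  have sub: "{u i, v i, w i} \<subseteq> tri A B C"
    using weak_subset[OF T i] by (auto simp: tri_def hull_inc)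
  have com: "online A B q p = online A B p q" for p q by (auto simp: online_def)
  show ?thesis using weak_nz[OF T i]
  proof (cases rule: orient_pos_or)
    case 1 then show ?thesis using *[OF 1 sub] by simp
  next
    case 2
    have "sgn (orient (u i) (v i) (w i)) * circulation (linepot A B) (u i) (v i) (w i) =
       circulation (linepot A B) (u i) (w i) (v i)"
      using 2 circulation_swap[of "linepot A B" "u i" "w i" "v i"] linepot_even
      by (simp add: orient_swap[of "u i" "v i" "w i"])
    also have "\<dots> = of_bool (online A B (u i) (w i)) * norm (w i - u i) +
     of_bool (online A B (w i) (v i)) * norm (v i - w i) + of_bool (online A B (v i) (u i)) * norm (u i - v i)"
      by (rule *[OF 2]) (use sub in auto)
    finally show ?thesis
      using com[of "u i" "w i"] com[of "w i" "v i"] com[of "v i" "u i"] norm_minus_commute[of "u i" "w i"]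
        norm_minus_commute[of "w i" "v i"] norm_minus_commute[of "v i" "u i"] by simp
  qed
qed

lemma side_length:
  "norm (B - A) = (\<Sum>i\<in>I. of_bool (online A B (u i) (v i)) * norm (v i - u i)
    + of_bool (online A B (v i) (w i)) * norm (w i - v i) + of_bool (online A B (w i) (u i)) * norm (u i - w i))"
proof -
  have "(\<Sum>i\<in>I. sgn (orient (u i) (v i) (w i)) * circulation (linepot A B) (u i) (v i) (w i)) = circulation (linepot A B) A B C"
    by (rule weak_circulation[OF T]) (rule linepot_even)
  moreover have "circulation (linepot A B) A B C = norm (B - A)"
  proof -
    have "orient A B C \<noteq> 0" using weak_orient_pos[OF T] by simp
    then have off: "\<not> online A B B C" "\<not> online A B C A" by (auto simp: online_def)
    have on: "online A B A B" by (simp add: online_def orient_def)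
    show ?thesis
      using off on weak_neq online_orientation[OF weak_orient_pos[OF T], of A B] weak_orient_pos[OF T]
      unfolding circulation_def by (simp add: edge_pot_linepot del: times_complex.sel)
  qed
  ultimately show ?thesis using linepot_tile by simp
qed

lemma side_start:
  obtains i where "i \<in> I"
    "u i = A \<and> online A B (u i) (v i) \<or> v i = A \<and> online A B (u i) (v i) \<or>
     v i = A \<and> online A B (v i) (w i) \<or> w i = A \<and> online A B (v i) (w i) \<or>
     w i = A \<and> online A B (w i) (u i) \<or> u i = A \<and> online A B (w i) (u i)"
proof -
  have "(\<Sum>i\<in>I. sgn (orient (u i) (v i) (w i)) * circulation (startpot A B) (u i) (v i) (w i)) = circulation (startpot A B) A B C"
    by (rule weak_circulation[OF T]) (rule startpot_even)
  moreover have "circulation (startpot A B) A B C \<noteq> 0"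
  proof -
    have "orient A B C \<noteq> 0" using weak_orient_pos[OF T] by simp
    then have off: "\<not> online A B C A" "\<not> online A B B C" by (auto simp: online_def)
    have "edge_pot (startpot A B) A B = -1"
      using weak_neq by (simp add: edge_pot_def startpot_def)
    moreover have "edge_pot (startpot A B) B C = 0" "edge_pot (startpot A B) C A = 0"
      using off weak_neq edge_pot_startpot[of C A A B] edge_pot_startpot[of B C A B] by blast+
    ultimately show ?thesis by (simp add: circulation_def)
  qed
  ultimately obtain i where i: "i \<in> I" "circulation (startpot A B) (u i) (v i) (w i) \<noteq> 0"
    by (metis (no_types, lifting) mult_zero_right sum.neutral)
  then consider "edge_pot (startpot A B) (u i) (v i) \<noteq> 0" | "edge_pot (startpot A B) (v i) (w i) \<noteq> 0"
    | "edge_pot (startpot A B) (w i) (u i) \<noteq> 0" unfolding circulation_def by fastforce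
  then show ?thesis
    using edge_pot_startpot[of "u i" "v i" A B] edge_pot_startpot[of "v i" "w i" A B]
      edge_pot_startpot[of "w i" "u i" A B] weak_neq(1) orient_nonzero_neq[OF weak_nz[OF T i(1)]]
    by cases (rule that[OF i(1)]; blast)+
qed

end

section \<open>Tiles and embeddings of their coordinates\<close>

text \<open>The sides \<open>a\<close> and \<open>b\<close> for \<open>c = 1\<close>. For a
  conjugate of \<omega> they can be negative, and then their absolute values are the
  lengths.\<close>

definition ts :: "complex \<Rightarrow> real" where "ts \<omega> = - 2 * Re \<omega>"
definition tb :: "complex \<Rightarrow> real" where "tb \<omega> = 1 - (ts \<omega>)\<^sup>2"

text \<open>\<open>e\<close> is the direction of the unit side, and the choice of
  \<open>\<rho>\<close> allows mirror images. The angles \<alpha>, \<beta>, \<gamma> sit at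
  \<open>u\<close>, \<open>v\<close>, \<open>w\<close>. Being polynomial in \<open>e\<close>,
  \<omega> and its conjugate, the description survives ring embeddings, which conditions on lengths
  would not.\<close>

definition tile_shape :: "complex \<Rightarrow> complex \<Rightarrow> complex \<Rightarrow> complex \<Rightarrow> bool"
  where "tile_shape \<omega> u v w \<longleftrightarrow> (\<exists>e \<rho>. norm e = 1 \<and> (\<rho> = \<omega> \<or> \<rho> = cnj \<omega>) \<and> v = u + e \<and> w = u - of_real (tb \<omega>) * \<rho>\<^sup>2 * e)"

lemma ts_cnj: "ts (cnj \<omega>) = ts \<omega>" and tb_cnj: "tb (cnj \<omega>) = tb \<omega>"
  by (simp_all add: ts_def tb_def)

lemma unit_cnj: "norm e = 1 \<Longrightarrow> e * cnj e = 1" for e :: complex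
  by (simp add: complex_norm_square[symmetric])

lemma ts_eq: "of_real (ts \<omega>) = - (\<omega> + cnj \<omega>)"
  by (simp add: complex_eq_iff ts_def)

lemma unit_quadratic:
  assumes "norm \<omega> = 1" shows "\<omega>\<^sup>2 = - of_real (ts \<omega>) * \<omega> - 1"
  using unit_cnj[OF assms] by (simp add: ts_eq power2_eq_square algebra_simps)

text \<open>The edge vectors of the tile close up. Both sides become the same linear polynomial in
  \<omega> after reduction by \<open>unit_quadratic\<close>.\<close>

lemma tile_closing:
  assumes "norm \<omega> = 1" shows "1 + of_real (tb \<omega>) * \<omega>\<^sup>2 = of_real (ts \<omega>) * \<omega> ^ 3"
proof -
  let ?s = "of_real (ts \<omega>) :: complex"
  note q = unit_quadratic[OF assms]
  have "\<omega> ^ 3 = \<omega> * \<omega>\<^sup>2" by (simp add: power3_eq_cube power2_eq_square)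
  also have "\<dots> = - ?s * \<omega>\<^sup>2 - \<omega>" by (subst q) (simp add: power2_eq_square algebra_simps)
  also have "\<dots> = (?s\<^sup>2 - 1) * \<omega> + ?s" by (subst q) (simp add: power2_eq_square algebra_simps)
  finally have c: "\<omega> ^ 3 = (?s\<^sup>2 - 1) * \<omega> + ?s" .
  show ?thesis unfolding c unfolding q by (simp add: tb_def power2_eq_square algebra_simps)
qed

lemma tile_closing':
  assumes "norm \<omega> = 1" "\<rho> = \<omega> \<or> \<rho> = cnj \<omega>"
  shows "norm \<rho> = 1" "1 + of_real (tb \<omega>) * \<rho>\<^sup>2 = of_real (ts \<omega>) * \<rho> ^ 3"
  using assms tile_closing[of \<rho>] by (auto simp: ts_cnj tb_cnj)

lemma tile_norms:
  assumes "norm \<omega> = 1" "tile_shape \<omega> u v w"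
  shows "norm (v - u) = 1" "norm (u - w) = \<bar>tb \<omega>\<bar>" "norm (w - v) = \<bar>ts \<omega>\<bar>"
proof -
  obtain e \<rho> where e: "norm e = 1" and \<rho>: "\<rho> = \<omega> \<or> \<rho> = cnj \<omega>" and v: "v = u + e" and w: "w = u - of_real (tb \<omega>) * \<rho>\<^sup>2 * e"
    using assms(2) by (auto simp: tile_shape_def)
  note c = tile_closing'[OF assms(1) \<rho>]
  have "w - v = - ((1 + of_real (tb \<omega>) * \<rho>\<^sup>2) * e)" unfolding v w by (simp add: algebra_simps)
  then have "w - v = - (of_real (ts \<omega>) * \<rho> ^ 3 * e)" unfolding c .
  then show "norm (w - v) = \<bar>ts \<omega>\<bar>" using c e by (simp add: norm_mult norm_power)
  show "norm (v - u) = 1" "norm (u - w) = \<bar>tb \<omega>\<bar>" using v w e c by (simp_all add: norm_mult norm_power)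
qed

lemma tile_directions:
  assumes \<omega>: "norm \<omega> = 1" and e: "norm e = 1" and \<rho>: "\<rho> = \<omega> \<or> \<rho> = cnj \<omega>" and pos: "ts \<omega> > 0" "tb \<omega> > 0"
    and v: "v = u + e" and w: "w = u - of_real (tb \<omega>) * \<rho>\<^sup>2 * e"
  shows "sgn (v - u) = e" "sgn (w - v) = - (\<rho> ^ 3 * e)" "sgn (u - w) = \<rho>\<^sup>2 * e"
proof -
  note c = tile_closing'[OF \<omega> \<rho>]
  have wv: "w - v = - (of_real (ts \<omega>) * (\<rho> ^ 3 * e))"
  proof -
    have "w - v = - ((1 + of_real (tb \<omega>) * \<rho>\<^sup>2) * e)" unfolding v w by (simp add: algebra_simps)
    then show ?thesis unfolding c by (simp add: mult.assoc)
  qed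
  have uw: "u - w = of_real (tb \<omega>) * (\<rho>\<^sup>2 * e)" unfolding w by simp
  have sg: "sgn x = x" if "norm x = 1" for x :: complex using that by (simp add: sgn_div_norm)
  show "sgn (v - u) = e" "sgn (w - v) = - (\<rho> ^ 3 * e)" "sgn (u - w) = \<rho>\<^sup>2 * e"
    unfolding wv uw using v e c(1) pos sg[OF e] sg[of "\<rho> ^ 3 * e"] sg[of "\<rho>\<^sup>2 * e"]
    by (simp_all add: sgn_minus sgn_mult sgn_of_real norm_mult norm_power)
qed

lemma tile_orient:
  assumes "norm \<omega> = 1" "norm e = 1" "\<rho> = \<omega> \<or> \<rho> = cnj \<omega>"
  shows "orient u (u + e) (u - of_real (tb \<omega>) * \<rho>\<^sup>2 * e) = (if \<rho> = \<omega> then 1 else -1) * (- tb \<omega> * Im (\<omega>\<^sup>2))"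
proof -
  have "orient u (u + e) (u - of_real (tb \<omega>) * \<rho>\<^sup>2 * e) = Im ((e * cnj e) * (- of_real (tb \<omega>) * \<rho>\<^sup>2))"
    unfolding orient_def crs_alt by (simp add: algebra_simps)
  also have "\<dots> = - tb \<omega> * Im (\<rho>\<^sup>2)" unfolding unit_cnj[OF assms(2)] by simp
  finally show ?thesis using assms(3) by (auto simp: power2_eq_square)
qed

text \<open>The angles are arguments of quotients of edge vectors, not multiples of a fixed angle,
  so that they also cover conjugate tiles, whose \<open>ts\<close> or \<open>tb\<close> may be
  negative.\<close>

definition ang_a :: "complex \<Rightarrow> real" where "ang_a \<omega> = \<bar>Arg (- of_real (tb \<omega>) * \<omega>\<^sup>2)\<bar>"
definition ang_b :: "complex \<Rightarrow> real" where "ang_b \<omega> = \<bar>Arg (of_real (ts \<omega>) * cnj (\<omega> ^ 3))\<bar>"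
definition ang_c :: "complex \<Rightarrow> real" where "ang_c \<omega> = \<bar>Arg (of_real (ts \<omega> * tb \<omega>) * \<omega>)\<bar>"

lemma abs_Arg_cnj: "Im z \<noteq> 0 \<Longrightarrow> \<bar>Arg (cnj z)\<bar> = \<bar>Arg z\<bar>"
  using Arg_cnj[of z] by (auto simp: complex_is_Real_iff)

lemma tile_corners:
  assumes \<omega>: "norm \<omega> = 1" and k: "tb \<omega> * Im (\<omega>\<^sup>2) \<noteq> 0" and T: "tile_shape \<omega> u v w"
  shows "corner u v w = ang_a \<omega>" "corner v w u = ang_b \<omega>" "corner w u v = ang_c \<omega>"
proof -
  obtain e \<rho> where e: "norm e = 1" and \<rho>: "\<rho> = \<omega> \<or> \<rho> = cnj \<omega>" and v: "v = u + e" and w: "w = u - of_real (tb \<omega>) * \<rho>\<^sup>2 * e"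
    using T by (auto simp: tile_shape_def)
  note c = tile_closing'[OF \<omega> \<rho>]
  have ee: "e * cnj e = 1" "\<rho> * cnj \<rho> = 1" using e c(1) by (simp_all add: unit_cnj)
  have wv: "w - v = - (of_real (ts \<omega>) * \<rho> ^ 3 * e)"
  proof -
    have "w - v = - ((1 + of_real (tb \<omega>) * \<rho>\<^sup>2) * e)" unfolding v w by (simp add: algebra_simps)
    then show ?thesis unfolding c .
  qed
  have nz: "orient u v w \<noteq> 0" "orient v w u \<noteq> 0" "orient w u v \<noteq> 0"
    using tile_orient[OF \<omega> e \<rho>, of u] k unfolding v[symmetric] w[symmetric]
    by (auto simp: orient_cyc[of v w u] orient_cyc[of w u v] split: if_splits)
  have im: "Im ((w - u) * cnj (v - u)) \<noteq> 0" "Im ((u - v) * cnj (w - v)) \<noteq> 0" "Im ((v - w) * cnj (u - w)) \<noteq> 0"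
    using nz unfolding Im_orient by (simp_all add: orient_cyc[of u v w] orient_cyc[of v w u])
  have 1: "(w - u) * cnj (v - u) = - of_real (tb \<omega>) * \<rho>\<^sup>2"
  proof -
    have "(w - u) * cnj (v - u) = - of_real (tb \<omega>) * \<rho>\<^sup>2 * (e * cnj e)" unfolding v w by simp
    then show ?thesis unfolding ee by simp
  qed
  have 2: "(u - v) * cnj (w - v) = of_real (ts \<omega>) * cnj (\<rho> ^ 3)"
  proof -
    have "(u - v) * cnj (w - v) = of_real (ts \<omega>) * cnj (\<rho> ^ 3) * (e * cnj e)" unfolding wv unfolding v by simp
    then show ?thesis unfolding ee by simp
  qed
  have 3: "(v - w) * cnj (u - w) = of_real (ts \<omega> * tb \<omega>) * \<rho>"
  proof -
    have "v - w = of_real (ts \<omega>) * \<rho> ^ 3 * e" using wv by (simp add: algebra_simps)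
    moreover have "u - w = of_real (tb \<omega>) * \<rho>\<^sup>2 * e" unfolding w by simp
    ultimately have "(v - w) * cnj (u - w) = of_real (ts \<omega> * tb \<omega>) * \<rho> * (e * cnj e) * (\<rho> * cnj \<rho>)\<^sup>2"
      by (simp add: power3_eq_cube power2_eq_square)
    then show ?thesis unfolding ee by simp
  qed
  have *: "\<bar>Arg (f \<rho>)\<bar> = \<bar>Arg (f \<omega>)\<bar>" if "f (cnj \<omega>) = cnj (f \<omega>)" "Im (f \<rho>) \<noteq> 0" for f
    using \<rho> that abs_Arg_cnj[of "f \<omega>"] by auto
  show "corner u v w = ang_a \<omega>"
    using *[of "\<lambda>z. - of_real (tb \<omega>) * z\<^sup>2"] im(1) unfolding corner_def 1 ang_a_def by simp
  show "corner v w u = ang_b \<omega>"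
    using *[of "\<lambda>z. of_real (ts \<omega>) * cnj (z ^ 3)"] im(2) unfolding corner_def 2 ang_b_def by simp
  show "corner w u v = ang_c \<omega>"
    using *[of "\<lambda>z. of_real (ts \<omega> * tb \<omega>) * z"] im(3) unfolding corner_def 3 ang_c_def by simp
qed

section \<open>Embeddings of the coordinate ring and conjugate tilings\<close>

text \<open>\<open>F\<close> need not make sense outside \<open>L\<close>. Compatibility with
  \<open>cnj\<close> preserves real and unit numbers, but no order is preserved.\<close>

locale embedding =
  fixes L :: "complex set" and F :: "complex \<Rightarrow> complex" and \<omega> :: complex
  assumes L_one: "1 \<in> L" and L_add: "\<And>x y. x \<in> L \<Longrightarrow> y \<in> L \<Longrightarrow> x + y \<in> L"
    and L_uminus: "\<And>x. x \<in> L \<Longrightarrow> - x \<in> L" and L_mult: "\<And>x y. x \<in> L \<Longrightarrow> y \<in> L \<Longrightarrow> x * y \<in> L"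
    and L_cnj: "\<And>x. x \<in> L \<Longrightarrow> cnj x \<in> L" and L_\<omega>: "\<omega> \<in> L" and norm_\<omega>: "norm \<omega> = 1"
    and F_one: "F 1 = 1" and F_add: "\<And>x y. x \<in> L \<Longrightarrow> y \<in> L \<Longrightarrow> F (x + y) = F x + F y"
    and F_mult: "\<And>x y. x \<in> L \<Longrightarrow> y \<in> L \<Longrightarrow> F (x * y) = F x * F y"
    and F_cnj: "\<And>x. x \<in> L \<Longrightarrow> F (cnj x) = cnj (F x)" and F_inj: "\<And>x. x \<in> L \<Longrightarrow> F x = 0 \<Longrightarrow> x = 0"
begin

lemma L_zero: "0 \<in> L"
  using L_add[OF L_one L_uminus[OF L_one]] by simp

lemma F_zero: "F 0 = 0"
  using F_add[OF L_zero L_zero] by simp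

lemma F_uminus: "x \<in> L \<Longrightarrow> F (- x) = - F x"
  using F_add[of x "- x"] L_uminus F_zero by (simp add: eq_neg_iff_add_eq_0 add.commute)

lemma L_diff: "x \<in> L \<Longrightarrow> y \<in> L \<Longrightarrow> x - y \<in> L"
  using L_add[OF _ L_uminus] by fastforce

lemma F_diff: "x \<in> L \<Longrightarrow> y \<in> L \<Longrightarrow> F (x - y) = F x - F y"
  using F_add[of x "- y"] L_uminus F_uminus by simp

lemma F_eq: "x \<in> L \<Longrightarrow> y \<in> L \<Longrightarrow> F x = F y \<longleftrightarrow> x = y"
  using F_inj[of "x - y"] F_diff L_diff by auto

lemma L_power: "x \<in> L \<Longrightarrow> x ^ n \<in> L"
  by (induction n) (auto intro: L_mult L_one)

lemma F_power: "x \<in> L \<Longrightarrow> F (x ^ n) = F x ^ n"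
  by (induction n) (simp_all add: F_one F_mult L_power)

lemma F_unit: "x \<in> L \<Longrightarrow> norm x = 1 \<Longrightarrow> norm (F x) = 1"
proof -
  assume x: "x \<in> L" "norm x = 1"
  have "F x * cnj (F x) = F (x * cnj x)" using x by (simp add: F_mult L_cnj F_cnj)
  also have "\<dots> = 1" using x by (simp add: unit_cnj F_one)
  finally have "of_real ((norm (F x))\<^sup>2) = (1 :: complex)" by (simp add: complex_norm_square[symmetric])
  then have "(norm (F x))\<^sup>2 = 1" using of_real_eq_1_iff by blast
  then show ?thesis by (simp add: abs_square_eq_1[symmetric] power2_eq_1_iff) (use norm_ge_zero[of "F x"] in linarith)
qed

lemma F_real: "of_real x \<in> L \<Longrightarrow> F (of_real x) = of_real (Re (F (of_real x)))"
  using F_cnj[of "of_real x"] by (simp add: complex_eq_iff)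

lemma L_ts: "of_real (ts \<omega>) \<in> L" and F_ts: "F (of_real (ts \<omega>)) = of_real (ts (F \<omega>))"
proof -
  have L: "\<omega> + cnj \<omega> \<in> L" by (intro L_add L_cnj L_\<omega>)
  show "of_real (ts \<omega>) \<in> L" unfolding ts_eq by (rule L_uminus[OF L])
  show "F (of_real (ts \<omega>)) = of_real (ts (F \<omega>))"
    unfolding ts_eq F_uminus[OF L] by (simp only: F_add F_cnj L_\<omega> L_cnj)
qed

lemma L_tb: "of_real (tb \<omega>) \<in> L" and F_tb: "F (of_real (tb \<omega>)) = of_real (tb (F \<omega>))"
proof -
  have e: "(of_real (tb x) :: complex) = 1 - (of_real (ts x))\<^sup>2" for x by (simp add: tb_def)
  show "of_real (tb \<omega>) \<in> L" unfolding e by (intro L_diff L_one L_power L_ts)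
  show "F (of_real (tb \<omega>)) = of_real (tb (F \<omega>))" unfolding e
    by (simp only: F_diff[OF L_one L_power[OF L_ts]] F_power[OF L_ts] F_ts F_one)
qed

text \<open>The length of the edge lies in \<open>L\<close> and is sent to a nonzero real, possibly
  negative. So the direction of the image is \<open>F d\<close> up to a sign, which evenness of
  \<open>\<phi>\<close> absorbs.\<close>

lemma edge_pot_image:
  assumes "\<And>d x. \<phi> (- d) x = \<phi> d x" and p: "p \<in> L" and q: "q \<in> L" and "p \<noteq> q" and d: "sgn (q - p) \<in> L"
  shows "edge_pot (\<lambda>d x. if d \<in> L then \<phi> (F d) (F x) else 0) p q = edge_pot \<phi> (F p) (F q)"
proof -
  define d where "d = sgn (q - p)"
  define n where "n = norm (q - p)"
  have dL: "d \<in> L" using d d_def by simp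
  have nd: "norm d = 1" using assms by (simp add: d_def norm_sgn)
  have e: "q - p = of_real n * d" unfolding n_def d_def by (rule norm_sgn_mult)
  have "of_real n = (q - p) * cnj d" unfolding e using unit_cnj[OF nd] by simp
  then have nL: "of_real n \<in> L" using L_mult L_diff[OF q p] L_cnj[OF dL] by simp
  define m where "m = Re (F (of_real n))"
  have Fn: "F (of_real n) = of_real m" unfolding m_def by (rule F_real[OF nL])
  have "m \<noteq> 0" using F_inj[OF nL] Fn assms(4) by (auto simp: n_def)
  have "F q - F p = of_real m * F d" using F_diff[OF q p] F_mult[OF nL dL] e Fn by simp
  then have "sgn (F q - F p) = of_real (sgn m) * F d"
    using F_unit[OF dL nd] by (simp add: sgn_mult sgn_of_real) (simp add: sgn_div_norm)
  then have "sgn (F q - F p) = F d \<or> sgn (F q - F p) = - F d" using \<open>m \<noteq> 0\<close> by (cases "m > 0") auto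
  then show ?thesis unfolding edge_pot_def d_def[symmetric] using dL assms(1) by auto
qed

context
  fixes I u v w A B C
  assumes T: "weak_tiling I u v w A B C" and shape: "\<And>i. i \<in> I \<Longrightarrow> tile_shape \<omega> (u i) (v i) (w i)"
    and pos: "ts \<omega> > 0" "tb \<omega> > 0"
    and ABC: "A \<in> L" "B \<in> L" "C \<in> L" "sgn (B - A) \<in> L" "sgn (C - B) \<in> L" "sgn (A - C) \<in> L"
begin

text \<open>The three directions are \<open>e\<close> times units of \<open>L\<close>, so they lie
  in \<open>L\<close> together or not at all. If they do, the edge vectors lie in \<open>L\<close>
  as well, so the vertices are all inside or all outside. A potential supported on \<open>L\<close>
  therefore sees a tile completely or not at all.\<close>

lemma L_tile:
  assumes i: "i \<in> I"
  shows "u i \<in> L \<and> v i \<in> L \<and> w i \<in> L \<and> sgn (v i - u i) \<in> L \<and> sgn (w i - v i) \<in> L \<and> sgn (u i - w i) \<in> L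
    \<or> u i \<notin> L \<and> v i \<notin> L \<and> w i \<notin> L
    \<or> sgn (v i - u i) \<notin> L \<and> sgn (w i - v i) \<notin> L \<and> sgn (u i - w i) \<notin> L"
proof -
  obtain e \<rho> where e: "norm e = 1" and \<rho>: "\<rho> = \<omega> \<or> \<rho> = cnj \<omega>" and v: "v i = u i + e"
    and w: "w i = u i - of_real (tb \<omega>) * \<rho>\<^sup>2 * e"
    using shape[OF i] by (auto simp: tile_shape_def)
  note c = tile_closing'[OF norm_\<omega> \<rho>]
  have \<rho>L: "\<rho> \<in> L" using \<rho> L_\<omega> L_cnj by auto
  note d = tile_directions[OF norm_\<omega> e \<rho> pos v w]
  have mul: "\<rho> ^ k * e \<in> L \<longleftrightarrow> e \<in> L" for k
  proof
    assume "\<rho> ^ k * e \<in> L"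
    then have "cnj \<rho> ^ k * (\<rho> ^ k * e) \<in> L" using L_mult L_power L_cnj \<rho>L by blast
    moreover have "cnj \<rho> ^ k * (\<rho> ^ k * e) = (\<rho> * cnj \<rho>) ^ k * e" by (simp add: power_mult_distrib)
    ultimately show "e \<in> L" using unit_cnj[OF c(1)] by simp
  qed (use L_mult L_power \<rho>L in blast)
  have eL: "sgn (v i - u i) \<in> L \<longleftrightarrow> e \<in> L" "sgn (w i - v i) \<in> L \<longleftrightarrow> e \<in> L" "sgn (u i - w i) \<in> L \<longleftrightarrow> e \<in> L"
    using d mul[of 3] mul[of 2] L_uminus[of "\<rho> ^ 3 * e"] L_uminus[of "- (\<rho> ^ 3 * e)"] by auto
  show ?thesis
  proof (cases "e \<in> L")
    case False then show ?thesis using eL by simp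
  next
    case True
    have sh: "x \<in> L \<longleftrightarrow> x + y \<in> L" if "y \<in> L" for x y
      using that L_add[of x y] L_diff[of "x + y" y] by auto
    have "u i \<in> L \<longleftrightarrow> v i \<in> L" unfolding v by (rule sh[OF True])
    moreover have "w i \<in> L \<longleftrightarrow> u i \<in> L"
    proof -
      have "u i = w i + of_real (tb \<omega>) * \<rho>\<^sup>2 * e" unfolding w by simp
      then show ?thesis using sh[of "of_real (tb \<omega>) * \<rho>\<^sup>2 * e" "w i"] L_mult L_tb L_power[OF \<rho>L] True by auto
    qed
    ultimately show ?thesis using eL True by blast
  qed
qed

definition good :: "'a set"
  where "good = {i \<in> I. u i \<in> L \<and> v i \<in> L \<and> w i \<in> L \<and> sgn (v i - u i) \<in> L \<and> sgn (w i - v i) \<in> L \<and> sgn (u i - w i) \<in> L}"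

lemma good_circulation:
  assumes even: "\<And>d x. \<psi> (- d) x = \<psi> d x"
  shows "(\<Sum>i\<in>good. sgn (orient (u i) (v i) (w i)) *
      circulation (\<lambda>d x. if d \<in> L then \<psi> d x else 0) (u i) (v i) (w i))
    = circulation (\<lambda>d x. if d \<in> L then \<psi> d x else 0) A B C"
proof -
  let ?\<psi> = "\<lambda>d x. if d \<in> L \<and> x \<in> L then \<psi> d x else 0"
  have "- d \<in> L \<longleftrightarrow> d \<in> L" for d using L_uminus[of d] L_uminus[of "- d"] by auto
  then have ev: "?\<psi> (- d) x = ?\<psi> d x" for d x by (simp only: even)
  have in_L: "circulation ?\<psi> p q r = circulation (\<lambda>d x. if d \<in> L then \<psi> d x else 0) p q r"
    if "p \<in> L" "q \<in> L" "r \<in> L" for p q r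
    using that by (simp add: circulation_def edge_pot_def)
  have fin: "finite I" using weak_fin[OF T] .
  have "circulation (\<lambda>d x. if d \<in> L then \<psi> d x else 0) A B C = circulation ?\<psi> A B C"
    by (rule in_L[symmetric]) (use ABC in auto)
  also have "\<dots> = (\<Sum>i\<in>I. sgn (orient (u i) (v i) (w i)) * circulation ?\<psi> (u i) (v i) (w i))"
    by (rule weak_circulation[OF T, of ?\<psi>, OF ev, symmetric])
  also have "\<dots> = (\<Sum>i\<in>good. sgn (orient (u i) (v i) (w i)) * circulation ?\<psi> (u i) (v i) (w i))"
  proof (rule sum.mono_neutral_right[OF fin])
    show "\<forall>i\<in>I - good. sgn (orient (u i) (v i) (w i)) * circulation ?\<psi> (u i) (v i) (w i) = 0"
    proof
      fix i assume i: "i \<in> I - good"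
      then consider "u i \<notin> L \<and> v i \<notin> L \<and> w i \<notin> L" |
        "sgn (v i - u i) \<notin> L \<and> sgn (w i - v i) \<notin> L \<and> sgn (u i - w i) \<notin> L"
        using L_tile[of i] unfolding good_def by blast
      then have "circulation ?\<psi> (u i) (v i) (w i) = 0"
        unfolding circulation_def edge_pot_def by cases simp_all
      then show "sgn (orient (u i) (v i) (w i)) * circulation ?\<psi> (u i) (v i) (w i) = 0" by simp
    qed
  qed (auto simp: good_def)
  also have "\<dots> = (\<Sum>i\<in>good. sgn (orient (u i) (v i) (w i)) *
      circulation (\<lambda>d x. if d \<in> L then \<psi> d x else 0) (u i) (v i) (w i))"
  proof (rule sum.cong[OF refl])
    fix i assume "i \<in> good"
    then have "u i \<in> L" "v i \<in> L" "w i \<in> L" by (auto simp: good_def)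
    then show "sgn (orient (u i) (v i) (w i)) * circulation ?\<psi> (u i) (v i) (w i) =
       sgn (orient (u i) (v i) (w i)) * circulation (\<lambda>d x. if d \<in> L then \<psi> d x else 0) (u i) (v i) (w i)"
      by (simp only: in_L)
  qed
  finally show ?thesis by simp
qed

lemma good_nonempty: "good \<noteq> {}"
proof
  assume "good = {}"
  then have "circulation (\<lambda>d x. if d \<in> L then areapot d x else 0) A B C = 0"
    using good_circulation[of areapot, OF areapot_even] by simp
  moreover have "circulation (\<lambda>d x. if d \<in> L then areapot d x else 0) A B C = circulation areapot A B C"
    using ABC by (simp add: circulation_def edge_pot_def)
  ultimately show False
    using circulation_areapot weak_neq[OF T] weak_orient_pos[OF T] by auto
qed

text \<open>The sign of a tile is the sign of \<open>- tb \<omega> * Im (\<omega>\<^sup>2)\<close>,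
  reversed for mirror images, and injectivity of \<open>F\<close> preserves being a mirror image.
  The two positivity assumptions thus keep every sign in the circulation identity, which is then the
  old identity for the potential composed with \<open>F\<close>.\<close>

theorem weak_tiling_image:
  assumes k: "- tb \<omega> * Im (\<omega>\<^sup>2) > 0" "- tb (F \<omega>) * Im ((F \<omega>)\<^sup>2) > 0"
  shows "weak_tiling good (\<lambda>i. F (u i)) (\<lambda>i. F (v i)) (\<lambda>i. F (w i)) (F A) (F B) (F C)"
    and "i \<in> good \<Longrightarrow> tile_shape (F \<omega>) (F (u i)) (F (v i)) (F (w i))"
proof -
  have nF: "norm (F \<omega>) = 1" by (rule F_unit[OF L_\<omega> norm_\<omega>])
  have *: "tile_shape (F \<omega>) (F (u i)) (F (v i)) (F (w i)) \<and>
      orient (F (u i)) (F (v i)) (F (w i)) \<noteq> 0 \<and>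
      sgn (orient (F (u i)) (F (v i)) (F (w i))) = sgn (orient (u i) (v i) (w i))" if i: "i \<in> good" for i
  proof -
    have iI: "i \<in> I" using i by (simp add: good_def)
    obtain e \<rho> where e: "norm e = 1" and \<rho>: "\<rho> = \<omega> \<or> \<rho> = cnj \<omega>" and v: "v i = u i + e"
      and w: "w i = u i - of_real (tb \<omega>) * \<rho>\<^sup>2 * e"
      using shape[OF iI] by (auto simp: tile_shape_def)
    have uL: "u i \<in> L" and eL: "e \<in> L" using i L_diff[of "v i" "u i"] v by (auto simp: good_def)
    have \<rho>L: "\<rho> \<in> L" using \<rho> L_\<omega> L_cnj by auto
    have Fv: "F (v i) = F (u i) + F e" unfolding v by (rule F_add[OF uL eL])
    have "F (w i) = F (u i) - F (of_real (tb \<omega>) * \<rho>\<^sup>2 * e)" unfolding w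
      by (rule F_diff[OF uL]) (intro L_mult L_power L_tb \<rho>L eL)
    also have "F (of_real (tb \<omega>) * \<rho>\<^sup>2 * e) = of_real (tb (F \<omega>)) * (F \<rho>)\<^sup>2 * F e"
      by (simp add: F_mult F_power L_mult L_power L_tb \<rho>L eL F_tb)
    finally have Fw: "F (w i) = F (u i) - of_real (tb (F \<omega>)) * (F \<rho>)\<^sup>2 * F e" .
    have ne: "norm (F e) = 1" by (rule F_unit[OF eL e])
    have F\<rho>: "F \<rho> = F \<omega> \<or> F \<rho> = cnj (F \<omega>)" using \<rho> F_cnj[OF L_\<omega>] by auto
    have \<rho>eq: "F \<rho> = F \<omega> \<longleftrightarrow> \<rho> = \<omega>" by (rule F_eq[OF \<rho>L L_\<omega>])
    have "tile_shape (F \<omega>) (F (u i)) (F (v i)) (F (w i))"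
      using ne F\<rho> Fv Fw unfolding tile_shape_def by blast
    moreover
    have o1: "orient (u i) (v i) (w i) = (if \<rho> = \<omega> then 1 else -1) * (- tb \<omega> * Im (\<omega>\<^sup>2))"
      using tile_orient[OF norm_\<omega> e \<rho>, of "u i"] unfolding v[symmetric] w[symmetric] .
    have o2: "orient (F (u i)) (F (v i)) (F (w i)) = (if \<rho> = \<omega> then 1 else -1) * (- tb (F \<omega>) * Im ((F \<omega>)\<^sup>2))"
      using tile_orient[OF nF ne F\<rho>, of "F (u i)"] unfolding Fv[symmetric] Fw[symmetric] \<rho>eq .
    have "sgn (- tb \<omega> * Im (\<omega>\<^sup>2)) = 1" "sgn (- tb (F \<omega>) * Im ((F \<omega>)\<^sup>2)) = 1" using k by (simp_all only: sgn_pos)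
    then have "orient (F (u i)) (F (v i)) (F (w i)) \<noteq> 0"
      "sgn (orient (F (u i)) (F (v i)) (F (w i))) = sgn (orient (u i) (v i) (w i))"
      using k(2) unfolding o1 o2 sgn_mult[of "if _ then _ else _"] by auto
    ultimately show ?thesis by blast
  qed
  then show "i \<in> good \<Longrightarrow> tile_shape (F \<omega>) (F (u i)) (F (v i)) (F (w i))" by blast
  have neq: "A \<noteq> B" "B \<noteq> C" "C \<noteq> A" using weak_neq[OF T] .
  show "weak_tiling good (\<lambda>i. F (u i)) (\<lambda>i. F (v i)) (\<lambda>i. F (w i)) (F A) (F B) (F C)"
    unfolding weak_tiling_def
  proof (intro conjI allI impI ballI)
    show "finite good" using weak_fin[OF T] by (simp add: good_def)
    show "good \<noteq> {}" by (rule good_nonempty)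
    show "F A \<noteq> F B" "F B \<noteq> F C" "F C \<noteq> F A" using neq F_eq ABC by auto
    show "orient (F (u i)) (F (v i)) (F (w i)) \<noteq> 0" if "i \<in> good" for i using *[OF that] by blast
    fix \<phi> :: "complex \<Rightarrow> complex \<Rightarrow> real" assume "\<forall>d x. \<phi> (- d) x = \<phi> d x"
    then have ev: "\<phi> (- d) x = \<phi> d x" for d x by blast
    let ?\<psi> = "\<lambda>d x. if d \<in> L then \<phi> (F d) (F x) else 0"
    have ev': "?\<psi> (- d) x = ?\<psi> d x" for d x
      using L_uminus[of d] L_uminus[of "- d"] F_uminus[of d] ev by auto
    have img: "circulation ?\<psi> p q r = circulation \<phi> (F p) (F q) (F r)"
      if "p \<in> L" "q \<in> L" "r \<in> L" "p \<noteq> q" "q \<noteq> r" "r \<noteq> p" "sgn (q - p) \<in> L" "sgn (r - q) \<in> L" "sgn (p - r) \<in> L"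
      for p q r
      unfolding circulation_def using that edge_pot_image[of \<phi>, OF ev] by simp
    have "(\<Sum>i\<in>good. sgn (orient (u i) (v i) (w i)) * circulation ?\<psi> (u i) (v i) (w i)) = circulation ?\<psi> A B C"
      using good_circulation[of ?\<psi>, OF ev'] by (simp cong: if_cong)
    also have "\<dots> = circulation \<phi> (F A) (F B) (F C)" by (rule img) (use ABC neq in auto)
    also have "(\<Sum>i\<in>good. sgn (orient (u i) (v i) (w i)) * circulation ?\<psi> (u i) (v i) (w i)) =
      (\<Sum>i\<in>good. sgn (orient (F (u i)) (F (v i)) (F (w i))) * circulation \<phi> (F (u i)) (F (v i)) (F (w i)))"
    proof (rule sum.cong[OF refl])
      fix i assume i: "i \<in> good"
      then have "orient (u i) (v i) (w i) \<noteq> 0" using weak_nz[OF T] by (simp add: good_def)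
      then have "circulation ?\<psi> (u i) (v i) (w i) = circulation \<phi> (F (u i)) (F (v i)) (F (w i))"
        using i orient_nonzero_neq[of "u i" "v i" "w i"] by (intro img) (auto simp: good_def)
      then show "sgn (orient (u i) (v i) (w i)) * circulation ?\<psi> (u i) (v i) (w i) =
         sgn (orient (F (u i)) (F (v i)) (F (w i))) * circulation \<phi> (F (u i)) (F (v i)) (F (w i))"
        using *[OF i] by simp
    qed
    finally show "(\<Sum>i\<in>good. sgn (orient (F (u i)) (F (v i)) (F (w i))) * circulation \<phi> (F (u i)) (F (v i)) (F (w i)))
      = circulation \<phi> (F A) (F B) (F C)" .
  qed
qed

end

end

section \<open>Counting corners, sides and area\<close>

text \<open>The three quotients multiply to a negative real, so the sum is an odd multiple of
  \<open>pi\<close>; it lies strictly between 0 and \<open>3 * pi\<close>.\<close>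

lemma corner_sum:
  assumes D: "orient p q r > 0"
  shows "corner p q r + corner q r p + corner r p q = pi"
proof -
  have D': "orient q r p > 0" "orient r p q > 0"
    using D by (simp_all add: orient_cyc[of p q r] orient_cyc[of q r p])
  let ?x = "(r - p) * cnj (q - p)" and ?y = "(p - q) * cnj (r - q)" and ?z = "(q - r) * cnj (p - r)"
  define S where "S = corner p q r + corner q r p + corner r p q"
  have c: "corner p q r = Arg ?x" "corner q r p = Arg ?y" "corner r p q = Arg ?z"
    using Arg_pos_orient[OF D] Arg_pos_orient[OF D'(1)] Arg_pos_orient[OF D'(2)] by (simp_all add: corner_def)
  have S: "0 < S" "S < 3 * pi" "Arg ?x + Arg ?y > 0" "Arg ?x > 0" "Arg ?y > 0" "Arg ?z > 0"
    using Arg_pos_orient[OF D] Arg_pos_orient[OF D'(1)] Arg_pos_orient[OF D'(2)] unfolding S_def c by linarith+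
  define k where "k = (norm (q - p))\<^sup>2 * (norm (r - q))\<^sup>2 * (norm (p - r))\<^sup>2"
  have ne: "p \<noteq> q" "q \<noteq> r" "r \<noteq> p" using D orient_nonzero_neq[of p q r] by auto
  have k: "k > 0" unfolding k_def using ne by simp
  have "?x * ?y * ?z = - (((q - p) * cnj (q - p)) * ((r - q) * cnj (r - q)) * ((p - r) * cnj (p - r)))"
  proof -
    have "(r - p) = - (p - r)" "(p - q) = - (q - p)" "(q - r) = - (r - q)" by simp_all
    then have "?x * ?y * ?z = (- (p - r)) * cnj (q - p) * ((- (q - p)) * cnj (r - q)) * ((- (r - q)) * cnj (p - r))"
      by metis
    then show ?thesis by (simp only: mult_minus_left mult_minus_right minus_minus mult_ac)
  qed
  also have "\<dots> = - of_real k"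
    unfolding k_def by (simp only: complex_norm_square[symmetric] of_real_mult)
  finally have 1: "?x * ?y * ?z = - of_real k" .
  have "x * y * z = of_real (norm x * norm y * norm z) * (cis (Arg x) * cis (Arg y) * cis (Arg z))" for x y z
  proof -
    have dec: "of_real (norm x) * cis (Arg x) = x" for x by (metis rcis_cmod_Arg rcis_def)
    have "of_real a * a' * (of_real b * b') * (of_real c * c') = of_real (a * b * c) * (a' * b' * c')" for a b c and a' b' c' :: complex
      by (simp add: mult_ac)
    from this[of "norm x" "cis (Arg x)" "norm y" "cis (Arg y)" "norm z" "cis (Arg z)"] show ?thesis
      by (simp only: dec)
  qed
  then have "?x * ?y * ?z = of_real (norm ?x * norm ?y * norm ?z) * (cis (Arg ?x) * cis (Arg ?y) * cis (Arg ?z))" .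
  also have "cis (Arg ?x) * cis (Arg ?y) * cis (Arg ?z) = cis S"
    unfolding S_def c by (simp add: cis_mult)
  finally have 2: "?x * ?y * ?z = of_real (norm ?x * norm ?y * norm ?z) * cis S" .
  have "norm ?x * norm ?y * norm ?z = k"
    using arg_cong[OF 1, of norm] k by (simp add: norm_mult)
  then have "of_real k * cis S = - of_real k" using 1 2 by metis
  then have "of_real k * (cis S + 1) = 0" by (simp add: algebra_simps)
  then have "cis S = -1" using k by (simp add: eq_neg_iff_add_eq_0)
  then have "cos (S - pi) = 1" by (simp add: complex_eq_iff)
  then obtain n :: int where n: "S - pi = of_int n * 2 * pi" using cos_one_2pi_int by blast
  then have "of_int n * (2 * pi) < 1 * (2 * pi)" "of_int n * (2 * pi) > (-1) * (2 * pi)"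
    using S(1,2) pi_gt_zero by linarith+
  then have "of_int n < (1::real)" "of_int n > (-1::real)" by (simp_all only: mult_less_cancel_right) auto
  then have "n = 0" by linarith
  then show ?thesis using n S_def by simp
qed

lemma sgn_corner:
  assumes D: "orient p q r > 0"
  shows "sgn (r - p) = sgn (q - p) * cis (corner p q r)"
proof -
  let ?x = "(r - p) * cnj (q - p)"
  have ne: "p \<noteq> q" "q \<noteq> r" "r \<noteq> p" using D orient_nonzero_neq[of p q r] by auto
  have c: "corner p q r = Arg ?x"
    using Arg_pos_orient[OF D] by (simp add: corner_def)
  have "cis (Arg ?x) = sgn ?x" using ne by (intro cis_Arg) auto
  also have "\<dots> = sgn (r - p) * cnj (sgn (q - p))"
  proof -
    have "sgn (cnj z) = cnj (sgn z)" for z by (simp add: sgn_div_norm)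
    then show ?thesis by (simp only: sgn_mult)
  qed
  finally have "sgn (q - p) * cis (corner p q r) = sgn (r - p) * (sgn (q - p) * cnj (sgn (q - p)))"
    unfolding c by (simp add: mult_ac)
  also have "\<dots> = sgn (r - p)" using unit_cnj[of "sgn (q - p)"] ne by (simp add: norm_sgn)
  finally show ?thesis by simp
qed

lemma sum_of_bool_card: "finite I \<Longrightarrow> (\<Sum>i\<in>I. of_bool (P i) :: real) = real (card {i \<in> I. P i})"
  by (simp add: of_bool_def sum.If_cases Int_def)

lemma corner_count:
  assumes T: "weak_tiling I u v w A B C" and shape: "\<And>i. i \<in> I \<Longrightarrow> tile_shape \<omega> (u i) (v i) (w i)"
    and \<omega>: "norm \<omega> = 1" and k: "tb \<omega> * Im (\<omega>\<^sup>2) \<noteq> 0"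
  shows "corner A B C = real (card {i \<in> I. u i = A}) * ang_a \<omega> + real (card {i \<in> I. v i = A}) * ang_b \<omega>
    + real (card {i \<in> I. w i = A}) * ang_c \<omega>"
proof -
  have fin: "finite I" by (rule weak_fin[OF T])
  have "corner A B C = (\<Sum>i\<in>I. of_bool (u i = A) * ang_a \<omega> + of_bool (v i = A) * ang_b \<omega> + of_bool (w i = A) * ang_c \<omega>)"
    unfolding weak_corner[OF T] by (rule sum.cong[OF refl]) (simp add: tile_corners[OF \<omega> k shape])
  also have "\<dots> = (\<Sum>i\<in>I. of_bool (u i = A)) * ang_a \<omega> + (\<Sum>i\<in>I. of_bool (v i = A)) * ang_b \<omega> + (\<Sum>i\<in>I. of_bool (w i = A)) * ang_c \<omega>"
    by (simp add: sum.distrib sum_distrib_right)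
  finally show ?thesis by (simp only: sum_of_bool_card[OF fin])
qed

lemma side_count:
  assumes T: "weak_tiling I u v w A B C" and shape: "\<And>i. i \<in> I \<Longrightarrow> tile_shape \<omega> (u i) (v i) (w i)"
    and \<omega>: "norm \<omega> = 1" and pos: "ts \<omega> > 0" "tb \<omega> > 0"
  shows "norm (B - A) = real (card {i \<in> I. online A B (v i) (w i)}) * ts \<omega>
    + real (card {i \<in> I. online A B (w i) (u i)}) * tb \<omega> + real (card {i \<in> I. online A B (u i) (v i)})"
proof -
  have fin: "finite I" by (rule weak_fin[OF T])
  have "norm (B - A) = (\<Sum>i\<in>I. of_bool (online A B (v i) (w i)) * ts \<omega> + of_bool (online A B (w i) (u i)) * tb \<omega>
    + of_bool (online A B (u i) (v i)))"
    unfolding side_length[OF T] by (rule sum.cong[OF refl]) (use tile_norms[OF \<omega> shape] pos in simp)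
  also have "\<dots> = (\<Sum>i\<in>I. of_bool (online A B (v i) (w i))) * ts \<omega> + (\<Sum>i\<in>I. of_bool (online A B (w i) (u i))) * tb \<omega> + (\<Sum>i\<in>I. of_bool (online A B (u i) (v i)))"
    by (simp add: sum.distrib sum_distrib_right)
  finally show ?thesis by (simp only: sum_of_bool_card[OF fin])
qed

text \<open>If only \<alpha> vertices meet at \<open>A\<close>, the side \<open>AB\<close> starts
  there with an edge adjacent to \<alpha>, hence with \<open>b\<close> or \<open>c\<close> and not
  with \<open>a\<close>.\<close>

lemma side_not_a:
  assumes T: "weak_tiling I u v w A B C" and only: "\<And>i. i \<in> I \<Longrightarrow> v i \<noteq> A \<and> w i \<noteq> A"
  shows "card {i \<in> I. online A B (w i) (u i)} + card {i \<in> I. online A B (u i) (v i)} > 0"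
proof -
  have fin: "finite I" by (rule weak_fin[OF T])
  obtain i where i: "i \<in> I" "u i = A \<and> online A B (u i) (v i) \<or> v i = A \<and> online A B (u i) (v i) \<or>
     v i = A \<and> online A B (v i) (w i) \<or> w i = A \<and> online A B (v i) (w i) \<or>
     w i = A \<and> online A B (w i) (u i) \<or> u i = A \<and> online A B (w i) (u i)"
    using side_start[OF T] .
  then have "{i \<in> I. online A B (w i) (u i)} \<noteq> {} \<or> {i \<in> I. online A B (u i) (v i)} \<noteq> {}"
    using only[OF i(1)] by blast
  then show ?thesis using fin by (auto simp: card_gt_0_iff)
qed

lemma area_count:
  assumes T: "weak_tiling I u v w A B C" and shape: "\<And>i. i \<in> I \<Longrightarrow> tile_shape \<omega> (u i) (v i) (w i)"
    and \<omega>: "norm \<omega> = 1"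
  shows "orient A B C = real (card I) * \<bar>tb \<omega> * Im (\<omega>\<^sup>2)\<bar>"
proof -
  have "\<bar>orient (u i) (v i) (w i)\<bar> = \<bar>tb \<omega> * Im (\<omega>\<^sup>2)\<bar>" if i: "i \<in> I" for i
  proof -
    obtain e \<rho> where e: "norm e = 1" and \<rho>: "\<rho> = \<omega> \<or> \<rho> = cnj \<omega>" and v: "v i = u i + e" and w: "w i = u i - of_real (tb \<omega>) * \<rho>\<^sup>2 * e"
      using shape[OF i] by (auto simp: tile_shape_def)
    show ?thesis using tile_orient[OF \<omega> e \<rho>, of "u i"] unfolding v[symmetric] w[symmetric] by (auto simp: abs_mult)
  qed
  then show ?thesis unfolding weak_area[OF T] by simp
qed

text \<open>The bounds express positivity of \<open>\<alpha> = 2 * \<delta>\<close> and of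
  \<open>\<beta> = pi / 2 - 3 * \<delta>\<close>; the third angle is
  \<open>pi / 2 + \<delta>\<close>.\<close>

locale tile_angle =
  fixes \<delta> :: real
  assumes \<delta>: "0 < \<delta>" "\<delta> < pi / 6"
begin

definition "\<omega> = cis (pi / 2 + \<delta>)"
definition "s = 2 * sin \<delta>"

lemma norm_\<omega>: "norm \<omega> = 1" by (simp add: \<omega>_def)

lemma ts_\<omega>: "ts \<omega> = s"
  by (simp add: ts_def \<omega>_def s_def cos_add)

lemma tb_\<omega>: "tb \<omega> = 1 - s\<^sup>2"
  by (simp add: tb_def ts_\<omega>)

lemma s_pos: "0 < s"
  unfolding s_def using \<delta> by (intro mult_pos_pos sin_gt_zero) auto

lemma s_less_1: "s < 1"
proof -
  have "sin \<delta> < sin (pi / 6)" using \<delta> by (intro sin_monotone_2pi) auto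
  then show ?thesis by (simp add: s_def sin_30)
qed

lemma tb_pos: "0 < 1 - s\<^sup>2"
  using s_pos s_less_1 by (simp add: abs_square_less_1)

lemma \<omega>_powers: "- (\<omega>\<^sup>2) = cis (2 * \<delta>)" "cnj (\<omega> ^ 3) = cis (pi / 2 - 3 * \<delta>)"
proof -
  have "\<omega>\<^sup>2 = cis (real 2 * (pi / 2 + \<delta>))" unfolding \<omega>_def Complex.DeMoivre by (rule refl)
  also have "real 2 * (pi / 2 + \<delta>) = pi + 2 * \<delta>" by (simp add: algebra_simps)
  finally have "\<omega>\<^sup>2 = cis (pi + 2 * \<delta>)" .
  then show "- (\<omega>\<^sup>2) = cis (2 * \<delta>)" by (simp add: cis_mult[symmetric])
  have "cnj (\<omega> ^ 3) = cis (- (3 * (pi / 2 + \<delta>)))" unfolding \<omega>_def Complex.DeMoivre by (simp add: cis_cnj)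
  also have "- (3 * (pi / 2 + \<delta>)) = (pi / 2 - 3 * \<delta>) - 2 * pi" by (simp add: algebra_simps)
  also have "cis (x - 2 * pi) = cis x" for x by (simp add: cis_divide[symmetric])
  finally show "cnj (\<omega> ^ 3) = cis (pi / 2 - 3 * \<delta>)" .
qed

lemma orient_eq: "- tb \<omega> * Im (\<omega>\<^sup>2) = (1 - s\<^sup>2) * sin (2 * \<delta>)"
proof -
  have "Im (\<omega>\<^sup>2) = - sin (2 * \<delta>)" using arg_cong[OF \<omega>_powers(1), of Im] by simp
  then show ?thesis by (simp only: tb_\<omega> mult_minus_left mult_minus_right minus_minus)
qed

lemma orient_sign: "- tb \<omega> * Im (\<omega>\<^sup>2) > 0"
proof -
  have "sin (2 * \<delta>) > 0" using \<delta> by (intro sin_gt_zero) auto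
  then show ?thesis unfolding orient_eq using tb_pos by simp
qed

lemma area_const: "\<bar>tb \<omega> * Im (\<omega>\<^sup>2)\<bar> = (1 - s\<^sup>2) * sin (2 * \<delta>)"
  using orient_sign orient_eq by linarith

lemma Arg_cis_scaled: "0 < c \<Longrightarrow> - pi < x \<Longrightarrow> x \<le> pi \<Longrightarrow> Arg (of_real c * cis x) = x"
  by (rule cis_Arg_unique) (simp_all add: sgn_mult sgn_of_real sgn_cis)

lemma angs: "ang_a \<omega> = 2 * \<delta>" "ang_b \<omega> = pi / 2 - 3 * \<delta>" "ang_c \<omega> = pi / 2 + \<delta>"
proof -
  have "- of_real (tb \<omega>) * \<omega>\<^sup>2 = of_real (1 - s\<^sup>2) * cis (2 * \<delta>)"
    unfolding \<omega>_powers(1)[symmetric] tb_\<omega> by (simp add: algebra_simps)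
  then show "ang_a \<omega> = 2 * \<delta>" unfolding ang_a_def
    using \<delta> Arg_cis_scaled[OF tb_pos, of "2 * \<delta>"] by simp
  show "ang_b \<omega> = pi / 2 - 3 * \<delta>" unfolding ang_b_def \<omega>_powers(2) ts_\<omega>
    using \<delta> Arg_cis_scaled[OF s_pos, of "pi / 2 - 3 * \<delta>"] by simp
  show "ang_c \<omega> = pi / 2 + \<delta>" unfolding ang_c_def ts_\<omega> tb_\<omega> unfolding \<omega>_def
    using \<delta> Arg_cis_scaled[of "s * (1 - s\<^sup>2)" "pi / 2 + \<delta>"] s_pos tb_pos by simp
qed

lemma cis_angs:
  "cis (real p * (2 * \<delta>) + real q * (pi / 2 - 3 * \<delta>) + real r * (pi / 2 + \<delta>)) = (- (\<omega>\<^sup>2)) ^ p * (cnj (\<omega> ^ 3)) ^ q * \<omega> ^ r"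
  unfolding \<omega>_powers unfolding \<omega>_def Complex.DeMoivre by (simp add: cis_mult)

end

lemma rational_linear:
  fixes s x y :: real
  assumes "s \<notin> \<rat>" "x \<in> \<rat>" "y \<in> \<rat>" "x + y * s = 0"
  shows "x = 0 \<and> y = 0"
proof (cases "y = 0")
  case False
  then have "s = - x / y" using assms(4) by (simp add: field_simps eq_neg_iff_add_eq_0)
  then have "s \<in> \<rat>" using assms by simp
  then show ?thesis using assms(1) by simp
qed (use assms in simp)

section \<open>Angles incommensurable with \<open>pi\<close>\<close>

context
  fixes s :: real
  assumes s: "0 < s" "s < 1" and irr: "s \<notin> \<rat>"
begin

text \<open>Corners \<open>\<alpha> + \<beta>\<close>, \<open>\<alpha> + \<beta>\<close>, \<alpha>
  with sides \<open>X\<close>, \<open>X\<close>, \<open>s * X\<close>. After cancelling a factor,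
  each character makes \<open>X\<close> an integer multiple of \<open>1 - s\<close> or of
  \<open>1 + s\<close>, incompatible for irrational \<open>s\<close>.\<close>

lemma shape_sum_apex:
  assumes X: "X > 0"
    and 1: "- X - X - s * X = of_int t1 * ((1 - s) * (2 + s))"
    and 2: "X + X - s * X = of_int t2 * ((2 - s) * (1 + s))"
  shows False
proof -
  have "(2 + s) * (X + of_int t1 * (1 - s)) = 0" using 1 by (simp add: algebra_simps)
  then have e1: "X = - of_int t1 * (1 - s)" using s by auto
  have "(2 - s) * (X - of_int t2 * (1 + s)) = 0" using 2 by (simp add: algebra_simps)
  then have e2: "X = of_int t2 * (1 + s)" using s by auto
  have "of_int (t1 + t2) + of_int (t2 - t1) * s = 0" using e1 e2 by (simp add: algebra_simps)
  then have "of_int (t1 + t2) = (0::real) \<and> of_int (t2 - t1) = (0::real)" by (intro rational_linear[OF irr]) auto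
  then have "t1 = 0" by simp
  then show False using e1 X by simp
qed

text \<open>Corners \<beta>, \<beta>, \<open>3 * \<alpha>\<close>. The characters make both
  \<open>(1 - s) * X\<close> and \<open>(1 + s) * X\<close> integers, so \<open>s\<close> would be
  rational.\<close>

lemma shape_beta_apex:
  assumes X: "X > 0"
    and 1: "X + X - (3 * s - s ^ 3) * X = of_int t1 * ((1 - s) * (2 + s))"
    and 2: "- X - X - (3 * s - s ^ 3) * X = of_int t2 * ((2 - s) * (1 + s))"
  shows False
proof -
  have "(1 - s) * (2 + s) * ((1 - s) * X - of_int t1) = 0"
    using 1 by (simp add: algebra_simps power3_eq_cube)
  then have e1: "(1 - s) * X = of_int t1" using s by auto
  have "(2 - s) * (1 + s) * ((1 + s) * X + of_int t2) = 0"
    using 2 by (simp add: algebra_simps power3_eq_cube)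
  then have e2: "(1 + s) * X = - of_int t2" using s by auto
  have "of_int t1 * (1 + s) = - of_int t2 * (1 - s)" unfolding e1[symmetric] using e2 by algebra
  then have "of_int (t1 + t2) + of_int (t1 - t2) * s = 0" by (simp add: algebra_simps)
  then have "of_int (t1 + t2) = (0::real) \<and> of_int (t1 - t2) = (0::real)" by (intro rational_linear[OF irr]) auto
  then have "t1 = 0" by simp
  then show False using e1 X s by simp
qed

text \<open>When both characters give the same left-hand side, they yield only a quadratic equation
  for \<open>s\<close> over the rationals. Its reduction turns the area equation into a linear one
  in \<open>s\<close>.\<close>

lemma quadratic_case:
  assumes t: "of_int t1 * ((1 - s) * (2 + s)) = of_int t2 * ((2 - s) * (1 + s))" "t1 \<noteq> 0"
  obtains k where "k \<in> \<rat>" "s\<^sup>2 = 2 - k * s" "of_int t1 - of_int t2 \<noteq> (0::real)"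
    "of_int t1 + of_int t2 = k * (of_int t1 - of_int t2)"
proof -
  have e: "of_int (t1 - t2) * (2 - s\<^sup>2) = of_int (t1 + t2) * s"
    using t(1) by (simp add: algebra_simps power2_eq_square)
  have ne: "t1 \<noteq> t2"
  proof
    assume "t1 = t2"
    then show False using e s t(2) by simp
  qed
  define k where "k = real_of_int (t1 + t2) / of_int (t1 - t2)"
  show ?thesis
  proof (rule that[of k])
    show "k \<in> \<rat>" by (simp add: k_def)
    have "2 - s\<^sup>2 = k * s" using e ne by (simp add: k_def field_simps)
    then show "s\<^sup>2 = 2 - k * s" by simp
    show "of_int t1 - of_int t2 \<noteq> (0::real)" using ne by simp
    then show "of_int t1 + of_int t2 = k * (of_int t1 - of_int t2)" by (simp add: k_def)
  qed
qed

text \<open>Corners \<open>\<alpha> + 2 * \<beta>\<close>, \<alpha>, \<alpha> with sides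
  \<open>(2 - s\<^sup>2) * X\<close>, \<open>X\<close>, \<open>X\<close>.\<close>

lemma shape_alpha_base:
  assumes X: "X > 0" and N: "N > (0::nat)"
    and 1: "- ((2 - s\<^sup>2) * X) - X - X = of_int t1 * ((1 - s) * (2 + s))"
    and 2: "- ((2 - s\<^sup>2) * X) - X - X = of_int t2 * ((2 - s) * (1 + s))"
    and area: "X\<^sup>2 * (2 - s\<^sup>2) = of_nat N * (1 - s\<^sup>2)"
  shows False
proof -
  have "(2 + s) * ((2 - s) * X + of_int t1 * (1 - s)) = 0" using 1 by (simp add: algebra_simps power2_eq_square)
  then have e1: "(2 - s) * X = - of_int t1 * (1 - s)" using s by auto
  have "t1 \<noteq> 0" using e1 X s by auto
  moreover have "of_int t1 * ((1 - s) * (2 + s)) = of_int t2 * ((2 - s) * (1 + s))" using 1 2 by simp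
  ultimately obtain k where k: "k \<in> \<rat>" "s\<^sup>2 = 2 - k * s" using quadratic_case by metis
  have "((2 - s) * X)\<^sup>2 * (2 - s\<^sup>2) = of_nat N * (1 - s\<^sup>2) * (2 - s)\<^sup>2"
    unfolding power_mult_distrib using area by algebra
  then have "(1 - s) * ((of_int t1)\<^sup>2 * (1 - s) * (2 - s\<^sup>2) - of_nat N * (1 + s) * (2 - s)\<^sup>2) = 0"
    unfolding e1 by (simp add: algebra_simps power2_eq_square)
  then have e: "(of_int t1)\<^sup>2 * (1 - s) * (2 - s\<^sup>2) = of_nat N * (1 + s) * (2 - s)\<^sup>2" using s by simp
  \<comment> \<open>Both sides of the area equation are reduced modulo
    \<open>s\<^sup>2 = 2 - k * s\<close>, so that the coefficients of 1 and \<open>s\<close> can be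
    compared.\<close>
  have l: "(of_int t1)\<^sup>2 * (1 - s) * (2 - s\<^sup>2) = - (2 * k * (of_int t1)\<^sup>2) + ((of_int t1)\<^sup>2 * k * (1 + k)) * s"
    using k(2) by algebra
  have r: "of_nat N * (1 + s) * (2 - s)\<^sup>2 = - (2 * of_nat N * (1 + k)) + (of_nat N * (1 + k) * (2 + k)) * s"
    using k(2) by algebra
  have "(2 * of_nat N * (1 + k) - 2 * k * (of_int t1)\<^sup>2) + ((of_int t1)\<^sup>2 * k * (1 + k) - of_nat N * (1 + k) * (2 + k)) * s = 0"
    using e unfolding l r by (simp add: algebra_simps)
  then have "2 * of_nat N * (1 + k) - 2 * k * (of_int t1)\<^sup>2 = 0 \<and> (of_int t1)\<^sup>2 * k * (1 + k) - of_nat N * (1 + k) * (2 + k) = 0"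
    by (intro rational_linear[OF irr]) (use k(1) in auto)
  then have a: "of_nat N * (1 + k) = k * (of_int t1)\<^sup>2" and b: "(of_int t1)\<^sup>2 * k * (1 + k) = of_nat N * (1 + k) * (2 + k)" by (simp_all add: algebra_simps)
  have "of_nat N * (1 + k) * (1 + k) = of_nat N * (1 + k) * (2 + k)"
    unfolding b[symmetric] unfolding a by (simp add: mult_ac)
  then have "of_nat N * (1 + k) = 0" by (simp add: algebra_simps)
  then have "1 + k = 0" "k * (of_int t1)\<^sup>2 = 0" using N unfolding a[symmetric] by auto
  then show False using \<open>t1 \<noteq> 0\<close> by auto
qed

text \<open>Corners \<open>2 * \<beta>\<close>, \<alpha>, \<open>2 * \<alpha>\<close>.\<close>

lemma shape_two_alpha_two_beta:
  assumes X: "X > 0" and N: "N > (0::nat)"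
    and 1: "(1 - s\<^sup>2) * (3 - s\<^sup>2) * X - X + (2 - s\<^sup>2) * X = of_int t1 * ((1 - s) * (2 + s))"
    and 2: "(1 - s\<^sup>2) * (3 - s\<^sup>2) * X - X + (2 - s\<^sup>2) * X = of_int t2 * ((2 - s) * (1 + s))"
    and area: "(3 - s\<^sup>2) * (2 - s\<^sup>2) * X\<^sup>2 = of_nat N"
  shows False
proof -
  have "(1 - s) * (2 + s) * ((2 - s) * (1 + s) * X - of_int t1) = 0" using 1 by (simp add: algebra_simps power2_eq_square)
  then have e1: "(2 - s) * (1 + s) * X = of_int t1" using s by simp
  have "(2 - s) * (1 + s) * ((1 - s) * (2 + s) * X - of_int t2) = 0" using 2 by (simp add: algebra_simps power2_eq_square)
  then have e2: "(1 - s) * (2 + s) * X = of_int t2" using s by simp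
  have "t1 \<noteq> 0" using e1 X s by auto
  moreover have "of_int t1 * ((1 - s) * (2 + s)) = of_int t2 * ((2 - s) * (1 + s))" using 1 2 by simp
  ultimately obtain k where k: "k \<in> \<rat>" "s\<^sup>2 = 2 - k * s" "of_int t1 - of_int t2 \<noteq> (0::real)" using quadratic_case by metis
  define d :: real where "d = of_int t1 - of_int t2"
  \<comment> \<open>The difference of the two integers expresses \<open>X\<close> through
    \<open>s\<close>; substituting it in the area leaves only \<open>s\<close> and
    rationals.\<close>
  have d: "d = 2 * s * X" unfolding d_def e1[symmetric] e2[symmetric] by (simp add: algebra_simps)
  have ks: "1 + k * s = 3 - s\<^sup>2" "k * s = 2 - s\<^sup>2" using k(2) by simp_all
  have "(1 + k * s) * (k * s) * d\<^sup>2 = 4 * of_nat N * s\<^sup>2"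
    unfolding d area[symmetric] ks by (simp add: power_mult_distrib)
  then have "s * (k * d\<^sup>2 + (k\<^sup>2 * d\<^sup>2 - 4 * of_nat N) * s) = 0" by algebra
  then have "k * d\<^sup>2 + (k\<^sup>2 * d\<^sup>2 - 4 * of_nat N) * s = 0" using s by simp
  then have "k * d\<^sup>2 = 0 \<and> k\<^sup>2 * d\<^sup>2 - 4 * of_nat N = 0"
    by (intro rational_linear[OF irr]) (use k(1) in \<open>auto simp: d_def\<close>)
  then have "k\<^sup>2 * d\<^sup>2 = 0" "k\<^sup>2 * d\<^sup>2 = 4 * of_nat N" by (auto simp: power2_eq_square)
  then show False using N by simp
qed

text \<open>Corners \<open>\<alpha> + \<beta>\<close>, \<beta>, \<open>2 * \<alpha>\<close>.
  Character and area make \<open>s\<^sup>2\<close> rational and \<open>X\<close> a rational multiple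
  of \<open>s\<close>, which a side made of \<open>a\<close> edges alone could be. The contradiction
  comes from a side with at least one \<open>b\<close> or \<open>c\<close> edge, whose rational part
  is positive.\<close>

lemma shape_scalene:
  assumes X: "X > 0" and N: "N > (0::nat)"
    and 1: "- X + (1 - s\<^sup>2) * X + s * (2 - s\<^sup>2) * X = of_int t1 * ((1 - s) * (2 + s))"
    and area: "X\<^sup>2 * (2 - s\<^sup>2) = of_nat N"
    and side: "Y = X \<or> Y = (1 - s\<^sup>2) * X" "Y = of_nat P * s + of_nat Q * (1 - s\<^sup>2) + of_nat R" "Q + R > (0::nat)"
  shows False
proof -
  have "(1 - s) * (2 + s) * (s * X - of_int t1) = 0" using 1 by (simp add: algebra_simps power2_eq_square)
  then have e1: "s * X = of_int t1" using s by simp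
  have "(of_int t1)\<^sup>2 * (2 - s\<^sup>2) = of_nat N * s\<^sup>2" unfolding e1[symmetric] area[symmetric] by (simp add: power_mult_distrib)
  then have "s\<^sup>2 * (of_nat N + (of_int t1)\<^sup>2) = 2 * (of_int t1)\<^sup>2" by algebra
  moreover have "of_nat N + (of_int t1)\<^sup>2 > (0::real)" using N by (simp add: add_pos_nonneg)
  ultimately have "s\<^sup>2 = 2 * (of_int t1)\<^sup>2 / (of_nat N + (of_int t1)\<^sup>2)" by (simp add: field_simps)
  then have s2: "s\<^sup>2 \<in> \<rat>" by simp
  have "X = of_int t1 / s\<^sup>2 * s" using e1 s by (simp add: field_simps power2_eq_square)
  then obtain y where y: "y \<in> \<rat>" "Y = y * s"
  proof -
    have "Y = (of_int t1 / s\<^sup>2) * s \<or> Y = ((1 - s\<^sup>2) * (of_int t1 / s\<^sup>2)) * s"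
      using side(1) \<open>X = of_int t1 / s\<^sup>2 * s\<close> by auto
    moreover have "of_int t1 / s\<^sup>2 \<in> \<rat>" "(1 - s\<^sup>2) * (of_int t1 / s\<^sup>2) \<in> \<rat>" using s2 by auto
    ultimately show ?thesis using that by blast
  qed
  have "(of_nat Q * (1 - s\<^sup>2) + of_nat R) + (of_nat P - y) * s = 0" using side(2) y by (simp add: algebra_simps)
  then have "of_nat Q * (1 - s\<^sup>2) + of_nat R = 0 \<and> of_nat P - y = 0"
    by (intro rational_linear[OF irr]) (use s2 y in auto)
  moreover have "1 - s\<^sup>2 > 0" using s by (simp add: abs_square_less_1)
  then have "of_nat Q * (1 - s\<^sup>2) + of_nat R > 0"
    using side(3) by (cases "Q = 0") (auto intro: add_pos_nonneg)
  ultimately show False by simp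
qed

end

text \<open>An odd character of the group of directions generated by \<open>-1\<close> and \<open>\<omega>\<close>, translated to the
  coset of \<open>d0\<close> and extended by \<open>0\<close>.\<close>

definition chi :: "complex \<Rightarrow> real \<Rightarrow> complex \<Rightarrow> complex \<Rightarrow> real"
  where "chi \<omega> \<epsilon> d0 d = (if \<exists>k. d = d0 * \<omega> powi k then \<epsilon> powi (THE k. d = d0 * \<omega> powi k)
    else if \<exists>k. d = - (d0 * \<omega> powi k) then - (\<epsilon> powi (THE k. d = - (d0 * \<omega> powi k))) else 0)"

context
  fixes \<omega> d0 :: complex and \<epsilon> :: real
  assumes \<omega>: "norm \<omega> = 1" and nonroot: "\<And>n::nat. n > 0 \<Longrightarrow> \<omega> ^ n \<noteq> 1" and \<epsilon>: "\<epsilon> = 1 \<or> \<epsilon> = -1" and d0: "d0 \<noteq> 0"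
begin

lemma \<omega>_nz: "\<omega> \<noteq> 0" using \<omega> by auto
lemma \<epsilon>_nz: "\<epsilon> \<noteq> 0" using \<epsilon> by auto

lemma powi_eq_1: "\<omega> powi k = 1 \<Longrightarrow> k = 0"
proof (rule ccontr)
  assume k: "\<omega> powi k = 1" "k \<noteq> 0"
  then have "\<omega> powi \<bar>k\<bar> = 1" by (cases "k \<ge> 0") (simp_all add: power_int_minus)
  then have "\<omega> ^ nat \<bar>k\<bar> = 1" by (simp add: power_int_def)
  then show False using nonroot[of "nat \<bar>k\<bar>"] k by simp
qed

lemma powi_inj: "\<omega> powi k = \<omega> powi l \<Longrightarrow> k = l"
  using powi_eq_1[of "k - l"] \<omega>_nz by (simp add: power_int_diff)

lemma powi_neq_minus: "\<omega> powi k \<noteq> - (\<omega> powi l)"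
proof
  assume e: "\<omega> powi k = - (\<omega> powi l)"
  then have "\<omega> powi (k - l) = -1" using \<omega>_nz by (simp add: power_int_diff)
  then have "\<omega> powi ((k - l) * 2) = 1" by (simp only: power_int_mult) simp
  then have "k = l" using powi_eq_1 by fastforce
  then show False using e \<omega>_nz by (simp add: eq_neg_iff_add_eq_0)
qed

lemma chi_pos: "chi \<omega> \<epsilon> d0 (d0 * \<omega> powi k) = \<epsilon> powi k"
proof -
  have "(THE j. d0 * \<omega> powi k = d0 * \<omega> powi j) = k" using powi_inj d0 by (intro the_equality) auto
  then show ?thesis unfolding chi_def by auto
qed

lemma chi_neg: "chi \<omega> \<epsilon> d0 (- (d0 * \<omega> powi k)) = - (\<epsilon> powi k)"
proof -
  have "(THE j. - (d0 * \<omega> powi k) = - (d0 * \<omega> powi j)) = k" using powi_inj d0 by (intro the_equality) auto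
  moreover have "\<not> (\<exists>j. - (d0 * \<omega> powi k) = d0 * \<omega> powi j)"
    using powi_neq_minus[of _ k] d0 by (metis mult_cancel_left mult_minus_right)
  ultimately show ?thesis unfolding chi_def by auto
qed

lemma chi_cases:
  obtains k where "d = d0 * \<omega> powi k" | k where "d = - (d0 * \<omega> powi k)"
  | "chi \<omega> \<epsilon> d0 d = 0" "\<And>k. d \<noteq> d0 * \<omega> powi k" "\<And>k. d \<noteq> - (d0 * \<omega> powi k)"
  unfolding chi_def by metis

lemma chi_minus: "chi \<omega> \<epsilon> d0 (- d) = - chi \<omega> \<epsilon> d0 d"
proof (cases d rule: chi_cases)
  case (1 k) then show ?thesis by (simp add: chi_pos chi_neg)
next
  case (2 k) then show ?thesis by (simp add: chi_pos chi_neg)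
next
  case 3
  then have "\<And>k. - d \<noteq> d0 * \<omega> powi k" "\<And>k. - d \<noteq> - (d0 * \<omega> powi k)" by (metis minus_minus)+
  then show ?thesis using 3(1) unfolding chi_def by simp
qed

lemma chi_mult: "chi \<omega> \<epsilon> d0 (\<omega> * d) = \<epsilon> * chi \<omega> \<epsilon> d0 d"
proof (cases d rule: chi_cases)
  case (1 k)
  then have "\<omega> * d = d0 * \<omega> powi (k + 1)" using \<omega>_nz by (simp add: power_int_add)
  then show ?thesis using 1 \<epsilon>_nz by (simp only: chi_pos) (simp add: power_int_add)
next
  case (2 k)
  then have "\<omega> * d = - (d0 * \<omega> powi (k + 1))" using \<omega>_nz by (simp add: power_int_add)
  then show ?thesis using 2 \<epsilon>_nz by (simp only: chi_neg) (simp add: power_int_add)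
next
  case 3
  have "\<omega> * d \<noteq> d0 * \<omega> powi k" for k
  proof
    assume "\<omega> * d = d0 * \<omega> powi k"
    then have "d = d0 * \<omega> powi (k - 1)" using \<omega>_nz by (simp add: power_int_diff field_simps)
    then show False using 3 by blast
  qed
  moreover have "\<omega> * d \<noteq> - (d0 * \<omega> powi k)" for k
  proof
    assume "\<omega> * d = - (d0 * \<omega> powi k)"
    then have "d = - (d0 * \<omega> powi (k - 1))" using \<omega>_nz by (simp add: power_int_diff field_simps)
    then show False using 3 by blast
  qed
  ultimately show ?thesis using 3(1) unfolding chi_def by simp
qed

lemma chi_mult_cnj: "chi \<omega> \<epsilon> d0 (cnj \<omega> * d) = \<epsilon> * chi \<omega> \<epsilon> d0 d"
proof -
  have "\<omega> * (cnj \<omega> * d) = d" using unit_cnj[OF \<omega>] by (metis mult.assoc mult_1)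
  then have "chi \<omega> \<epsilon> d0 d = \<epsilon> * chi \<omega> \<epsilon> d0 (cnj \<omega> * d)" using chi_mult[of "cnj \<omega> * d"] by metis
  then show ?thesis using \<epsilon> by auto
qed

lemma chi_mult_power:
  assumes "\<rho> = \<omega> \<or> \<rho> = cnj \<omega>" shows "chi \<omega> \<epsilon> d0 (\<rho> ^ n * d) = \<epsilon> ^ n * chi \<omega> \<epsilon> d0 d"
  using assms by (induction n) (auto simp: mult.assoc chi_mult chi_mult_cnj)

lemma chi_int: "\<exists>t::int. chi \<omega> \<epsilon> d0 d = of_int t"
proof (cases d rule: chi_cases)
  case (1 k)
  have "\<epsilon> powi k = 1 \<or> \<epsilon> powi k = -1" using \<epsilon> by (cases "even k") (auto simp: power_int_minus_left)
  then show ?thesis using 1 chi_pos by (metis of_int_1 of_int_minus)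
next
  case (2 k)
  have "\<epsilon> powi k = 1 \<or> \<epsilon> powi k = -1" using \<epsilon> by (cases "even k") (auto simp: power_int_minus_left)
  then show ?thesis using 2 chi_neg by (metis minus_minus of_int_1 of_int_minus)
next
  case 3 then show ?thesis by (metis of_int_0)
qed

lemma edge_pot_chi:
  assumes "p \<noteq> q"
  shows "edge_pot (\<lambda>d x. chi \<omega> \<epsilon> d0 d * Re (cnj d * x)) p q = chi \<omega> \<epsilon> d0 (sgn (q - p)) * norm (q - p)"
proof -
  define d where "d = sgn (q - p)"
  have "q - p = of_real (norm (q - p)) * d" unfolding d_def by (rule norm_sgn_mult)
  then have "cnj d * (q - p) = of_real (norm (q - p)) * (d * cnj d)" by (metis mult.assoc mult.commute)
  also have "d * cnj d = 1" by (rule unit_cnj) (use assms in \<open>simp add: d_def norm_sgn\<close>)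
  finally have "Re (cnj d * q) - Re (cnj d * p) = norm (q - p)"
    by (metis Re_complex_of_real minus_complex.sel(1) mult.right_neutral right_diff_distrib)
  then show ?thesis unfolding edge_pot_def d_def[symmetric] by (metis right_diff_distrib)
qed

text \<open>An odd character times an odd abscissa is an even potential, and it weights lengths by
  the character. The directions \<open>e\<close>, \<open>\<rho>\<^sup>2 * e\<close>,
  \<open>- (\<rho> ^ 3 * e)\<close> have characters proportional to \<open>1\<close>,
  \<open>1\<close>, \<open>- \<epsilon>\<close>, so every tile contributes an integer multiple of
  one constant.\<close>

lemma chi_tiling:
  assumes T: "weak_tiling I u v w A B C" and shape: "\<And>i. i \<in> I \<Longrightarrow> tile_shape \<omega> (u i) (v i) (w i)"
    and pos: "ts \<omega> > 0" "tb \<omega> > 0"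
  shows "\<exists>t::int. chi \<omega> \<epsilon> d0 (sgn (B - A)) * norm (B - A) + chi \<omega> \<epsilon> d0 (sgn (C - B)) * norm (C - B)
    + chi \<omega> \<epsilon> d0 (sgn (A - C)) * norm (A - C) = of_int t * (1 + tb \<omega> - \<epsilon> * ts \<omega>)"
proof -
  let ?\<psi> = "\<lambda>d x. chi \<omega> \<epsilon> d0 d * Re (cnj d * x)"
  have even: "?\<psi> (- d) x = ?\<psi> d x" for d x by (simp add: chi_minus algebra_simps)
  have tile: "circulation ?\<psi> (u i) (v i) (w i) = chi \<omega> \<epsilon> d0 (sgn (v i - u i)) * (1 + tb \<omega> - \<epsilon> * ts \<omega>)" if i: "i \<in> I" for i
  proof -
    obtain e \<rho> where e: "norm e = 1" and \<rho>: "\<rho> = \<omega> \<or> \<rho> = cnj \<omega>" and v: "v i = u i + e"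
      and w: "w i = u i - of_real (tb \<omega>) * \<rho>\<^sup>2 * e"
      using shape[OF i] by (auto simp: tile_shape_def)
    note c = tile_closing'[OF \<omega> \<rho>]
    note d = tile_directions[OF \<omega> e \<rho> pos v w]
    note ne = orient_nonzero_neq[OF weak_nz[OF T i]]
    have e3: "\<epsilon> ^ 3 = \<epsilon>" "\<epsilon>\<^sup>2 = 1" using \<epsilon> by auto
    show ?thesis
      unfolding circulation_def edge_pot_chi[OF ne(1)] edge_pot_chi[OF ne(2)] edge_pot_chi[OF ne(3)]
        tile_norms[OF \<omega> shape[OF i]] d chi_minus chi_mult_power[OF \<rho>] e3
      using pos by (simp add: algebra_simps)
  qed
  define t where "t = (\<lambda>i. \<lfloor>chi \<omega> \<epsilon> d0 (sgn (v i - u i))\<rfloor>)"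
  have t: "chi \<omega> \<epsilon> d0 (sgn (v i - u i)) = of_int (t i)" for i
    using chi_int[of "sgn (v i - u i)"] by (auto simp: t_def)
  have "circulation ?\<psi> A B C = (\<Sum>i\<in>I. sgn (orient (u i) (v i) (w i)) * circulation ?\<psi> (u i) (v i) (w i))"
    by (rule weak_circulation[OF T, of ?\<psi>, OF even, symmetric])
  also have "\<dots> = (\<Sum>i\<in>I. of_int ((if orient (u i) (v i) (w i) > 0 then 1 else -1) * t i) * (1 + tb \<omega> - \<epsilon> * ts \<omega>))"
    by (rule sum.cong[OF refl]) (use weak_nz[OF T] tile t in \<open>auto simp: sgn_if\<close>)
  also have "\<dots> = of_int (\<Sum>i\<in>I. (if orient (u i) (v i) (w i) > 0 then 1 else -1) * t i) * (1 + tb \<omega> - \<epsilon> * ts \<omega>)"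
    by (simp add: sum_distrib_right)
  finally show ?thesis
    unfolding circulation_def edge_pot_chi[OF weak_neq(1)[OF T]] edge_pot_chi[OF weak_neq(2)[OF T]] edge_pot_chi[OF weak_neq(3)[OF T]]
    by blast
qed

end

text \<open>A turn by \<alpha>, \<beta> or \<gamma> multiplies the character by \<open>-1\<close>,
  \<open>\<epsilon>\<close> or \<open>\<epsilon>\<close>.\<close>

lemma chi_dir:
  assumes \<omega>: "norm \<omega> = 1" "\<And>n::nat. n > 0 \<Longrightarrow> \<omega> ^ n \<noteq> 1" and \<epsilon>: "\<epsilon> = 1 \<or> \<epsilon> = -1" and d0: "d0 \<noteq> 0"
  shows "chi \<omega> \<epsilon> d0 (d * ((- (\<omega>\<^sup>2)) ^ p * (cnj (\<omega> ^ 3)) ^ q * \<omega> ^ r)) = (-1) ^ p * \<epsilon> ^ (q + r) * chi \<omega> \<epsilon> d0 d"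
proof -
  note m = chi_mult_power[OF \<omega> \<epsilon> d0]
  have e: "\<epsilon>\<^sup>2 = 1" "\<epsilon> ^ 3 = \<epsilon>" using \<epsilon> by auto
  have 1: "chi \<omega> \<epsilon> d0 ((- (\<omega>\<^sup>2)) ^ p * d) = (-1) ^ p * chi \<omega> \<epsilon> d0 d" for d
  proof (induction p)
    case (Suc p)
    have "(- (\<omega>\<^sup>2)) ^ Suc p * d = - (\<omega>\<^sup>2 * ((- (\<omega>\<^sup>2)) ^ p * d))" by (simp add: mult.assoc)
    then have "chi \<omega> \<epsilon> d0 ((- (\<omega>\<^sup>2)) ^ Suc p * d) = - (\<epsilon>\<^sup>2 * chi \<omega> \<epsilon> d0 ((- (\<omega>\<^sup>2)) ^ p * d))"
      using chi_minus[OF \<omega> \<epsilon> d0] m[of \<omega> 2] by metis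
    then show ?case using Suc e by simp
  qed simp
  have 2: "chi \<omega> \<epsilon> d0 ((cnj (\<omega> ^ 3)) ^ q * d) = \<epsilon> ^ q * chi \<omega> \<epsilon> d0 d" for d
  proof (induction q)
    case (Suc q)
    have "(cnj (\<omega> ^ 3)) ^ Suc q * d = (cnj \<omega>) ^ 3 * ((cnj (\<omega> ^ 3)) ^ q * d)" by (simp add: mult.assoc)
    then have "chi \<omega> \<epsilon> d0 ((cnj (\<omega> ^ 3)) ^ Suc q * d) = \<epsilon> ^ 3 * chi \<omega> \<epsilon> d0 ((cnj (\<omega> ^ 3)) ^ q * d)"
      using m[of "cnj \<omega>" 3] by metis
    then show ?case using Suc e by simp
  qed simp
  have "d * ((- (\<omega>\<^sup>2)) ^ p * (cnj (\<omega> ^ 3)) ^ q * \<omega> ^ r) = (- (\<omega>\<^sup>2)) ^ p * ((cnj (\<omega> ^ 3)) ^ q * (\<omega> ^ r * d))"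
    by (simp only: mult_ac)
  then show ?thesis unfolding 1 2 using m[of \<omega> r d] by (simp only: 1 2 power_add) simp
qed

lemma area_corner:
  assumes D: "orient A B C > 0"
  shows "norm (B - A) * norm (C - A) * sin (corner A B C) = orient A B C"
proof -
  have "C - A = of_real (norm (C - A)) * (sgn (B - A) * cis (corner A B C))"
    using norm_sgn_mult[of "C - A"] sgn_corner[OF D] by simp
  moreover have "of_real (norm (B - A)) * sgn (B - A) = B - A" using norm_sgn_mult[of "B - A"] by simp
  ultimately have e: "of_real (norm (B - A)) * (C - A) = of_real (norm (C - A)) * ((B - A) * cis (corner A B C))"
    by (metis mult.assoc mult.left_commute)
  have "norm (B - A) * orient A B C = norm (C - A) * crs (B - A) ((B - A) * cis (corner A B C))"
    unfolding orient_def using arg_cong[OF e, of "crs (B - A)"] by (simp only: crs_scaleR)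
  also have "crs (B - A) ((B - A) * cis (corner A B C)) = (norm (B - A))\<^sup>2 * sin (corner A B C)"
    unfolding cmod_power2 by (simp add: crs_def algebra_simps power2_eq_square)
  finally have f: "norm (B - A) * orient A B C = norm (C - A) * ((norm (B - A))\<^sup>2 * sin (corner A B C))" .
  have "norm (B - A) * (norm (B - A) * norm (C - A) * sin (corner A B C)) = norm (B - A) * orient A B C"
    unfolding f by (simp add: power2_eq_square)
  moreover have "norm (B - A) \<noteq> 0" using orient_nonzero_neq[of A B C] D by auto
  ultimately show ?thesis by (metis mult_left_cancel)
qed

locale angle_tiling = tile_angle +
  fixes I :: "'a set" and u v w :: "'a \<Rightarrow> complex" and A B C :: complex
  assumes T: "weak_tiling I u v w A B C" and shape: "\<And>i. i \<in> I \<Longrightarrow> tile_shape \<omega> (u i) (v i) (w i)"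
begin

lemma cyc: "angle_tiling \<delta> I u v w B C A"
  using T shape by unfold_locales (auto intro: weak_tiling_cyc)

lemma ts_pos: "ts \<omega> > 0" and tb_pos': "tb \<omega> > 0"
  using s_pos tb_pos by (simp_all add: ts_\<omega> tb_\<omega>)

definition "na X = card {i \<in> I. u i = X}"
definition "nb X = card {i \<in> I. v i = X}"
definition "nc X = card {i \<in> I. w i = X}"

lemma corner_A: "corner A B C = real (na A) * (2 * \<delta>) + real (nb A) * (pi / 2 - 3 * \<delta>) + real (nc A) * (pi / 2 + \<delta>)"
proof -
  have "tb \<omega> * Im (\<omega>\<^sup>2) \<noteq> 0" using orient_sign by auto
  from corner_count[OF T shape norm_\<omega> this] show ?thesis unfolding na_def nb_def nc_def angs .
qed

lemma orient_ABC: "orient A B C > 0" by (rule weak_orient_pos[OF T])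

lemma count_pos: "na A + nb A + nc A > 0"
proof -
  have "corner A B C > 0" using orient_ABC by (intro corner_gt_0) simp
  then show ?thesis unfolding corner_A by (cases "na A + nb A + nc A = 0") auto
qed

definition "N = card I"

lemma N_pos: "N > 0"
  using T unfolding N_def weak_tiling_def by (simp add: card_gt_0_iff)

lemma area: "orient A B C = real N * (1 - s\<^sup>2) * sin (2 * \<delta>)"
  unfolding N_def area_count[OF T shape norm_\<omega>, simplified] area_const by simp

lemma dir_A: "sgn (C - A) = sgn (B - A) * ((- (\<omega>\<^sup>2)) ^ na A * (cnj (\<omega> ^ 3)) ^ nb A * \<omega> ^ nc A)"
  using sgn_corner[OF orient_ABC] unfolding corner_A cis_angs .

definition is_side :: "real \<Rightarrow> bool"
  where "is_side Y \<longleftrightarrow> (\<exists>P Q R. Y = of_nat P * s + of_nat Q * (1 - s\<^sup>2) + of_nat R)"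

definition is_side' :: "real \<Rightarrow> bool"
  where "is_side' Y \<longleftrightarrow> (\<exists>P Q R. Y = of_nat P * s + of_nat Q * (1 - s\<^sup>2) + of_nat R \<and> Q + R > (0::nat))"

lemma side_A: "is_side (norm (B - A))"
  using side_count[OF T shape norm_\<omega> ts_pos tb_pos'] unfolding is_side_def ts_\<omega> tb_\<omega> by blast

lemma side'_A:
  assumes "nb A = 0" "nc A = 0" shows "is_side' (norm (B - A))"
proof -
  have fin: "finite I" by (rule weak_fin[OF T])
  have "{i \<in> I. v i = A} = {}" "{i \<in> I. w i = A} = {}" using assms fin unfolding nb_def nc_def by auto
  then have "v i \<noteq> A \<and> w i \<noteq> A" if "i \<in> I" for i using that by auto
  from side_not_a[OF T this] show ?thesis
    using side_count[OF T shape norm_\<omega> ts_pos tb_pos'] unfolding is_side'_def ts_\<omega> tb_\<omega> by blast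
qed

end

section \<open>Distributions of three angles \<alpha> and two angles \<beta>\<close>

lemma mset_triple_permute: "{#y, z, x#} = {#x, y, z#}" "{#z, x, y#} = {#x, y, z#}" "{#y, x, z#} = {#x, y, z#}"
    "{#x, z, y#} = {#x, y, z#}" "{#z, y, x#} = {#x, y, z#}"
  by (simp_all only: add_mset_commute)

lemma two_pos_sum_3_cases:
  fixes p1 p2 p3 :: nat
  assumes "p2 > 0" "p3 > 0" "p1 + p2 + p3 = 3"
  shows "p1 = 1 \<and> p2 = 1 \<and> p3 = 1 \<or> p1 = 0 \<and> p2 = 1 \<and> p3 = 2 \<or> p1 = 0 \<and> p2 = 2 \<and> p3 = 1"
proof -
  have "p1 = 0 \<or> p1 = 1" "p2 = 1 \<or> p2 = 2" using assms by linarith+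
  then show ?thesis using assms by (elim disjE) simp_all
qed

lemma one_pos_sum_3_cases:
  fixes p1 p2 p3 :: nat
  assumes "p3 > 0" "p1 + p2 + p3 = 3"
  shows "p1 = 0 \<and> p2 = 0 \<and> p3 = 3 \<or> p1 = 1 \<and> p2 = 0 \<and> p3 = 2 \<or> p1 = 0 \<and> p2 = 1 \<and> p3 = 2 \<or>
      p1 = 1 \<and> p2 = 1 \<and> p3 = 1 \<or> p1 = 2 \<and> p2 = 0 \<and> p3 = 1 \<or> p1 = 0 \<and> p2 = 2 \<and> p3 = 1"
proof -
  have "p1 = 0 \<or> p1 = 1 \<or> p1 = 2" "p2 = 0 \<or> p2 = 1 \<or> p2 = 2" using assms by linarith+
  then show ?thesis using assms by (elim disjE) simp_all
qed

context tile_angle begin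

text \<open>The law of sines makes the sides of \<open>ABC\<close> proportional to these
  values.\<close>

definition "gsin p q = sin (real p * (2 * \<delta>) + real q * (pi / 2 - 3 * \<delta>))"
definition "c = cos \<delta>"

lemma c_pos: "c > 0" unfolding c_def using \<delta> by (intro cos_gt_zero) auto

lemma sin_2\<delta>: "sin (2 * \<delta>) = s * c" by (simp add: sin_double s_def c_def)
lemma cos_2\<delta>: "2 * cos (2 * \<delta>) = 2 - s\<^sup>2"
  by (simp add: cos_double_sin s_def power_mult_distrib)
lemma cos_3\<delta>: "cos (3 * \<delta>) = (1 - s\<^sup>2) * c"
proof -
  have "cos (3 * \<delta>) = cos (2 * \<delta> + \<delta>)" by simp
  also have "2 * \<dots> = 2 * cos (2 * \<delta>) * cos \<delta> - 2 * (sin (2 * \<delta>) * sin \<delta>)" unfolding cos_add by simp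
  also have "\<dots> = 2 * ((1 - s\<^sup>2) * c)" unfolding cos_2\<delta> sin_2\<delta>
    by (simp add: s_def c_def algebra_simps power2_eq_square)
  finally show ?thesis by simp
qed

lemma sin_3\<delta>: "2 * sin (3 * \<delta>) = 3 * s - s ^ 3"
proof -
  have "sin (3 * \<delta>) = sin (2 * \<delta> + \<delta>)" by simp
  also have "\<dots> = 2 * sin \<delta> * (cos \<delta> * cos \<delta>) + cos (2 * \<delta>) * sin \<delta>" unfolding sin_add sin_double by simp
  also have "cos \<delta> * cos \<delta> = 1 - (sin \<delta>)\<^sup>2" using cos_squared_eq[of \<delta>] by (simp only: power2_eq_square)
  also have "cos (2 * \<delta>) = 1 - 2 * (sin \<delta>)\<^sup>2" by (rule cos_double_sin)
  finally show ?thesis by (simp add: s_def algebra_simps power2_eq_square power3_eq_cube)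
qed

lemma sin_4\<delta>: "sin (4 * \<delta>) = s * c * (2 - s\<^sup>2)"
proof -
  have "sin (4 * \<delta>) = sin (2 * \<delta>) * (2 * cos (2 * \<delta>))" using sin_double[of "2 * \<delta>"] by simp
  then show ?thesis unfolding sin_2\<delta> cos_2\<delta> .
qed

lemma sin_6\<delta>: "sin (6 * \<delta>) = (3 * s - s ^ 3) * ((1 - s\<^sup>2) * c)"
proof -
  have "sin (6 * \<delta>) = (2 * sin (3 * \<delta>)) * cos (3 * \<delta>)" using sin_double[of "3 * \<delta>"] by simp
  then show ?thesis unfolding sin_3\<delta> cos_3\<delta> .
qed

lemma gsin_vals:
  "gsin 1 0 = s * c" "gsin 0 1 = (1 - s\<^sup>2) * c" "gsin 1 1 = c" "gsin 2 0 = s * c * (2 - s\<^sup>2)"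
  "gsin 3 0 = (3 * s - s ^ 3) * ((1 - s\<^sup>2) * c)" "gsin 0 2 = (3 * s - s ^ 3) * ((1 - s\<^sup>2) * c)"
  "gsin 1 2 = s * c * (2 - s\<^sup>2)"
proof -
  show "gsin 1 0 = s * c" by (simp add: gsin_def sin_2\<delta>)
  have "gsin 0 1 = sin (pi / 2 - 3 * \<delta>)" by (simp add: gsin_def)
  then show "gsin 0 1 = (1 - s\<^sup>2) * c" by (simp add: sin_diff cos_3\<delta>)
  have "gsin 1 1 = sin (pi / 2 - \<delta>)" by (simp add: gsin_def)
  then show "gsin 1 1 = c" by (simp add: sin_diff c_def)
  show "gsin 2 0 = s * c * (2 - s\<^sup>2)" by (simp add: gsin_def sin_4\<delta>)
  show "gsin 3 0 = (3 * s - s ^ 3) * ((1 - s\<^sup>2) * c)" by (simp add: gsin_def sin_6\<delta>)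
  have "gsin 0 2 = sin (pi - 6 * \<delta>)" by (simp add: gsin_def algebra_simps)
  then show "gsin 0 2 = (3 * s - s ^ 3) * ((1 - s\<^sup>2) * c)" by (simp add: sin_6\<delta>)
  have "gsin 1 2 = sin (pi - 4 * \<delta>)" by (simp add: gsin_def algebra_simps)
  then show "gsin 1 2 = s * c * (2 - s\<^sup>2)" by (simp add: sin_4\<delta>)
qed

end

context angle_tiling begin

text \<open>The corners are \<open>p\<^sub>i * \<alpha> + q\<^sub>i * \<beta>\<close>, with opposite sides \<open>X\<^sub>i\<close>; no tile has its angle \<open>\<gamma>\<close>
  at a vertex of the big triangle. The integers \<open>t\<close> come from the two characters
  \<open>\<omega> \<mapsto> 1\<close> and \<open>\<omega> \<mapsto> -1\<close>.\<close>

definition vertex_data :: "nat \<Rightarrow> nat \<Rightarrow> real \<Rightarrow> nat \<Rightarrow> nat \<Rightarrow> real \<Rightarrow> nat \<Rightarrow> nat \<Rightarrow> real \<Rightarrow> bool"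
  where "vertex_data p1 q1 X1 p2 q2 X2 p3 q3 X3 \<longleftrightarrow>
    X1 > 0 \<and> X2 > 0 \<and> X3 > 0 \<and> p1 + q1 > 0 \<and> p2 + q2 > 0 \<and> p3 + q3 > 0 \<and>
    p1 + p2 + p3 = 3 \<and> q1 + q2 + q3 = 2 \<and>
    X1 * X2 * gsin p3 q3 = real N * (1 - s\<^sup>2) * (s * c) \<and>
    X2 * X3 * gsin p1 q1 = real N * (1 - s\<^sup>2) * (s * c) \<and>
    X3 * X1 * gsin p2 q2 = real N * (1 - s\<^sup>2) * (s * c) \<and>
    (\<exists>t::int. (-1) ^ p1 * X1 + (-1) ^ p2 * X2 + (-1) ^ p3 * X3 = of_int t * ((1 - s) * (2 + s))) \<and>
    (\<exists>t::int. (-1) ^ (p1 + q1) * X1 + (-1) ^ (p2 + q2) * X2 + (-1) ^ (p3 + q3) * X3 = of_int t * ((2 - s) * (1 + s))) \<and>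
    (q1 = 0 \<longrightarrow> is_side' X2 \<or> is_side' X3) \<and> (q2 = 0 \<longrightarrow> is_side' X3 \<or> is_side' X1) \<and> (q3 = 0 \<longrightarrow> is_side' X1 \<or> is_side' X2)"

lemma vertex_data_cyc: "vertex_data p1 q1 X1 p2 q2 X2 p3 q3 X3 \<Longrightarrow> vertex_data p2 q2 X2 p3 q3 X3 p1 q1 X1"
  unfolding vertex_data_def by (elim conjE, intro conjI; (assumption | simp add: add_ac))

lemma vertex_data_swap: "vertex_data p1 q1 X1 p2 q2 X2 p3 q3 X3 \<Longrightarrow> vertex_data p2 q2 X2 p1 q1 X1 p3 q3 X3"
  unfolding vertex_data_def by (elim conjE, intro conjI; (assumption | blast | simp add: add_ac mult_ac))

lemma area_cancel:
  assumes "X1 * X2 * (f * (s * c)) = real N * (1 - s\<^sup>2) * (s * c)"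
  shows "X1 * X2 * f = real N * (1 - s\<^sup>2)"
  using assms s_pos c_pos by (simp add: mult.assoc[symmetric])

text \<open>The law of sines, obtained by equating the area formula at two corners.\<close>

lemma vertex_data_ratio:
  assumes "vertex_data p1 q1 X1 p2 q2 X2 p3 q3 X3"
  shows "X1 * gsin p2 q2 = X2 * gsin p1 q1" "X1 * gsin p3 q3 = X3 * gsin p1 q1"
proof -
  have X: "X1 > 0" "X2 > 0" "X3 > 0" and e: "X1 * X2 * gsin p3 q3 = X2 * X3 * gsin p1 q1" "X3 * X1 * gsin p2 q2 = X2 * X3 * gsin p1 q1"
    using assms by (auto simp: vertex_data_def)
  have "X3 * (X1 * gsin p2 q2) = X3 * (X2 * gsin p1 q1)" using e by (simp add: mult_ac)
  then show "X1 * gsin p2 q2 = X2 * gsin p1 q1" using X by simp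
  have "X2 * (X1 * gsin p3 q3) = X2 * (X3 * gsin p1 q1)" using e by (simp add: mult_ac)
  then show "X1 * gsin p3 q3 = X3 * gsin p1 q1" using X by simp
qed

context
  assumes irr: "s \<notin> \<rat>"
begin

lemma no_vertex_data_112: "\<not> vertex_data 1 2 X1 1 0 X2 1 0 X3"
proof
  assume d: "vertex_data 1 2 X1 1 0 X2 1 0 X3"
  note r = vertex_data_ratio[OF d, unfolded gsin_vals] vertex_data_ratio[OF vertex_data_cyc[OF d], unfolded gsin_vals]
  have X: "X2 > 0" and N: "N > 0" using d N_pos by (auto simp: vertex_data_def)
  have "(s * c) * X1 = (s * c) * ((2 - s\<^sup>2) * X2)" using r(1) by (auto simp: mult_ac)
  then have X1: "X1 = (2 - s\<^sup>2) * X2" using s_pos c_pos by simp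
  have "(s * c) * X3 = (s * c) * X2" using r(3) by (auto simp: mult_ac)
  then have X3: "X3 = X2" using s_pos c_pos by simp
  obtain t1 t2 :: int where t: "- X1 - X2 - X3 = of_int t1 * ((1 - s) * (2 + s))" "- X1 - X2 - X3 = of_int t2 * ((2 - s) * (1 + s))"
    using d by (auto simp: vertex_data_def algebra_simps)
  have "X1 * X2 * (s * c) = real N * (1 - s\<^sup>2) * (s * c)" using d gsin_vals by (simp add: vertex_data_def)
  then have "X2\<^sup>2 * (2 - s\<^sup>2) = real N * (1 - s\<^sup>2)"
    using area_cancel[of X1 X2 1] unfolding X1 by (simp add: power2_eq_square mult_ac)
  then show False using shape_alpha_base[OF s_pos s_less_1 irr X N] t unfolding X1 X3 by metis
qed

lemma no_vertex_data_012: "\<not> vertex_data 0 2 X1 1 0 X2 2 0 X3"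
proof
  assume d: "vertex_data 0 2 X1 1 0 X2 2 0 X3"
  note r = vertex_data_ratio[OF d, unfolded gsin_vals] vertex_data_ratio[OF vertex_data_cyc[OF d], unfolded gsin_vals]
  have X: "X2 > 0" and N: "N > 0" using d N_pos by (auto simp: vertex_data_def)
  have "(s * c) * X1 = (s * c) * ((1 - s\<^sup>2) * (3 - s\<^sup>2) * X2)" using r(1) by (simp add: algebra_simps power2_eq_square power3_eq_cube)
  then have X1: "X1 = (1 - s\<^sup>2) * (3 - s\<^sup>2) * X2" using s_pos c_pos by simp
  have "(s * c) * X3 = (s * c) * ((2 - s\<^sup>2) * X2)" using r(3) by (auto simp: mult_ac)
  then have X3: "X3 = (2 - s\<^sup>2) * X2" using s_pos c_pos by simp
  obtain t1 t2 :: int where t: "X1 - X2 + X3 = of_int t1 * ((1 - s) * (2 + s))" "X1 - X2 + X3 = of_int t2 * ((2 - s) * (1 + s))"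
    using d by (auto simp: vertex_data_def algebra_simps)
  have "X1 * X2 * (s * c * (2 - s\<^sup>2)) = real N * (1 - s\<^sup>2) * (s * c)" using d gsin_vals by (simp add: vertex_data_def)
  then have "X1 * X2 * (2 - s\<^sup>2) = real N * (1 - s\<^sup>2)"
    using area_cancel[of X1 X2 "2 - s\<^sup>2"] by (simp add: mult_ac)
  then have "(1 - s\<^sup>2) * ((3 - s\<^sup>2) * (2 - s\<^sup>2) * X2\<^sup>2) = (1 - s\<^sup>2) * real N"
    unfolding X1 by (simp add: power2_eq_square mult_ac)
  then have "(3 - s\<^sup>2) * (2 - s\<^sup>2) * X2\<^sup>2 = real N" using tb_pos by simp
  then show False using shape_two_alpha_two_beta[OF s_pos s_less_1 irr X N] t unfolding X1 X3 by metis
qed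

lemma no_vertex_data_003: "\<not> vertex_data 0 1 X1 0 1 X2 3 0 X3"
proof
  assume d: "vertex_data 0 1 X1 0 1 X2 3 0 X3"
  note r = vertex_data_ratio[OF d, unfolded gsin_vals] vertex_data_ratio[OF vertex_data_cyc[OF d], unfolded gsin_vals]
  have X: "X1 > 0" using d by (auto simp: vertex_data_def)
  have "((1 - s\<^sup>2) * c) * X2 = ((1 - s\<^sup>2) * c) * X1" using r(1) by (auto simp: mult_ac)
  then have X2: "X2 = X1" using tb_pos c_pos by auto
  have "((1 - s\<^sup>2) * c) * X3 = ((1 - s\<^sup>2) * c) * ((3 * s - s ^ 3) * X1)" using r(2) by (auto simp: mult_ac)
  then have X3: "X3 = (3 * s - s ^ 3) * X1" using tb_pos c_pos by auto
  obtain t1 t2 :: int where t: "X1 + X2 - X3 = of_int t1 * ((1 - s) * (2 + s))" "- X1 - X2 - X3 = of_int t2 * ((2 - s) * (1 + s))"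
    using d by (auto simp: vertex_data_def algebra_simps)
  then show False using shape_beta_apex[OF s_pos s_less_1 irr X] unfolding X2 X3 by metis
qed

lemma no_vertex_data_111: "\<not> vertex_data 1 1 X1 1 1 X2 1 0 X3"
proof
  assume d: "vertex_data 1 1 X1 1 1 X2 1 0 X3"
  note r = vertex_data_ratio[OF d, unfolded gsin_vals] vertex_data_ratio[OF vertex_data_cyc[OF d], unfolded gsin_vals]
  have X: "X1 > 0" using d by (auto simp: vertex_data_def)
  have "c * X2 = c * X1" using r(1) by (auto simp: mult_ac)
  then have X2: "X2 = X1" using c_pos by simp
  have "c * X3 = c * (s * X1)" using r(2) by (auto simp: mult_ac)
  then have X3: "X3 = s * X1" using c_pos by simp
  obtain t1 t2 :: int where t: "- X1 - X2 - X3 = of_int t1 * ((1 - s) * (2 + s))" "X1 + X2 - X3 = of_int t2 * ((2 - s) * (1 + s))"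
    using d by (auto simp: vertex_data_def algebra_simps)
  then show False using shape_sum_apex[OF s_pos s_less_1 irr X] unfolding X2 X3 by metis
qed

lemma no_vertex_data_102: "\<not> vertex_data 1 1 X1 0 1 X2 2 0 X3"
proof
  assume d: "vertex_data 1 1 X1 0 1 X2 2 0 X3"
  note r = vertex_data_ratio[OF d, unfolded gsin_vals] vertex_data_ratio[OF vertex_data_cyc[OF d], unfolded gsin_vals]
  have X: "X1 > 0" and N: "N > 0" using d N_pos by (auto simp: vertex_data_def)
  have "c * X2 = c * ((1 - s\<^sup>2) * X1)" using r(1) by (auto simp: mult_ac)
  then have X2: "X2 = (1 - s\<^sup>2) * X1" using c_pos by simp
  have "c * X3 = c * (s * (2 - s\<^sup>2) * X1)" using r(2) by (auto simp: mult_ac)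
  then have X3: "X3 = s * (2 - s\<^sup>2) * X1" using c_pos by simp
  obtain t1 :: int where t: "- X1 + X2 + X3 = of_int t1 * ((1 - s) * (2 + s))"
    using d by (auto simp: vertex_data_def algebra_simps)
  have "X1 * X2 * (s * c * (2 - s\<^sup>2)) = real N * (1 - s\<^sup>2) * (s * c)" using d gsin_vals by (simp add: vertex_data_def)
  then have "X1 * X2 * (2 - s\<^sup>2) = real N * (1 - s\<^sup>2)"
    using area_cancel[of X1 X2 "2 - s\<^sup>2"] by (simp add: mult_ac)
  then have "(1 - s\<^sup>2) * (X1\<^sup>2 * (2 - s\<^sup>2)) = (1 - s\<^sup>2) * real N"
    unfolding X2 by (simp add: power2_eq_square mult_ac)
  then have a: "X1\<^sup>2 * (2 - s\<^sup>2) = real N" using tb_pos by simp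
  obtain Y where Y: "Y = X1 \<or> Y = (1 - s\<^sup>2) * X1" "is_side' Y"
    using d X2 by (auto simp: vertex_data_def)
  then obtain P Q R where "Y = of_nat P * s + of_nat Q * (1 - s\<^sup>2) + of_nat R" "Q + R > (0::nat)"
    by (auto simp: is_side'_def)
  then show False using shape_scalene[OF s_pos s_less_1 irr X N _ a Y(1)] t unfolding X2 X3 by metis
qed

text \<open>Ordering by the number of angles \<beta> leaves the patterns 2, 0, 0 and 1, 1, 0. The
  distribution that survives is the tile itself, because
  \<open>2 * \<alpha> + \<beta> = \<gamma>\<close>.\<close>

lemma vertex_data_sorted:
  assumes d: "vertex_data p1 q1 X1 p2 q2 X2 p3 q3 X3" and "q1 \<ge> q2" "q2 \<ge> q3"
  shows "{#(p1, q1), (p2, q2), (p3, q3)#} = {#(2, 1), (0, 1), (1, 0)#}"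
proof -
  have h: "p1 + q1 > 0" "p2 + q2 > 0" "p3 + q3 > 0" "p1 + p2 + p3 = 3" "q1 + q2 + q3 = 2"
    using d by (auto simp: vertex_data_def)
  have "q3 = 0" using h assms by linarith
  moreover from this have "q1 = 2 \<and> q2 = 0 \<or> q1 = 1 \<and> q2 = 1" using h(5) assms(2) by auto
  ultimately
  consider "q1 = 2" "q2 = 0" "q3 = 0" | "q1 = 1" "q2 = 1" "q3 = 0" by blast
  then show ?thesis
  proof cases
    case 1
    have "p1 = 1 \<and> p2 = 1 \<and> p3 = 1 \<or> p1 = 0 \<and> p2 = 1 \<and> p3 = 2 \<or> p1 = 0 \<and> p2 = 2 \<and> p3 = 1"
      by (rule two_pos_sum_3_cases) (use h 1 in auto)
    moreover have "\<not> (p1 = 1 \<and> p2 = 1 \<and> p3 = 1)" using d no_vertex_data_112 1 by blast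
    moreover have "\<not> (p1 = 0 \<and> p2 = 1 \<and> p3 = 2)" using d no_vertex_data_012 1 by blast
    moreover have "\<not> (p1 = 0 \<and> p2 = 2 \<and> p3 = 1)" using vertex_data_cyc[OF vertex_data_swap[OF d]] no_vertex_data_012 1 by blast
    ultimately show ?thesis by blast
  next
    case 2
    have "p1 = 0 \<and> p2 = 0 \<and> p3 = 3 \<or> p1 = 1 \<and> p2 = 0 \<and> p3 = 2 \<or> p1 = 0 \<and> p2 = 1 \<and> p3 = 2 \<or>
      p1 = 1 \<and> p2 = 1 \<and> p3 = 1 \<or> p1 = 2 \<and> p2 = 0 \<and> p3 = 1 \<or> p1 = 0 \<and> p2 = 2 \<and> p3 = 1"
      by (rule one_pos_sum_3_cases) (use h 2 in auto)
    moreover have "\<not> (p1 = 0 \<and> p2 = 0 \<and> p3 = 3)" using d no_vertex_data_003 2 by blast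
    moreover have "\<not> (p1 = 1 \<and> p2 = 0 \<and> p3 = 2)" using d no_vertex_data_102 2 by blast
    moreover have "\<not> (p1 = 0 \<and> p2 = 1 \<and> p3 = 2)" using vertex_data_swap[OF d] no_vertex_data_102 2 by blast
    moreover have "\<not> (p1 = 1 \<and> p2 = 1 \<and> p3 = 1)" using d no_vertex_data_111 2 by blast
    ultimately have "p1 = 2 \<and> p2 = 0 \<and> p3 = 1 \<or> p1 = 0 \<and> p2 = 2 \<and> p3 = 1" by blast
    then show ?thesis
    proof
      assume "p1 = 2 \<and> p2 = 0 \<and> p3 = 1"
      then show ?thesis unfolding 2 by (simp only:)
    next
      assume "p1 = 0 \<and> p2 = 2 \<and> p3 = 1"
      then show ?thesis unfolding 2 using mset_triple_permute(3)[of "(0, 1)" "(2, 1)" "(1, 0)"] by (simp only:)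
    qed
  qed
qed

lemma vertex_data_unique:
  assumes d: "vertex_data p1 q1 X1 p2 q2 X2 p3 q3 X3"
  shows "{#(p1, q1), (p2, q2), (p3, q3)#} = {#(2, 1), (0, 1), (1, 0)#}"
proof -
  let ?M = "{#(p1, q1), (p2, q2), (p3, q3)#}"
  have M: "{#(p2, q2), (p3, q3), (p1, q1)#} = ?M" "{#(p3, q3), (p1, q1), (p2, q2)#} = ?M"
    "{#(p2, q2), (p1, q1), (p3, q3)#} = ?M" "{#(p1, q1), (p3, q3), (p2, q2)#} = ?M" "{#(p3, q3), (p2, q2), (p1, q1)#} = ?M"
    by (rule mset_triple_permute)+
  note c1 = vertex_data_cyc[OF d]
  note c2 = vertex_data_cyc[OF c1]
  note s0 = vertex_data_swap[OF d]
  note s1 = vertex_data_cyc[OF s0]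
  note s2 = vertex_data_cyc[OF s1]
  consider "q1 \<ge> q2" "q2 \<ge> q3" | "q2 \<ge> q3" "q3 \<ge> q1" | "q3 \<ge> q1" "q1 \<ge> q2"
    | "q2 \<ge> q1" "q1 \<ge> q3" | "q1 \<ge> q3" "q3 \<ge> q2" | "q3 \<ge> q2" "q2 \<ge> q1" by linarith
  then show ?thesis
    using vertex_data_sorted[OF d] vertex_data_sorted[OF c1] vertex_data_sorted[OF c2] vertex_data_sorted[OF s0] vertex_data_sorted[OF s1] vertex_data_sorted[OF s2]
    unfolding M by cases blast+
qed

end

end

lemma unit_counts_mset:
  fixes a b c x1 x2 x3 :: real and p1 q1 r1 p2 q2 r2 p3 q3 r3 :: nat
  assumes x: "x1 = real p1 * a + real q1 * b + real r1 * c" "x2 = real p2 * a + real q2 * b + real r2 * c"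
      "x3 = real p3 * a + real q3 * b + real r3 * c"
    and pos: "p1 + q1 + r1 > 0" "p2 + q2 + r2 > 0" "p3 + q3 + r3 > 0"
    and sum: "p1 + p2 + p3 = 1" "q1 + q2 + q3 = 1" "r1 + r2 + r3 = 1"
  shows "{#x1, x2, x3#} = {#a, b, c#}"
proof -
  have 1: "p1 + q1 + r1 = 1" "p2 + q2 + r2 = 1" "p3 + q3 + r3 = 1" using pos sum by linarith+
  have c: "p = 1 \<and> q = 0 \<and> r = 0 \<or> p = 0 \<and> q = 1 \<and> r = 0 \<or> p = 0 \<and> q = 0 \<and> r = 1"
    if "p + q + r = 1" for p q r :: nat using that by auto
  show ?thesis
    using c[OF 1(1)] c[OF 1(2)] c[OF 1(3)] sum unfolding x by (elim disjE conjE) (simp_all add: add_mset_commute)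
qed

context angle_tiling begin

definition "similar_corners \<longleftrightarrow> {#corner A B C, corner B C A, corner C A B#} = {#2 * \<delta>, pi / 2 - 3 * \<delta>, pi / 2 + \<delta>#}"

lemma corners_sum:
  "corner A B C + corner B C A + corner C A B = pi"
  "(real (na A + na B + na C)) * (2 * \<delta>) + real (nb A + nb B + nb C) * (pi / 2 - 3 * \<delta>) + real (nc A + nc B + nc C) * (pi / 2 + \<delta>) = pi"
proof -
  interpret B: angle_tiling \<delta> I u v w B C A by (rule cyc)
  interpret C: angle_tiling \<delta> I u v w C A B by (rule B.cyc)
  show 1: "corner A B C + corner B C A + corner C A B = pi" by (rule corner_sum[OF orient_ABC])
  show "(real (na A + na B + na C)) * (2 * \<delta>) + real (nb A + nb B + nb C) * (pi / 2 - 3 * \<delta>) + real (nc A + nc B + nc C) * (pi / 2 + \<delta>) = pi"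
    using 1 unfolding corner_A B.corner_A C.corner_A by (simp add: algebra_simps)
qed

theorem nonroot_case:
  assumes irr: "s \<notin> \<rat>" and nonroot: "\<And>n::nat. n > 0 \<Longrightarrow> \<omega> ^ n \<noteq> 1"
  shows similar_corners
proof -
  interpret B: angle_tiling \<delta> I u v w B C A by (rule cyc)
  interpret C: angle_tiling \<delta> I u v w C A B by (rule B.cyc)
  have indep: "x = 0" if e: "of_int x * \<delta> = of_int y * (pi / 2)" for x y :: int
  proof (rule ccontr)
    assume x: "x \<noteq> 0"
    \<comment> \<open>The factor 4 turns multiples of \<open>pi / 2\<close> into multiples of
      \<open>2 * pi\<close>, so a rational relation between \<open>\<delta>\<close> and
      \<open>pi\<close> makes \<omega> a root of unity.\<close>
    define n where "n = nat (4 * \<bar>x\<bar>)"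
    have n: "n > 0" "real n = 4 * \<bar>of_int x\<bar>" using x by (auto simp: n_def)
    have "real n * (pi / 2 + \<delta>) = 2 * pi * of_int (\<bar>x\<bar> + sgn x * y)"
    proof -
      have "real n * (pi / 2 + \<delta>) = 2 * pi * \<bar>of_int x\<bar> + 4 * sgn (of_int x) * (of_int x * \<delta>)"
        unfolding n(2) by (simp add: abs_sgn algebra_simps)
      also have "\<dots> = 2 * pi * of_int (\<bar>x\<bar> + sgn x * y)" unfolding e by (simp add: sgn_if algebra_simps)
      finally show ?thesis .
    qed
    then have "\<omega> ^ n = 1" unfolding \<omega>_def Complex.DeMoivre by (simp add: cis_multiple_2pi)
    then show False using nonroot[OF n(1)] by simp
  qed
  define P where "P = na A + na B + na C"
  define Q where "Q = nb A + nb B + nb C"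
  define R where "R = nc A + nc B + nc C"
  have eq: "real P * (2 * \<delta>) + real Q * (pi / 2 - 3 * \<delta>) + real R * (pi / 2 + \<delta>) = pi"
    unfolding P_def Q_def R_def by (rule corners_sum(2))
  then have "of_int (2 * int P - 3 * int Q + int R) * \<delta> = of_int (2 - int Q - int R) * (pi / 2)"
    by (simp add: field_simps)
  from indep[OF this] have m: "2 * int P - 3 * int Q + int R = 0" .
  then have "of_int (2 * int P - 3 * int Q + int R) * \<delta> = 0" by (simp only: of_int_0 mult_zero_left)
  then have "of_int (2 - int Q - int R) * (pi / 2) = 0" using eq by (simp add: field_simps)
  then have "2 - int Q - int R = 0" by simp
  then have "Q + R = 2" "2 * P + R = 3 * Q" using m by linarith+
  moreover from this have "Q = 0 \<or> Q = 1 \<or> Q = 2" by linarith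
  ultimately have "P = 1 \<and> Q = 1 \<and> R = 1 \<or> P = 3 \<and> Q = 2 \<and> R = 0" by (elim disjE) simp_all
  then consider "P = 1" "Q = 1" "R = 1" | "P = 3" "Q = 2" "R = 0" by blast
  then show ?thesis
  proof cases
    case 1
    then show ?thesis
      unfolding similar_corners_def
      using unit_counts_mset[OF corner_A B.corner_A C.corner_A count_pos B.count_pos C.count_pos]
      unfolding P_def Q_def R_def by blast
  next
    case 2
    have r0: "nc A = 0" "nc B = 0" "nc C = 0" using 2(3) by (auto simp: R_def)
    define X1 where "X1 = norm (C - B)"
    define X2 where "X2 = norm (A - C)"
    define X3 where "X3 = norm (B - A)"
    have X: "X1 > 0" "X2 > 0" "X3 > 0" using weak_neq[OF T] by (auto simp: X1_def X2_def X3_def)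
    have sinc: "sin (corner A B C) = gsin (na A) (nb A)" "sin (corner B C A) = gsin (na B) (nb B)" "sin (corner C A B) = gsin (na C) (nb C)"
      unfolding corner_A B.corner_A C.corner_A r0 gsin_def by simp_all
    have D: "orient A B C = real N * (1 - s\<^sup>2) * (s * c)" using area unfolding sin_2\<delta> .
    have cycD: "orient B C A = orient A B C" "orient C A B = orient A B C" by (simp_all add: orient_cyc orient_cyc[of C A B])
    have areas: "X1 * X2 * gsin (na C) (nb C) = real N * (1 - s\<^sup>2) * (s * c)"
      "X2 * X3 * gsin (na A) (nb A) = real N * (1 - s\<^sup>2) * (s * c)"
      "X3 * X1 * gsin (na B) (nb B) = real N * (1 - s\<^sup>2) * (s * c)"
      using area_corner[OF orient_ABC] area_corner[OF B.orient_ABC] area_corner[OF C.orient_ABC]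
      unfolding sinc cycD D X1_def X2_def X3_def by (simp_all add: norm_minus_commute mult_ac)
    have chi: "\<exists>t::int. ((-1) ^ na A * \<epsilon> ^ nb A) * X1 + ((-1) ^ na B * \<epsilon> ^ nb B) * X2 + ((-1) ^ na C * \<epsilon> ^ nb C) * X3
       = of_int t * (2 - s\<^sup>2 - \<epsilon> * s)" if \<epsilon>: "\<epsilon> = 1 \<or> \<epsilon> = -1" for \<epsilon>
    proof -
      \<comment> \<open>All three sides of \<open>ABC\<close> have directions in the coset of
        \<open>AB\<close>, since the corners are sums of tile angles.\<close>
      define d0 where "d0 = sgn (B - A)"
      have d0: "d0 \<noteq> 0" using weak_neq[OF T] by (auto simp: d0_def sgn_zero_iff)
      note dir = chi_dir[OF norm_\<omega> nonroot \<epsilon> d0]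
      define x y z where "x = (-1) ^ na A * \<epsilon> ^ nb A" "y = (-1) ^ na B * \<epsilon> ^ nb B" "z = (-1) ^ na C * \<epsilon> ^ nb C"
      have sq: "x = 1 \<or> x = -1" "y = 1 \<or> y = -1" "z = 1 \<or> z = -1"
      proof -
        have pm: "(-1) ^ n = (1::real) \<or> (-1) ^ n = (-1::real)" for n :: nat by (simp add: minus_one_power_iff)
        have pe: "\<epsilon> ^ n = 1 \<or> \<epsilon> ^ n = -1" for n using \<epsilon> pm[of n] by auto
        have "(-1) ^ m * \<epsilon> ^ n = 1 \<or> (-1) ^ m * \<epsilon> ^ n = -1" for m n
          using pm[of m] pe[of n] by (elim disjE) simp_all
        then show "x = 1 \<or> x = -1" "y = 1 \<or> y = -1" "z = 1 \<or> z = -1" unfolding x_y_z_def by blast+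
      qed
      have "x * y * z = (-1) ^ P * \<epsilon> ^ Q" unfolding x_y_z_def P_def Q_def by (simp add: power_add mult_ac)
      \<comment> \<open>Three angles \<alpha> and two angles \<beta> give
        \<open>(-1) ^ 3 * \<epsilon>\<^sup>2\<close>.\<close>
      then have xyz: "x * y * z = -1" using 2 \<epsilon> by auto
      have 1: "chi \<omega> \<epsilon> d0 (sgn (B - A)) = 1"
        using chi_pos[OF norm_\<omega> nonroot \<epsilon> d0, of 0] by (simp add: d0_def)
      have "chi \<omega> \<epsilon> d0 (sgn (C - A)) = (-1) ^ na A * \<epsilon> ^ (nb A + nc A) * chi \<omega> \<epsilon> d0 (sgn (B - A))"
        unfolding dir_A by (rule dir)
      then have "chi \<omega> \<epsilon> d0 (sgn (C - A)) = x"
        unfolding 1 x_y_z_def r0 by simp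
      then have 2: "chi \<omega> \<epsilon> d0 (sgn (A - C)) = - x"
        using chi_minus[OF norm_\<omega> nonroot \<epsilon> d0, of "sgn (C - A)"] sgn_minus[of "C - A"] by simp
      have "chi \<omega> \<epsilon> d0 (sgn (A - B)) = (-1) ^ na B * \<epsilon> ^ (nb B + nc B) * chi \<omega> \<epsilon> d0 (sgn (C - B))"
        unfolding B.dir_A by (rule dir)
      then have "chi \<omega> \<epsilon> d0 (sgn (A - B)) = y * chi \<omega> \<epsilon> d0 (sgn (C - B))"
        unfolding x_y_z_def r0 by simp
      moreover have "chi \<omega> \<epsilon> d0 (sgn (A - B)) = -1"
        using 1 chi_minus[OF norm_\<omega> nonroot \<epsilon> d0, of "sgn (B - A)"] sgn_minus[of "B - A"] by simp
      ultimately have 3: "chi \<omega> \<epsilon> d0 (sgn (C - B)) = - y" using sq(2) by auto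
      obtain t :: int where t: "X3 - y * X1 - x * X2 = of_int t * (2 - s\<^sup>2 - \<epsilon> * s)"
        using chi_tiling[OF norm_\<omega> nonroot \<epsilon> d0 T shape ts_pos tb_pos']
        unfolding 1 2 3 X1_def X2_def X3_def ts_\<omega> tb_\<omega> by (auto simp: algebra_simps)
      \<comment> \<open>Multiplying by the sign \<open>z\<close> puts the relation in a form
        symmetric in the corners, as \<open>vertex_data\<close> demands.\<close>
      have "x * X1 + y * X2 + z * X3 = z * (X3 - y * X1 - x * X2)"
        using sq xyz by (elim disjE) (auto simp: algebra_simps)
      also have "\<dots> = of_int (if z = 1 then t else - t) * (2 - s\<^sup>2 - \<epsilon> * s)" unfolding t using sq(3) by auto
      finally show ?thesis unfolding x_y_z_def by blast
    qed
    have f: "2 - s\<^sup>2 - 1 * s = (1 - s) * (2 + s)" "2 - s\<^sup>2 - (-1) * s = (2 - s) * (1 + s)"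
      by (simp_all add: algebra_simps power2_eq_square)
    have side: "is_side' X3" if "nb A = 0" using side'_A[OF that r0(1)] by (simp add: X3_def)
    have side2: "is_side' X1" if "nb B = 0" using B.side'_A[OF that r0(2)] by (simp add: X1_def)
    have side3: "is_side' X2" if "nb C = 0" using C.side'_A[OF that r0(3)] by (simp add: X2_def)
    have pos: "na A + nb A > 0" "na B + nb B > 0" "na C + nb C > 0"
      using count_pos B.count_pos C.count_pos unfolding r0 by (simp_all only: add_0_right)
    have sums: "na A + na B + na C = 3" "nb A + nb B + nb C = 2" using 2(1,2) unfolding P_def Q_def .
    have chi1: "\<exists>t::int. (-1) ^ na A * X1 + (-1) ^ na B * X2 + (-1) ^ na C * X3 = of_int t * ((1 - s) * (2 + s))"
      using chi[OF disjI1[OF refl]] unfolding f power_one mult_1_right .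
    have chi2: "\<exists>t::int. (-1) ^ (na A + nb A) * X1 + (-1) ^ (na B + nb B) * X2 + (-1) ^ (na C + nb C) * X3
        = of_int t * ((2 - s) * (1 + s))"
      using chi[OF disjI2[OF refl]] unfolding f power_add .
    have "vertex_data (na A) (nb A) X1 (na B) (nb B) X2 (na C) (nb C) X3"
      unfolding vertex_data_def by (intro conjI X pos sums areas chi1 chi2) (use side side2 side3 in blast)+
    from vertex_data_unique[OF irr this]
    have m: "{#(na A, nb A), (na B, nb B), (na C, nb C)#} = {#(2, 1), (0, 1), (1, 0)#}" .
    let ?f = "\<lambda>(p, q). real p * (2 * \<delta>) + real q * (pi / 2 - 3 * \<delta>)"
    have "image_mset ?f {#(na A, nb A), (na B, nb B), (na C, nb C)#} = {#corner A B C, corner B C A, corner C A B#}"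
      unfolding corner_A B.corner_A C.corner_A r0 by simp
    moreover have "image_mset ?f {#(2, 1), (0, 1), (1, 0)#} = {#2 * \<delta>, pi / 2 - 3 * \<delta>, pi / 2 + \<delta>#}"
      by (simp add: add_mset_commute)
    ultimately show ?thesis unfolding similar_corners_def m by simp
  qed
qed

end

section \<open>Conjugates of twice the real part of a root of unity\<close>

text \<open>Two numbers count as conjugate when they are zeros of the same integer polynomials,
  possibly in different fields; this takes the place of minimal polynomials.\<close>

definition ev :: "int poly \<Rightarrow> 'a::field_char_0 \<Rightarrow> 'a"
  where "ev p x = poly (map_poly of_int p) x"

lemma ev_pCons [simp]: "ev (pCons a p) x = of_int a + x * ev p x"
  by (simp add: ev_def map_poly_pCons)

lemma ev_0 [simp]: "ev 0 x = 0"
  by (simp add: ev_def)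

lemma ev_1 [simp]: "ev 1 x = 1"
  by (simp add: one_pCons)

lemma ev_add [simp]: "ev (p + q) x = ev p x + ev q x"
  by (induction p q rule: poly_induct2) (simp_all add: algebra_simps)

lemma ev_minus [simp]: "ev (- p) x = - ev p x"
  using ev_add[of p "- p" x] by (simp add: eq_neg_iff_add_eq_0 add.commute)

lemma ev_diff [simp]: "ev (p - q) x = ev p x - ev q x"
  using ev_add[of p "- q" x] by simp

lemma ev_smult [simp]: "ev (smult a p) x = of_int a * ev p x"
  by (induction p) (simp_all add: algebra_simps)

lemma ev_mult [simp]: "ev (p * q) x = ev p x * ev q x"
  by (induction p) (simp_all add: algebra_simps)

lemma ev_of_real: "ev p (of_real x :: complex) = of_real (ev p x)"
  by (induction p) simp_all

lemma degree_map_of_int: "degree (map_poly of_int p :: 'a::field_char_0 poly) = degree p"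
  by (rule degree_map_poly) auto

lemma ev_dvd: "p dvd q \<Longrightarrow> ev p x = 0 \<Longrightarrow> ev q x = 0"
  by (auto elim!: dvdE)

lemma ev_prime_factor:
  fixes h :: "int poly" and x :: "'a::field_char_0"
  assumes "h \<noteq> 0" "ev h x = 0"
  shows "\<exists>f. prime f \<and> f dvd h \<and> ev f x = 0"
  using assms
proof (induction h rule: prime_divisors_induct)
  case (unit u)
  then obtain v where "1 = u * v" by (auto elim!: dvdE)
  then have "ev u x * ev v x = 1" by (metis ev_1 ev_mult)
  then show ?case using unit by simp
next
  case (factor p h)
  show ?case
  proof (cases "ev p x = 0")
    case False
    then have "ev h x = 0" "h \<noteq> 0" using factor by auto
    then show ?thesis using factor.IH by (meson dvd_mult)
  qed (use factor in auto)
qed simp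

lemma ev_const: "degree p = 0 \<Longrightarrow> ev p x = 0 \<Longrightarrow> p = 0"
  by (elim degree_eq_zeroE) simp

text \<open>Division with remainder over the integers costs a constant factor, hence the
  pseudo-remainder. It vanishes at \<open>x\<close> and has too small a degree to be
  nonzero.\<close>

lemma ev_reduce:
  fixes g p :: "int poly" and x :: "'a::field_char_0"
  assumes g: "g \<noteq> 0" "ev g x = 0" and min: "\<And>h. h \<noteq> 0 \<Longrightarrow> ev h x = 0 \<Longrightarrow> degree g \<le> degree h" and p: "ev p x = 0"
  obtains a q where "a \<noteq> 0" "smult a p = g * q"
proof -
  obtain a q where aq: "a \<noteq> 0" "smult a p = g * q + pseudo_mod p g"
    using pseudo_mod(1)[OF g(1), of p] by blast
  have "ev (smult a p) x = ev (g * q + pseudo_mod p g) x" using aq by simp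
  then have "ev (pseudo_mod p g) x = 0" using g p by simp
  then have "pseudo_mod p g = 0"
    using min[of "pseudo_mod p g"] pseudo_mod(2)[OF g(1), of p] by force
  then show ?thesis using that aq by simp
qed

text \<open>A prime integer polynomial with zero \<open>x\<close> serves as minimal polynomial. Let
  \<open>g\<close> have least degree among the nonzero polynomials vanishing at \<open>x\<close>. A
  multiple of \<open>f\<close> is \<open>g * q\<close>; if \<open>f\<close> divided
  \<open>q\<close>, then \<open>g\<close> would be constant, so \<open>f\<close> divides
  \<open>g\<close> and with it a constant multiple of \<open>p\<close>.\<close>

lemma prime_dvd_ev:
  fixes f p :: "int poly" and x :: "'a::field_char_0"
  assumes f: "prime f" "ev f x = 0" and p: "ev p x = 0"
  shows "f dvd p"
proof -
  have pe: "prime_elem f" "f \<noteq> 0" using f by auto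
  let ?P = "\<lambda>g. g \<noteq> 0 \<and> ev g x = 0"
  define g where "g = arg_min degree ?P"
  have P: "?P g" and min: "\<And>h. ?P h \<Longrightarrow> degree g \<le> degree h"
    using arg_min_nat_lemma[of ?P f degree] pe f unfolding g_def by auto
  have dg: "degree g > 0" using P ev_const[of g x] by auto
  have df: "degree f > 0" using pe f ev_const[of f x] by auto
  have g: "g \<noteq> 0" "ev g x = 0" and min': "\<And>h. h \<noteq> 0 \<Longrightarrow> ev h x = 0 \<Longrightarrow> degree g \<le> degree h"
    using P min by auto
  have const: "\<not> f dvd [:a:]" if "a \<noteq> 0" for a
    using that df dvd_imp_degree_le[of f "[:a:]"] by auto
  obtain a q where a: "a \<noteq> 0" "smult a f = g * q" using ev_reduce[OF g min' f(2)] .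
  have "f dvd g * q" unfolding a(2)[symmetric] by (simp add: dvd_smult)
  then have "f dvd g \<or> f dvd q" using pe prime_elem_dvd_multD by blast
  moreover have "\<not> f dvd q"
  proof
    assume "f dvd q"
    then obtain r where "q = f * r" by (auto elim: dvdE)
    then have "f * [:a:] = f * (g * r)" using a(2) by (simp add: mult_ac)
    then have gr: "[:a:] = g * r" using mult_left_cancel[OF pe(2)] by blast
    then have "g \<noteq> 0" "r \<noteq> 0" using a by auto
    then have "degree (g * r) = degree g + degree r" by (rule degree_mult_eq)
    then show False using dg unfolding gr[symmetric] by simp
  qed
  ultimately have fg: "f dvd g" by blast
  obtain b r where b: "b \<noteq> 0" "smult b p = g * r" using ev_reduce[OF g min' p] .
  have "f dvd smult b p" unfolding b(2) using fg by simp
  then have "f dvd [:b:] * p" by simp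
  then show ?thesis using const[OF b(1)] pe prime_elem_dvd_multD by blast
qed

text \<open>Chebyshev polynomials rescaled to express \<open>2 * cos (n * x)\<close> in
  \<open>2 * cos x\<close>; for positive index this makes them monic over the integers.\<close>

fun cheb :: "nat \<Rightarrow> int poly" where
  "cheb 0 = [:2:]"
| "cheb (Suc 0) = [:0, 1:]"
| "cheb (Suc (Suc n)) = [:0, 1:] * cheb (Suc n) - cheb n"

lemma ev_cheb:
  fixes z :: "'a::field_char_0"
  assumes "z \<noteq> 0" shows "ev (cheb n) (z + inverse z) = z ^ n + inverse z ^ n"
proof (induction n rule: cheb.induct)
  case (3 n)
  define w where "w = inverse z"
  have zw: "z * w = 1" "w * z = 1" using assms by (simp_all add: w_def)
  have e1: "z * w ^ Suc n = w ^ n" "w * z ^ Suc n = z ^ n" using zw by (simp_all add: mult.assoc[symmetric])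
  have e2: "(z + w) * (z ^ Suc n + w ^ Suc n) = z ^ Suc (Suc n) + w ^ Suc (Suc n) + w * z ^ Suc n + z * w ^ Suc n"
    by (simp add: algebra_simps)
  have "(z + w) * (z ^ Suc n + w ^ Suc n) - (z ^ n + w ^ n) = z ^ Suc (Suc n) + w ^ Suc (Suc n)"
    unfolding e2 e1 by simp
  then show ?case using 3 unfolding w_def by simp
qed simp_all

lemma degree_cheb: "n > 0 \<Longrightarrow> degree (cheb n) = n \<and> lead_coeff (cheb n) = 1"
proof (induction n rule: cheb.induct)
  case (3 n)
  have 1: "degree (cheb (Suc n)) = Suc n" "lead_coeff (cheb (Suc n)) = 1" using 3 by auto
  then have "cheb (Suc n) \<noteq> 0" by auto
  then have 2: "degree ([:0, 1:] * cheb (Suc n)) = Suc (Suc n)" using 1 by simp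
  have 3: "degree (cheb n) \<le> n" using 3 by (cases n) auto
  have 4: "degree (cheb (Suc (Suc n))) = Suc (Suc n)"
    unfolding cheb.simps using 2 3 degree_add_eq_left[of "- cheb n" "[:0, 1:] * cheb (Suc n)"] by simp
  have "coeff (cheb n) (Suc (Suc n)) = 0" using 3 by (intro coeff_eq_0) simp
  then show ?case using 1 4 by simp
qed simp_all

text \<open>Solving \<open>x = z + inverse z\<close> turns the equation into
  \<open>(z ^ n - 1)\<^sup>2 = 0\<close>, which puts \<open>z\<close> on the unit circle. So all
  conjugates of twice the real part of a root of unity are real and at most 2 in modulus.\<close>

lemma cheb_roots:
  fixes x :: complex
  assumes n: "n > 0" and x: "ev (cheb n - [:2:]) x = 0"
  shows "x = of_real (Re x) \<and> \<bar>Re x\<bar> \<le> 2"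
proof -
  define h where "h = csqrt (x\<^sup>2 - 4)"
  define z where "z = (x + h) / 2"
  have h: "h\<^sup>2 = x\<^sup>2 - 4" by (simp add: h_def)
  have zz: "z * (x - z) = 1" unfolding z_def using h by (simp add: field_simps power2_eq_square)
  then have z: "z \<noteq> 0" by auto
  have xz: "x = z + inverse z" using zz z by (simp add: field_simps)
  have "z ^ n + inverse z ^ n = 2" using x ev_cheb[OF z, of n] unfolding xz by simp
  moreover have "z ^ n * inverse z ^ n = 1" using z by (simp add: power_mult_distrib[symmetric])
  ultimately have "(z ^ n - 1)\<^sup>2 = 0"
    using z by (simp add: field_simps power2_eq_square)
  then have "z ^ n = 1" by simp
  then have "norm z ^ n = 1 ^ n" by (metis norm_one norm_power power_one)
  then have nz: "norm z = 1" by (rule power_eq_imp_eq_base) (use n in auto)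
  then have "z * cnj z = 1" by (simp add: complex_norm_square[symmetric])
  then have "inverse z = cnj z" using z by (simp add: field_simps)
  then have "x = of_real (2 * Re z)" unfolding xz by (simp add: complex_eq_iff)
  moreover have "\<bar>Re z\<bar> \<le> 1" using abs_Re_le_cmod[of z] nz by simp
  ultimately show ?thesis by simp
qed

lemma ev_int: "ev p (of_int k) = of_int (poly p k)"
  by (induction p) simp_all

text \<open>\<open>Z\<close> consists of the zeros of the prime factor \<open>f\<close> of
  \<open>cheb n - 2\<close> that vanishes at \<open>y\<close>. As \<open>f\<close> has leading
  coefficient 1 or -1 and simple zeros, the product of \<open>k - z\<close> over \<open>Z\<close> is
  \<open>f(k)\<close> up to sign, hence an integer; \<open>k = 0, 1, -1\<close> are needed.\<close>

lemma conjugates_of_root_of_unity: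
  assumes n: "n > 0" and w: "norm w = 1" "w ^ n = 1" and y: "y = 2 * Re w" "-1 < y" "y < 0"
  obtains Z :: "real set" where "finite Z" "y \<in> Z" "\<And>z. z \<in> Z \<Longrightarrow> \<bar>z\<bar> < 2 \<and> z \<noteq> 0 \<and> \<bar>z\<bar> \<noteq> 1"
    "\<And>z p. z \<in> Z \<Longrightarrow> ev p z = 0 \<longleftrightarrow> ev p y = 0" "\<And>z. (\<And>p. ev p z = 0 \<longleftrightarrow> ev p y = 0) \<Longrightarrow> z \<in> Z"
    "(\<Prod>z\<in>Z. z) \<in> \<int>" "(\<Prod>z\<in>Z. 1 - z) \<in> \<int>" "(\<Prod>z\<in>Z. 1 + z) \<in> \<int>"
proof -
  define h where "h = cheb n - [:2:]"
  have dh: "degree h = n" "lead_coeff h = 1"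
  proof -
    have "degree (cheb n + - [:2:]) = degree (cheb n)"
      using degree_cheb[OF n] n by (intro degree_add_eq_left) simp
    then show 1: "degree h = n" using degree_cheb[OF n] unfolding h_def diff_conv_add_uminus by simp
    have "lead_coeff h = coeff (cheb n) n - coeff [:2:] n" unfolding 1 by (simp add: h_def)
    moreover have "coeff [:2::int:] n = 0" using n by (cases n) auto
    moreover have "coeff (cheb n) n = 1" using degree_cheb[OF n] by metis
    ultimately show "lead_coeff h = 1" by simp
  qed
  have h0: "h \<noteq> 0" using dh by auto
  have "w * cnj w = 1" using w(1) by (simp add: complex_norm_square[symmetric])
  then have w0: "w \<noteq> 0" and iw: "inverse w = cnj w" by (auto intro: inverse_unique)
  have "ev h (w + inverse w) = 0" unfolding h_def using ev_cheb[OF w0, of n] w(2)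
    by (simp add: power_inverse)
  moreover have "w + inverse w = of_real y" unfolding iw y by (simp add: complex_eq_iff)
  ultimately have "ev h (complex_of_real y) = 0" by simp
  then obtain f where f: "prime f" "f dvd h" "ev f (complex_of_real y) = 0"
    using ev_prime_factor[OF h0] by blast
  have f0: "f \<noteq> 0" using f by auto
  have df: "degree f > 0" using f0 f(3) ev_const[of f "complex_of_real y"] by auto
  obtain g where g: "h = f * g" using f by (auto elim: dvdE)
  have "lead_coeff f * lead_coeff g = 1" using dh(2) unfolding g lead_coeff_mult by simp
  then have "\<bar>lead_coeff f * lead_coeff g\<bar> = 1" by simp
  then have lc: "\<bar>lead_coeff f\<bar> = 1" by (rule abs_zmult_eq_1)
  define F :: "complex poly" where "F = map_poly of_int f"
  have evF: "poly F x = ev f x" for x by (simp add: F_def ev_def)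
  have lF: "lead_coeff F = of_int (lead_coeff f)" unfolding F_def by (simp add: degree_map_of_int coeff_map_poly)
  have F0: "F \<noteq> 0" using f0 lc lF by auto
  have real: "x = of_real (Re x) \<and> \<bar>Re x\<bar> \<le> 2" if "ev f x = 0" for x :: complex
    using cheb_roots[OF n, of x] ev_dvd[OF f(2) that] unfolding h_def by blast
  have key: "ev p x = 0 \<longleftrightarrow> ev p x' = 0" if "ev f x = 0" "ev f x' = 0" for p and x x' :: complex
    using prime_dvd_ev[OF f(1) that(1), of p] prime_dvd_ev[OF f(1) that(2), of p] ev_dvd that by blast
  \<comment> \<open>A double zero would be a zero of the derivative, so \<open>f\<close> would
    divide a polynomial of smaller degree.\<close>
  have sq: "rsquarefree F"
    unfolding rsquarefree_roots
  proof (intro allI notI)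
    fix a assume a: "poly F a = 0 \<and> poly (pderiv F) a = 0"
    have "pderiv F = map_poly of_int (pderiv f)" unfolding F_def
      by (rule poly_eqI) (simp add: coeff_pderiv coeff_map_poly)
    then have "ev (pderiv f) a = 0" using a by (simp add: ev_def)
    then have "f dvd pderiv f" using prime_dvd_ev[OF f(1), of a "pderiv f"] a evF by simp
    moreover have "pderiv f \<noteq> 0" using df by (simp add: pderiv_eq_0_iff)
    ultimately have "degree f \<le> degree (pderiv f)" by (rule dvd_imp_degree_le)
    then show False using df by (simp add: degree_pderiv)
  qed
  define R where "R = {x. poly F x = 0}"
  have finR: "finite R" unfolding R_def by (rule poly_roots_finite[OF F0])
  define Z where "Z = Re ` R"
  have Rreal: "x = of_real (Re x)" "\<bar>Re x\<bar> \<le> 2" "ev f x = 0" if "x \<in> R" for x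
    using real that unfolding R_def evF by auto
  have inj: "inj_on Re R" by (rule inj_onI) (metis Rreal(1))
  have ZR: "ev f (complex_of_real z) = 0" if "z \<in> Z" for z using that Rreal unfolding Z_def by force
  have keyZ: "ev p z = 0 \<longleftrightarrow> ev p y = 0" if "z \<in> Z" for z p
    using key[OF ZR[OF that] f(3), of p] by (simp add: ev_of_real)
  have prod: "(\<Prod>z\<in>Z. of_int k - z) \<in> \<int>" for k
  proof -
    have "of_int (lead_coeff f) * (\<Prod>x\<in>R. of_int k - x) = ev f (of_int k :: complex)"
    proof -
      have "poly F (of_int k) = poly (smult (lead_coeff F) (\<Prod>x\<in>R. [:-x, 1:])) (of_int k)"
        unfolding R_def complex_poly_decompose_rsquarefree[OF sq] ..
      then show ?thesis unfolding evF lF by (simp add: poly_prod)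
    qed
    also have "(\<Prod>x\<in>R. of_int k - x) = of_real (\<Prod>z\<in>Z. of_int k - z)"
      unfolding Z_def prod.reindex[OF inj] of_real_prod
      by (rule prod.cong[OF refl]) (use Rreal(1) in \<open>auto simp: complex_eq_iff\<close>)
    finally have "complex_of_real (of_int (lead_coeff f) * (\<Prod>z\<in>Z. of_int k - z)) = of_real (of_int (poly f k))"
      by (simp add: ev_int)
    then have e: "of_int (lead_coeff f) * (\<Prod>z\<in>Z. of_int k - z) = of_int (poly f k)" by (simp only: of_real_eq_iff)
    have "lead_coeff f = 1 \<or> lead_coeff f = -1" using lc by linarith
    then have "(\<Prod>z\<in>Z. of_int k - z) = of_int (poly f k) \<or> (\<Prod>z\<in>Z. of_int k - z) = of_int (- poly f k)"
      using e by auto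
    then show ?thesis by (metis Ints_of_int)
  qed
  \<comment> \<open>Conjugates of a non-integer are no integers, and \<open>y\<close> lies strictly
    between -1 and 0.\<close>
  have ints: "\<bar>z\<bar> < 2 \<and> z \<noteq> 0 \<and> \<bar>z\<bar> \<noteq> 1" if "z \<in> Z" for z
  proof -
    have "z \<noteq> of_int k" if k: "k \<in> {-2, -1, 0, 1, 2}" for k
    proof
      assume "z = of_int k"
      then have "ev [:-k, 1:] z = 0" by simp
      then have "ev [:-k, 1:] y = 0" using keyZ[OF \<open>z \<in> Z\<close>] by blast
      then have "y = of_int k" by simp
      then have "-1 < k" "k < 0" using y by simp_all
      then show False by simp
    qed
    from this[of 2] this[of "-2"] this[of 0] this[of 1] this[of "-1"]
    have "z \<noteq> 2" "z \<noteq> -2" "z \<noteq> 0" "z \<noteq> 1" "z \<noteq> -1" by simp_all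
    moreover have "\<bar>z\<bar> \<le> 2" using that Rreal(2) unfolding Z_def by auto
    ultimately show ?thesis by linarith
  qed
  show ?thesis
  proof (rule that[of Z])
    show "finite Z" using finR by (simp add: Z_def)
    have "complex_of_real y \<in> R" using f(3) by (simp add: R_def evF)
    then show "y \<in> Z" unfolding Z_def by force
    show "z \<in> Z" if "\<And>p. ev p z = 0 \<longleftrightarrow> ev p y = 0" for z
    proof -
      have "ev f z = 0" using f(3) that by (simp add: ev_of_real)
      then have "complex_of_real z \<in> R" by (simp add: R_def evF ev_of_real)
      then show ?thesis unfolding Z_def by force
    qed
    show "(\<Prod>z\<in>Z. z) \<in> \<int>"
    proof -
      have "(\<Prod>z\<in>Z. z) = (-1) ^ card Z * (\<Prod>z\<in>Z. of_int 0 - z)"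
        by (simp add: prod_uminus power_mult_distrib[symmetric] mult.assoc[symmetric])
      then show ?thesis using prod[of 0] by (simp add: Ints_mult Ints_power)
    qed
    show "(\<Prod>z\<in>Z. 1 - z) \<in> \<int>" using prod[of 1] by simp
    show "(\<Prod>z\<in>Z. 1 + z) \<in> \<int>"
    proof -
      have "(\<Prod>z\<in>Z. 1 + z) = (\<Prod>z\<in>Z. - (of_int (-1) - z))" by (intro prod.cong) auto
      also have "\<dots> = (-1) ^ card Z * (\<Prod>z\<in>Z. of_int (-1) - z)" by (rule prod_uminus)
      finally show ?thesis using prod[of "-1"] by (simp add: Ints_mult Ints_power)
    qed
  qed (use ints keyZ in auto)
qed

lemma ev_pcompose_minus: "ev (pcompose p [:0, -1:]) x = ev p (- x)"
  by (induction p) (simp_all add: pcompose_pCons algebra_simps)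

lemma Ints_between:
  fixes x :: real
  assumes "x \<in> \<int>" "x > 0" shows "x \<ge> 1"
  using assms by (auto elim!: Ints_cases)

text \<open>The product of \<open>g z = z\<^sup>2 * \<bar>1 - z\<^sup>2\<bar>\<close> over all
  conjugates is a positive integer. A conjugate of modulus below 1 contributes at most
  \<open>1 / 4\<close>, one of modulus above 1 less than \<open>4 * 3 = 12\<close>. Hence a large
  one exists, and if all large ones share one modulus, only very few small ones fit.\<close>

lemma conjugate_alternatives:
  assumes fin: "finite Z" and y: "y \<in> Z" "-1 < y" "y < 0"
    and Z: "\<And>z. z \<in> Z \<Longrightarrow> \<bar>z\<bar> < 2 \<and> z \<noteq> 0 \<and> \<bar>z\<bar> \<noteq> 1"
    and ev: "\<And>z p. z \<in> Z \<Longrightarrow> ev p z = 0 \<longleftrightarrow> ev p y = 0" "\<And>z. (\<And>p. ev p z = 0 \<longleftrightarrow> ev p y = 0) \<Longrightarrow> z \<in> Z"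
    and int: "(\<Prod>z\<in>Z. z) \<in> \<int>" "(\<Prod>z\<in>Z. 1 - z) \<in> \<int>" "(\<Prod>z\<in>Z. 1 + z) \<in> (\<int> :: real set)"
  shows "(\<exists>z1\<in>Z. \<exists>z2\<in>Z. \<bar>z1\<bar> > 1 \<and> \<bar>z2\<bar> > 1 \<and> \<bar>z1\<bar> \<noteq> \<bar>z2\<bar>) \<or>
    (\<exists>z\<in>Z. \<bar>z\<bar> > 1 \<and> (y\<^sup>2 * z\<^sup>2 = 1 \<and> y\<^sup>2 + z\<^sup>2 = 3 \<or> (y\<^sup>2 * z\<^sup>2 = 1 \<or> y\<^sup>2 * z\<^sup>2 = 2) \<and> y\<^sup>2 + z\<^sup>2 = 4))"
proof (rule disjCI)
  assume "\<not> (\<exists>z\<in>Z. \<bar>z\<bar> > 1 \<and> (y\<^sup>2 * z\<^sup>2 = 1 \<and> y\<^sup>2 + z\<^sup>2 = 3 \<or> (y\<^sup>2 * z\<^sup>2 = 1 \<or> y\<^sup>2 * z\<^sup>2 = 2) \<and> y\<^sup>2 + z\<^sup>2 = 4))"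
  then have no: "\<not> (y\<^sup>2 * z\<^sup>2 = 1 \<and> y\<^sup>2 + z\<^sup>2 = 3 \<or> (y\<^sup>2 * z\<^sup>2 = 1 \<or> y\<^sup>2 * z\<^sup>2 = 2) \<and> y\<^sup>2 + z\<^sup>2 = 4)"
    if "z \<in> Z" "\<bar>z\<bar> > 1" for z using that by blast
  show "\<exists>z1\<in>Z. \<exists>z2\<in>Z. \<bar>z1\<bar> > 1 \<and> \<bar>z2\<bar> > 1 \<and> \<bar>z1\<bar> \<noteq> \<bar>z2\<bar>"
  proof (rule ccontr)
    assume "\<not> ?thesis"
    then have same: "\<bar>z1\<bar> = \<bar>z2\<bar>" if "z1 \<in> Z" "z2 \<in> Z" "\<bar>z1\<bar> > 1" "\<bar>z2\<bar> > 1" for z1 z2 using that by blast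
    define g where "g = (\<lambda>z::real. z\<^sup>2 * \<bar>(1 - z) * (1 + z)\<bar>)"
    have g1: "g z \<le> 1 / 4" if "\<bar>z\<bar> < 1" for z
    proof -
      have "z\<^sup>2 < 1" using that by (simp add: abs_square_less_1)
      then have "g z = z\<^sup>2 * (1 - z\<^sup>2)" by (simp add: g_def algebra_simps power2_eq_square)
      also have "\<dots> = 1 / 4 - (z\<^sup>2 - 1 / 2)\<^sup>2" by (simp add: algebra_simps power2_eq_square)
      finally show ?thesis by simp
    qed
    have sq: "1 < z\<^sup>2 \<and> z\<^sup>2 < 4" if "\<bar>z\<bar> > 1" "\<bar>z\<bar> < 2" for z :: real
      using that power_strict_mono[of 1 "\<bar>z\<bar>" 2] power_strict_mono[of "\<bar>z\<bar>" 2 2] by simp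
    have g2: "g z < 12" if "\<bar>z\<bar> > 1" "\<bar>z\<bar> < 2" for z
    proof -
      have "g z = z\<^sup>2 * (z\<^sup>2 - 1)" using sq[OF that] by (simp add: g_def algebra_simps power2_eq_square)
      also have "\<dots> < 4 * 3" using sq[OF that] by (intro mult_strict_mono) auto
      finally show ?thesis by simp
    qed
    have gpos: "g z > 0" if "z \<in> Z" for z
    proof -
      have "1 - z \<noteq> 0" "1 + z \<noteq> 0" "z \<noteq> 0" using Z[OF that] by auto
      then show ?thesis by (simp add: g_def)
    qed
    have "(\<Prod>z\<in>Z. g z) = (\<Prod>z\<in>Z. z)\<^sup>2 * \<bar>(\<Prod>z\<in>Z. 1 - z) * (\<Prod>z\<in>Z. 1 + z)\<bar>"
      by (simp add: g_def prod.distrib abs_mult abs_prod power2_eq_square)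
    then have "(\<Prod>z\<in>Z. g z) \<in> \<int>" using int by (simp add: Ints_mult Ints_abs Ints_power)
    moreover have "(\<Prod>z\<in>Z. g z) > 0" using gpos by (intro prod_pos) auto
    ultimately have ge1: "(\<Prod>z\<in>Z. g z) \<ge> 1" by (rule Ints_between)
    define Big where "Big = {z \<in> Z. \<bar>z\<bar> > 1}"
    define Small where "Small = {z \<in> Z. \<bar>z\<bar> < 1}"
    have part: "Z = Big \<union> Small" "Big \<inter> Small = {}" "finite Big" "finite Small"
      using Z fin unfolding Big_def Small_def by (auto simp: neq_iff)
    have ySmall: "y \<in> Small" using y by (simp add: Small_def)
    have split: "(\<Prod>z\<in>Z. g z) = (\<Prod>z\<in>Big. g z) * (\<Prod>z\<in>Small. g z)"
      unfolding part(1) by (rule prod.union_disjoint) (use part in auto)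
    have small: "(\<Prod>z\<in>Small. g z) \<le> (1 / 4) ^ card Small"
    proof -
      have "(\<Prod>z\<in>Small. g z) \<le> (\<Prod>z\<in>Small. 1 / 4)"
        by (rule prod_mono) (use gpos g1 in \<open>auto simp: Small_def intro: less_imp_le\<close>)
      then show ?thesis by simp
    qed
    \<comment> \<open>Both quantities are positive integers \<open>m\<close>, \<open>n\<close>, and
      \<open>y\<^sup>2 + z\<^sup>2 = 1 + m + n\<close> is less than \<open>1 + 4\<close>. The three
      possible pairs are the excluded alternatives.\<close>
    have finish: False if z: "z \<in> Big" and k: "y\<^sup>2 * z\<^sup>2 \<in> \<int>" and l: "(1 - y\<^sup>2) * (z\<^sup>2 - 1) \<in> \<int>" for z
    proof -
      have zz: "z \<in> Z" "\<bar>z\<bar> > 1" "1 < z\<^sup>2" "z\<^sup>2 < 4" using z Z sq unfolding Big_def by auto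
      have yy: "0 < y\<^sup>2" "y\<^sup>2 < 1" using y by (auto simp: abs_square_less_1)
      obtain m where m: "y\<^sup>2 * z\<^sup>2 = of_int m" using k by (auto elim: Ints_cases)
      obtain n where n: "(1 - y\<^sup>2) * (z\<^sup>2 - 1) = of_int n" using l by (auto elim: Ints_cases)
      have "y\<^sup>2 * z\<^sup>2 > 0" "(1 - y\<^sup>2) * (z\<^sup>2 - 1) > 0" using zz yy by simp_all
      then have mn: "m > 0" "n > 0" unfolding m n by simp_all
      have sum: "y\<^sup>2 + z\<^sup>2 = of_int (1 + m + n)" using m n by (simp add: algebra_simps)
      have "real_of_int (1 + m + n) < of_int 5" unfolding sum[symmetric] using zz yy by simp
      then have "1 + m + n < 5" by (simp only: of_int_less_iff)
      then have "m = 1 \<or> m = 2" "n = 1 \<or> n = 2" "m + n < 4" using mn by linarith+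
      then have "m = 1 \<and> n = 1 \<or> m = 1 \<and> n = 2 \<or> m = 2 \<and> n = 1" by (elim disjE) simp_all
      then show False using no[OF zz(1,2)] m sum by auto
    qed
    show False
    proof (cases "Big = {}")
      case True
      have "(1 / 4 :: real) ^ card Small \<le> 1 / 4"
      proof -
        have "card Small > 0" using ySmall part(4) by (auto simp: card_gt_0_iff)
        then show ?thesis using power_decreasing[of 1 "card Small" "1 / 4 :: real"] by simp
      qed
      then show False using ge1 split small True by simp
    next
      case False
      then obtain r where r: "r \<in> Big" by blast
      have Big: "z = r \<or> z = - r" if "z \<in> Big" for z using same[of z r] that r unfolding Big_def by auto
      have r1: "\<bar>r\<bar> > 1" "\<bar>r\<bar> < 2" "r \<in> Z" using r Z unfolding Big_def by auto
      have yy: "y\<^sup>2 < 1" using y by (auto simp: abs_square_less_1)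
      show False
      proof (cases "- r \<in> Z")
        case False
        then have B: "Big = {r}" using Big r unfolding Big_def by blast
        have "1 \<le> g r * (1 / 4) ^ card Small"
          using ge1 split small gpos[OF r1(3)] unfolding B by (simp add: mult_left_mono order_trans)
        also have "\<dots> < 12 * (1 / 4) ^ card Small" using g2[OF r1(1,2)] by simp
        finally have c: "(4::real) ^ card Small < 12" by (simp add: power_one_over field_simps)
        have "card Small < 2"
        proof (rule ccontr)
          assume "\<not> card Small < 2"
          then have "(4::real) ^ 2 \<le> 4 ^ card Small" by (intro power_increasing) auto
          then show False using c by simp
        qed
        then have "card Small \<le> 1" by simp
        moreover have "card Small > 0" using ySmall part(4) by (auto simp: card_gt_0_iff)
        ultimately have "card Small = 1" by linarith
        then obtain x where "Small = {x}" by (rule card_1_singletonE)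
        then have S: "Small = {y}" using ySmall by simp
        have Zs: "Z = {r, y}" "r \<noteq> y" using part B S by auto
        have "y\<^sup>2 * r\<^sup>2 = (\<Prod>z\<in>Z. z)\<^sup>2" using Zs by (simp add: power_mult_distrib)
        then have k: "y\<^sup>2 * r\<^sup>2 \<in> \<int>" using int by (simp add: Ints_power)
        have "(1 - y\<^sup>2) * (r\<^sup>2 - 1) = - ((\<Prod>z\<in>Z. 1 - z) * (\<Prod>z\<in>Z. 1 + z))"
          using Zs by (simp add: algebra_simps power2_eq_square)
        then have "(1 - y\<^sup>2) * (r\<^sup>2 - 1) \<in> \<int>" using int by (simp add: Ints_mult Ints_minus del: mult_minus_left mult_minus_right)
        then show False using finish[OF r k] by blast
      next
        case True
        then have B: "Big = {r, - r}" "r \<noteq> - r" using Big r r1 unfolding Big_def by auto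
        \<comment> \<open>If one conjugate has its negative among the conjugates, all do: substitute
          \<open>- x\<close> in the polynomial.\<close>
        have neg: "- z \<in> Z" if "z \<in> Z" for z
        proof (rule ev(2))
          fix p
          have "ev p (- z) = 0 \<longleftrightarrow> ev (pcompose p [:0, -1:]) z = 0" by (simp only: ev_pcompose_minus)
          also have "\<dots> \<longleftrightarrow> ev (pcompose p [:0, -1:]) y = 0" by (rule ev(1)[OF that])
          also have "\<dots> \<longleftrightarrow> ev (pcompose p [:0, -1:]) r = 0" by (rule ev(1)[OF r1(3), symmetric])
          also have "\<dots> \<longleftrightarrow> ev p (- r) = 0" by (simp only: ev_pcompose_minus)
          also have "\<dots> \<longleftrightarrow> ev p y = 0" by (rule ev(1)[OF True])
          finally show "ev p (- z) = 0 \<longleftrightarrow> ev p y = 0" .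
        qed
        have "1 \<le> (g r * g (- r)) * (1 / 4) ^ card Small"
          using ge1 split small gpos[OF r1(3)] gpos[OF True] B by (simp add: mult_left_mono order_trans)
        also have "\<dots> < (12 * 12) * (1 / 4) ^ card Small"
          using g2[of r] g2[of "- r"] r1 gpos[OF r1(3)] gpos[OF True]
          by (intro mult_strict_right_mono mult_strict_mono) auto
        finally have c: "(4::real) ^ card Small < 144" by (simp add: power_one_over field_simps)
        have card: "card Small < 4"
        proof (rule ccontr)
          assume "\<not> card Small < 4"
          then have "(4::real) ^ 4 \<le> 4 ^ card Small" by (intro power_increasing) auto
          then show False using c by simp
        qed
        \<comment> \<open>A further small conjugate would come with its negative and give four, but
          \<open>4 ^ 4\<close> exceeds \<open>12 * 12\<close>.\<close>
        have S: "Small = {y, - y}"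
        proof (rule ccontr)
          assume "Small \<noteq> {y, - y}"
          moreover have "- y \<in> Small" using neg[OF y(1)] y by (simp add: Small_def)
          ultimately obtain z where z: "z \<in> Small" "z \<noteq> y" "z \<noteq> - y" using ySmall by blast
          have "z \<noteq> 0" using z Z by (auto simp: Small_def)
          have sub: "{y, - y, z, - z} \<subseteq> Small" using ySmall z neg by (auto simp: Small_def)
          have "- y \<noteq> y" "- z \<noteq> z" "- z \<noteq> y" "- z \<noteq> - y" using z \<open>z \<noteq> 0\<close> y by auto
          then have "card {y, - y, z, - z} = 4" using z(2,3) by simp
          then show False using card_mono[OF part(4) sub] card by simp
        qed
        have Zs: "Z = {r, - r, y, - y}" using part B S by auto
        have d: "r \<noteq> y" "r \<noteq> - y" "y \<noteq> - y" "r \<noteq> - r" using r1 y by auto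
        have "y\<^sup>2 * r\<^sup>2 = (\<Prod>z\<in>Z. z)" unfolding Zs using d d[symmetric] by (simp add: power2_eq_square)
        then have k: "y\<^sup>2 * r\<^sup>2 \<in> \<int>" using int by simp
        have "(1 - y\<^sup>2) * (r\<^sup>2 - 1) = - (\<Prod>z\<in>Z. 1 - z)"
        proof -
          have "(\<Prod>z\<in>{r, - r, y, - y}. 1 - z) = (1 - r) * ((1 + r) * ((1 - y) * (1 + y)))" using d d[symmetric] by simp
          then show ?thesis unfolding Zs by (simp add: algebra_simps power2_eq_square)
        qed
        then have "(1 - y\<^sup>2) * (r\<^sup>2 - 1) \<in> \<int>" using int by (simp add: Ints_minus)
        then show False using finish[OF r k] by blast
      qed
    qed
  qed
qed

text \<open>For a unit \<omega> this is a ring closed under conjugation, because \<omega> satisfies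
  a quadratic equation over the integer polynomials in \<open>2 * Re \<omega>\<close>.\<close>

definition zring :: "complex \<Rightarrow> complex set"
  where "zring \<omega> = {of_real (ev p (2 * Re \<omega>)) + of_real (ev q (2 * Re \<omega>)) * \<omega> | p q. True}"

text \<open>\<open>F\<close> keeps the coefficient polynomials and replaces \<omega>. As \<omega> is
  not real, an element vanishes only if both coefficients do, a condition shared by conjugates. This
  gives independence of the representation and injectivity at once.\<close>

lemma zring_embedding:
  fixes \<omega> \<omega>' :: complex
  assumes n: "norm \<omega> = 1" "norm \<omega>' = 1" and im: "Im \<omega> \<noteq> 0" "Im \<omega>' \<noteq> 0"
    and ev: "\<And>p. ev p (2 * Re \<omega>') = 0 \<longleftrightarrow> ev p (2 * Re \<omega>) = 0"
  shows "\<exists>F. embedding (zring \<omega>) F \<omega> \<and> F \<omega> = \<omega>'"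
proof -
  define c where "c = (\<lambda>w p q. of_real (ev p (2 * Re w)) + of_real (ev q (2 * Re w)) * w :: complex)"
  define F where "F = (\<lambda>x. let pq = (SOME pq. x = c \<omega> (fst pq) (snd pq)) in c \<omega>' (fst pq) (snd pq))"
  have L: "x \<in> zring \<omega> \<longleftrightarrow> (\<exists>p q. x = c \<omega> p q)" for x by (auto simp: zring_def c_def)
  have Lc: "c \<omega> p q \<in> zring \<omega>" for p q using L by blast
  have diff: "c w p q - c w p' q' = c w (p - p') (q - q')" for w p q p' q'
    by (simp add: c_def algebra_simps)
  have zero: "c w p q = 0 \<longleftrightarrow> ev p (2 * Re w) = 0 \<and> ev q (2 * Re w) = 0" if "Im w \<noteq> 0" for w p q
    using that by (auto simp: c_def complex_eq_iff)
  have zero': "c \<omega>' p q = 0 \<longleftrightarrow> c \<omega> p q = 0" for p q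
    unfolding zero[OF im(1)] zero[OF im(2)] ev ..
  have Fc: "F (c \<omega> p q) = c \<omega>' p q" for p q
  proof -
    define pq where "pq = (SOME pq. c \<omega> p q = c \<omega> (fst pq) (snd pq))"
    have "c \<omega> p q = c \<omega> (fst pq) (snd pq)"
      unfolding pq_def by (rule someI[of "\<lambda>pq. c \<omega> p q = c \<omega> (fst pq) (snd pq)" "(p, q)"]) simp
    then have "c \<omega> (p - fst pq) (q - snd pq) = 0" by (simp add: diff[symmetric])
    then have "c \<omega>' (p - fst pq) (q - snd pq) = 0" by (simp only: zero')
    then have "c \<omega>' p q = c \<omega>' (fst pq) (snd pq)" by (simp add: diff[symmetric])
    then show ?thesis unfolding F_def Let_def pq_def[symmetric] by simp
  qed
  have add: "c w p q + c w p' q' = c w (p + p') (q + q')" for w p q p' q'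
    by (simp add: c_def algebra_simps)
  have sq: "w * w = of_real (2 * Re w) * w - 1" if "norm w = 1" for w :: complex
  proof -
    have "of_real (2 * Re w) = w + cnj w" by (simp add: complex_eq_iff)
    then show ?thesis using unit_cnj[OF that] by (simp add: algebra_simps)
  qed
  have mult: "c w p q * c w p' q' = c w (p * p' - q * q') (p * q' + q * p' + [:0, 1:] * q * q')"
    if "norm w = 1" for w p q p' q'
  proof -
    have "(a + b * w) * (a' + b' * w) = (a * a' - b * b') + (a * b' + b * a' + of_real (2 * Re w) * b * b') * w" for a b a' b' :: complex
    proof -
      have "(a + b * w) * (a' + b' * w) = a * a' + (a * b' + b * a') * w + b * b' * (w * w)" by (simp add: algebra_simps)
      then show ?thesis unfolding sq[OF that] by (simp add: algebra_simps)
    qed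
    from this[of "of_real (ev p (2 * Re w))" "of_real (ev q (2 * Re w))" "of_real (ev p' (2 * Re w))" "of_real (ev q' (2 * Re w))"]
    show ?thesis unfolding c_def by simp
  qed
  have cj: "cnj (c w p q) = c w (p + [:0, 1:] * q) (- q)" if "norm w = 1" for w p q
  proof -
    have e: "of_real (2 * Re w) = w + cnj w" by (simp add: complex_eq_iff)
    have "a + b * cnj w = (a + of_real (2 * Re w) * b) + (- b) * w" for a b unfolding e by (simp add: algebra_simps)
    from this[of "of_real (ev p (2 * Re w))" "of_real (ev q (2 * Re w))"] show ?thesis unfolding c_def by simp
  qed
  have one: "c w 1 0 = 1" and gen: "c w 0 1 = w" for w by (simp_all add: c_def)
  have um: "- c w p q = c w (- p) (- q)" for w p q by (simp add: c_def)
  have "embedding (zring \<omega>) F \<omega>"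
  proof
    show "1 \<in> zring \<omega>" using Lc[of 1 0] by (simp add: one)
    show "\<omega> \<in> zring \<omega>" using Lc[of 0 1] by (simp add: gen)
    show "F 1 = 1" using Fc[of 1 0] by (simp add: one)
    fix x assume x: "x \<in> zring \<omega>"
    then obtain p q where p: "x = c \<omega> p q" using L by blast
    show "- x \<in> zring \<omega>" unfolding p um by (rule Lc)
    show "cnj x \<in> zring \<omega>" unfolding p cj[OF n(1)] by (rule Lc)
    show "F (cnj x) = cnj (F x)" unfolding p cj[OF n(1)] Fc cj[OF n(2)] ..
    show "x = 0" if "F x = 0" using that unfolding p Fc zero' .
    fix y assume y: "y \<in> zring \<omega>"
    then obtain p' q' where p': "y = c \<omega> p' q'" using L by blast
    show "x + y \<in> zring \<omega>" unfolding p p' add by (rule Lc)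
    show "x * y \<in> zring \<omega>" unfolding p p' mult[OF n(1)] by (rule Lc)
    show "F (x + y) = F x + F y" unfolding p p' add Fc ..
    show "F (x * y) = F x * F y" unfolding p p' mult[OF n(1)] Fc mult[OF n(2)] ..
  qed (rule n(1))
  moreover have "F \<omega> = \<omega>'" using Fc[of 0 1] by (simp add: gen)
  ultimately show ?thesis by blast
qed

section \<open>Quadratic irrationalities\<close>

lemma sqrt_nat_irrational:
  fixes x :: real
  assumes "x\<^sup>2 = of_nat n" "\<And>k::nat. k\<^sup>2 \<noteq> n"
  shows "x \<notin> \<rat>"
proof
  assume "x \<in> \<rat>"
  then obtain m k :: nat where mk: "k \<noteq> 0" "\<bar>x\<bar> = real m / real k" "coprime m k"
    by (rule Rats_abs_nat_div_natE)
  have 1: "\<bar>x\<bar> * real k = real m" unfolding mk(2) using mk(1) by simp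
  have "(real m)\<^sup>2 = \<bar>x\<bar>\<^sup>2 * (real k)\<^sup>2" unfolding 1[symmetric] by (rule power_mult_distrib)
  also have "\<dots> = real n * (real k)\<^sup>2" unfolding power2_abs assms(1) ..
  finally have "real (m\<^sup>2) = real (n * k\<^sup>2)" unfolding of_nat_power of_nat_mult .
  then have e: "m\<^sup>2 = n * k\<^sup>2" unfolding of_nat_eq_iff .
  have "k dvd m\<^sup>2" unfolding e power2_eq_square[of k] by (rule dvd_mult[OF dvd_triv_left])
  have "coprime k m" using mk(3) by (rule coprime_commute[THEN iffD1])
  then have "coprime k (m\<^sup>2)" by (rule coprime_power_right_iff[THEN iffD2, OF disjI1])
  then have "is_unit k" using \<open>k dvd m\<^sup>2\<close> by (rule coprime_common_divisor[OF _ dvd_refl])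
  then have "k = 1" by simp
  then have "m\<^sup>2 = n" unfolding e by simp
  then show False using assms(2) by blast
qed

lemma square_neq_2_3_6:
  fixes k :: nat
  shows "k\<^sup>2 \<noteq> 2" "k\<^sup>2 \<noteq> 3" "k\<^sup>2 \<noteq> 6"
proof -
  consider "k \<le> 1" | "k = 2" | "3 \<le> k" by fastforce
  then have "k * k \<le> 1 \<or> k * k = 4 \<or> 9 \<le> k * k"
    using mult_le_mono[of k 1 k 1] mult_le_mono[of 3 k 3 k] by cases simp_all
  then show "k\<^sup>2 \<noteq> 2" "k\<^sup>2 \<noteq> 3" "k\<^sup>2 \<noteq> 6" unfolding power2_eq_square by auto
qed

lemma sqrt2_irrational:
  assumes "x\<^sup>2 = 2" shows "(x::real) \<notin> \<rat>"
proof -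
  have "x\<^sup>2 = of_nat 2" using assms by simp
  then show ?thesis using square_neq_2_3_6(1) by (rule sqrt_nat_irrational)
qed

lemma sqrt3_irrational:
  assumes "x\<^sup>2 = 3" shows "(x::real) \<notin> \<rat>"
proof -
  have "x\<^sup>2 = of_nat 3" using assms by simp
  then show ?thesis using square_neq_2_3_6(2) by (rule sqrt_nat_irrational)
qed

lemma sqrt6_irrational:
  assumes "x\<^sup>2 = 6" shows "(x::real) \<notin> \<rat>"
proof -
  have "x\<^sup>2 = of_nat 6" using assms by simp
  then show ?thesis using square_neq_2_3_6(3) by (rule sqrt_nat_irrational)
qed

text \<open>The numbers \<open>1, r, s, r * s\<close> are independent over the rationals. Otherwise
  \<open>c + d * r\<close> is inverted with its norm \<open>k\<close>, and \<open>s\<close> lies in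
  the field generated by \<open>r\<close>.\<close>

lemma quadratic_field_independent:
  fixes r s a b c d :: real
  assumes r: "r \<notin> \<rat>" "r\<^sup>2 \<in> \<rat>" and s: "\<And>e f. e \<in> \<rat> \<Longrightarrow> f \<in> \<rat> \<Longrightarrow> s \<noteq> e + f * r"
    and q: "a \<in> \<rat>" "b \<in> \<rat>" "c \<in> \<rat>" "d \<in> \<rat>" and e: "(a + b * r) + (c + d * r) * s = 0"
  shows "a = 0 \<and> b = 0 \<and> c = 0 \<and> d = 0"
proof -
  have cd: "c = 0 \<and> d = 0"
  proof (rule ccontr)
    assume nz: "\<not> (c = 0 \<and> d = 0)"
    have n1: "c + d * r \<noteq> 0" using rational_linear[OF r(1) q(3,4)] nz by blast
    have md: "- d \<in> \<rat>" using q(4) by simp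
    have n2: "c - d * r \<noteq> 0"
    proof
      assume "c - d * r = 0"
      then have "c + (- d) * r = 0" by simp
      from rational_linear[OF r(1) q(3) md this] nz show False by simp
    qed
    define k where "k = c\<^sup>2 - d\<^sup>2 * r\<^sup>2"
    have k: "k = (c + d * r) * (c - d * r)" by (simp add: k_def algebra_simps power2_eq_square)
    have k0: "k \<noteq> 0" using n1 n2 k by simp
    have kq: "k \<in> \<rat>" unfolding k_def by (intro Rats_diff Rats_mult Rats_power q r)
    have "(c + d * r) * s = - (a + b * r)" using e by (simp only: eq_neg_iff_add_eq_0 add.commute)
    moreover have "s * k = ((c + d * r) * s) * (c - d * r)" unfolding k by (simp add: mult_ac)
    ultimately have "s * k = - (a + b * r) * (c - d * r)" by simp
    also have "\<dots> = (b * d * r\<^sup>2 - a * c) + (a * d - b * c) * r" by (simp add: algebra_simps power2_eq_square)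
    finally have "s = ((b * d * r\<^sup>2 - a * c) + (a * d - b * c) * r) / k"
      by (simp only: nonzero_eq_divide_eq[OF k0])
    also have "\<dots> = (b * d * r\<^sup>2 - a * c) / k + (a * d - b * c) / k * r" by (simp only: add_divide_distrib times_divide_eq_left)
    finally have e1: "s = (b * d * r\<^sup>2 - a * c) / k + (a * d - b * c) / k * r" .
    have "(b * d * r\<^sup>2 - a * c) / k \<in> \<rat>" "(a * d - b * c) / k \<in> \<rat>"
      by (intro Rats_divide Rats_diff Rats_mult q r kq)+
    from s[OF this] show False using e1 by blast
  qed
  then have "a + b * r = 0" using e by simp
  then show ?thesis using rational_linear[OF r(1) q(1,2)] cd by blast
qed

text \<open>The case \<open>\<alpha> = pi / 4\<close> with leg \<open>X\<close> and hypotenuse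
  \<open>r * X\<close>. Comparing coefficients in the area, either \<open>p = 0\<close> and 2 would
  be a rational square, or \<open>X = p * s\<close>. Then the hypotenuse is
  \<open>p * r * s\<close>, and a sum of tile edges has no \<open>r * s\<close> component.\<close>

lemma no_right_isosceles:
  fixes s X r :: real and p q p' q' :: nat and t t' :: int
  assumes r: "r\<^sup>2 = 2" "r > 0" and s: "s\<^sup>2 = 2 - r" and \<rho>: "\<rho> \<in> \<rat>" and X: "X > 0"
    and 1: "X = of_nat p * s + of_nat q * r + of_int t" and 2: "r * X = of_nat p' * s + of_nat q' * r + of_int t'"
    and area: "X\<^sup>2 = \<rho> * (2 - r)"
  shows False
proof -
  have irr: "r \<notin> \<rat>" using sqrt2_irrational[OF r(1)] .
  have r2: "r\<^sup>2 \<in> \<rat>" using r by simp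
  have s': "s \<noteq> e + f * r" if "e \<in> \<rat>" "f \<in> \<rat>" for e f
  proof
    assume "s = e + f * r"
    then have "s\<^sup>2 = e\<^sup>2 + f\<^sup>2 * r\<^sup>2 + 2 * e * f * r" by (simp add: power2_eq_square algebra_simps)
    then have "(e\<^sup>2 + 2 * f\<^sup>2 - 2) + (2 * e * f + 1) * r = 0" using s r by (simp add: algebra_simps)
    then have "e\<^sup>2 + 2 * f\<^sup>2 - 2 = 0 \<and> 2 * e * f + 1 = 0" by (intro rational_linear[OF irr]) (use that in auto)
    then have a: "e\<^sup>2 + 2 * f\<^sup>2 = 2" and b: "2 * e * f = -1" by auto
    \<comment> \<open>Eliminating \<open>e\<close> from the two equations gives a quadratic equation
      for \<open>f\<^sup>2\<close> without rational root.\<close>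
    have "(4 * f\<^sup>2 - 2)\<^sup>2 - 2 = 8 * f\<^sup>2 * (e\<^sup>2 + 2 * f\<^sup>2 - 2) - 2 * ((2 * e * f)\<^sup>2 - 1)"
      by (simp add: algebra_simps power2_eq_square)
    then have "(4 * f\<^sup>2 - 2)\<^sup>2 = 2" unfolding a b by simp
    then have "4 * f\<^sup>2 - 2 \<notin> \<rat>" by (rule sqrt2_irrational)
    then show False using that by simp
  qed
  note ind = quadratic_field_independent[OF irr r2 s']
  let ?p = "real p" and ?q = "real q" and ?t = "real_of_int t"
  have "X\<^sup>2 = (2 * ?p\<^sup>2 + 2 * ?q\<^sup>2 + ?t\<^sup>2 + (2 * ?q * ?t - ?p\<^sup>2) * r) + (2 * ?p * ?t + 2 * ?p * ?q * r) * s"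
  proof -
    have "X\<^sup>2 = ?p\<^sup>2 * s\<^sup>2 + ?q\<^sup>2 * r\<^sup>2 + ?t\<^sup>2 + 2 * ?q * ?t * r + (2 * ?p * ?t + 2 * ?p * ?q * r) * s"
      unfolding 1 by (simp add: algebra_simps power2_eq_square)
    then show ?thesis unfolding r(1) s by (simp add: algebra_simps)
  qed
  then have "(2 * ?p\<^sup>2 + 2 * ?q\<^sup>2 + ?t\<^sup>2 - 2 * \<rho> + (2 * ?q * ?t - ?p\<^sup>2 + \<rho>) * r) + (2 * ?p * ?t + 2 * ?p * ?q * r) * s = 0"
    unfolding area by (simp add: algebra_simps)
  then have "2 * ?p\<^sup>2 + 2 * ?q\<^sup>2 + ?t\<^sup>2 - 2 * \<rho> = 0 \<and> 2 * ?q * ?t - ?p\<^sup>2 + \<rho> = 0 \<and> 2 * ?p * ?t = 0 \<and> 2 * ?p * ?q = 0"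
    by (intro ind) (use \<rho> in auto)
  then have e: "2 * ?p\<^sup>2 + 2 * ?q\<^sup>2 + ?t\<^sup>2 = 2 * \<rho>" "2 * ?q * ?t + \<rho> = ?p\<^sup>2" "?p * ?t = 0" "?p * ?q = 0" by auto
  show False
  proof (cases "p = 0")
    case True
    then have "(?t + 2 * ?q)\<^sup>2 = 2 * ?q\<^sup>2" using e(1,2) by (simp add: power2_eq_square algebra_simps)
    have "q = 0"
    proof (rule ccontr)
      assume "q \<noteq> 0"
      then have "((?t + 2 * ?q) / ?q)\<^sup>2 = 2" using \<open>(?t + 2 * ?q)\<^sup>2 = 2 * ?q\<^sup>2\<close> by (simp add: power_divide)
      then have "(?t + 2 * ?q) / ?q \<notin> \<rat>" by (rule sqrt2_irrational)
      then show False by simp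
    qed
    then have "?t = 0" using \<open>(?t + 2 * ?q)\<^sup>2 = 2 * ?q\<^sup>2\<close> by simp
    then show False using 1 X True \<open>q = 0\<close> by simp
  next
    case False
    then have "X = ?p * s" using e 1 by simp
    then have "(- of_int t' + (- real q') * r) + (- real p' + ?p * r) * s = 0" using 2 by (simp add: algebra_simps)
    then have "- of_int t' = (0::real) \<and> - real q' = 0 \<and> - real p' = 0 \<and> ?p = 0" by (intro ind) auto
    then show False using False by simp
  qed
qed

text \<open>The case \<open>\<alpha> = pi / 6\<close>. The area alone suffices: \<open>p = 0\<close>
  would make 6 a rational square unless \<open>X = 0\<close>, and \<open>p > 0\<close> forces
  \<open>2 * p\<^sup>2 = 3 * p\<^sup>2\<close>.\<close>

lemma no_thirty_degrees:
  fixes s X r :: real and p q :: nat and t :: int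
  assumes r: "r\<^sup>2 = 3" "r > 0" and s: "s\<^sup>2 = 2 - r" and \<rho>: "\<rho> \<in> \<rat>" and X: "X > 0"
    and 1: "X = of_nat p * s + of_nat q * r + of_int t" and area: "X\<^sup>2 = \<rho> * (3 - r)"
  shows False
proof -
  have irr: "r \<notin> \<rat>" using sqrt3_irrational[OF r(1)] .
  have r2: "r\<^sup>2 \<in> \<rat>" using r by simp
  have s': "s \<noteq> e + f * r" if "e \<in> \<rat>" "f \<in> \<rat>" for e f
  proof
    assume "s = e + f * r"
    then have "s\<^sup>2 = e\<^sup>2 + f\<^sup>2 * r\<^sup>2 + 2 * e * f * r" by (simp add: power2_eq_square algebra_simps)
    then have "(e\<^sup>2 + 3 * f\<^sup>2 - 2) + (2 * e * f + 1) * r = 0" using s r by (simp add: algebra_simps)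
    then have "e\<^sup>2 + 3 * f\<^sup>2 - 2 = 0 \<and> 2 * e * f + 1 = 0" by (intro rational_linear[OF irr]) (use that in auto)
    then have a: "e\<^sup>2 + 3 * f\<^sup>2 = 2" and b: "2 * e * f = -1" by auto
    \<comment> \<open>Eliminating \<open>e\<close> leaves \<open>f\<^sup>2 = 1 / 2\<close> or
      \<open>f\<^sup>2 = 1 / 6\<close>.\<close>
    have "((2 * f)\<^sup>2 - 2) * ((6 * f)\<^sup>2 - 6) = 48 * f\<^sup>2 * (e\<^sup>2 + 3 * f\<^sup>2 - 2) - 12 * ((2 * e * f)\<^sup>2 - 1)"
      by (simp add: algebra_simps power2_eq_square)
    then have "((2 * f)\<^sup>2 - 2) * ((6 * f)\<^sup>2 - 6) = 0" unfolding a b by simp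
    then have "(2 * f)\<^sup>2 = 2 \<or> (6 * f)\<^sup>2 = 6" by auto
    then have "2 * f \<notin> \<rat> \<or> 6 * f \<notin> \<rat>" using sqrt2_irrational sqrt6_irrational by blast
    then show False using that by simp
  qed
  note ind = quadratic_field_independent[OF irr r2 s']
  let ?p = "real p" and ?q = "real q" and ?t = "real_of_int t"
  have "X\<^sup>2 = (2 * ?p\<^sup>2 + 3 * ?q\<^sup>2 + ?t\<^sup>2 + (2 * ?q * ?t - ?p\<^sup>2) * r) + (2 * ?p * ?t + 2 * ?p * ?q * r) * s"
  proof -
    have "X\<^sup>2 = ?p\<^sup>2 * s\<^sup>2 + ?q\<^sup>2 * r\<^sup>2 + ?t\<^sup>2 + 2 * ?q * ?t * r + (2 * ?p * ?t + 2 * ?p * ?q * r) * s"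
      unfolding 1 by (simp add: algebra_simps power2_eq_square)
    then show ?thesis unfolding r(1) s by (simp add: algebra_simps)
  qed
  then have "(2 * ?p\<^sup>2 + 3 * ?q\<^sup>2 + ?t\<^sup>2 - 3 * \<rho> + (2 * ?q * ?t - ?p\<^sup>2 + \<rho>) * r) + (2 * ?p * ?t + 2 * ?p * ?q * r) * s = 0"
    unfolding area by (simp add: algebra_simps)
  then have "2 * ?p\<^sup>2 + 3 * ?q\<^sup>2 + ?t\<^sup>2 - 3 * \<rho> = 0 \<and> 2 * ?q * ?t - ?p\<^sup>2 + \<rho> = 0 \<and> 2 * ?p * ?t = 0 \<and> 2 * ?p * ?q = 0"
    by (intro ind) (use \<rho> in auto)
  then have e: "2 * ?p\<^sup>2 + 3 * ?q\<^sup>2 + ?t\<^sup>2 = 3 * \<rho>" "2 * ?q * ?t + \<rho> = ?p\<^sup>2" "?p * ?t = 0" "?p * ?q = 0" by auto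
  show False
  proof (cases "p = 0")
    case True
    then have h: "(?t + 3 * ?q)\<^sup>2 = 6 * ?q\<^sup>2" using e(1,2) by (simp add: power2_eq_square algebra_simps)
    have "q = 0"
    proof (rule ccontr)
      assume "q \<noteq> 0"
      then have "((?t + 3 * ?q) / ?q)\<^sup>2 = 6" using h by (simp add: power_divide)
      then have "(?t + 3 * ?q) / ?q \<notin> \<rat>" by (rule sqrt6_irrational)
      then show False by simp
    qed
    then have "?t = 0" using h by simp
    then show False using 1 X True \<open>q = 0\<close> by simp
  next
    case False
    then have "?t = 0" "?q = 0" using e by auto
    then have "2 * ?p\<^sup>2 = 3 * ?p\<^sup>2" using e(1,2) by simp
    then show False using False by simp
  qed
qed

section \<open>Angles commensurable with \<open>pi\<close>\<close>

text \<open>The angles of the tile belonging to a conjugate \<open>- 2 * Re w\<close> of \<open>s\<close> of modulus above 1.\<close>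

lemma conjugate_tile_angles:
  fixes \<epsilon> \<theta> :: real
  assumes \<epsilon>: "\<epsilon> = 1 \<or> \<epsilon> = -1" and \<theta>: "0 < \<theta>" "\<theta> < pi / 3" and w: "w = - of_real \<epsilon> * cis \<theta>"
  shows "- tb w * Im (w\<^sup>2) > 0" "ang_a w = 2 * \<theta>" "ang_b w = pi - 3 * \<theta>" "ang_c w = \<theta>"
proof -
  have cos: "cos \<theta> > 1 / 2"
    using cos_monotone_0_pi[of \<theta> "pi / 3"] \<theta> by (simp add: cos_60)
  have ts: "ts w = 2 * \<epsilon> * cos \<theta>" by (simp add: ts_def w)
  have e2: "\<epsilon>\<^sup>2 = 1" using \<epsilon> by auto
  have tb: "tb w = 1 - (2 * cos \<theta>)\<^sup>2" unfolding tb_def ts using e2 by (simp add: power_mult_distrib)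
  have "1\<^sup>2 < (2 * cos \<theta>)\<^sup>2" using cos by (intro power_strict_mono) auto
  then have k: "- tb w > 0" unfolding tb by simp
  have w2: "w\<^sup>2 = cis (2 * \<theta>)"
  proof -
    have "w\<^sup>2 = of_real (\<epsilon>\<^sup>2) * cis \<theta> ^ 2" unfolding w by (simp add: power_mult_distrib)
    then show ?thesis unfolding e2 Complex.DeMoivre by simp
  qed
  have "sin (2 * \<theta>) > 0" using \<theta> by (intro sin_gt_zero) auto
  then show "- tb w * Im (w\<^sup>2) > 0" unfolding w2 using mult_pos_pos[OF k] by simp
  have scaled: "Arg (of_real c * cis x) = x" if "0 < c" "- pi < x" "x \<le> pi" for c x
    using that by (intro cis_Arg_unique) (simp_all add: sgn_mult sgn_of_real sgn_cis)
  have e1: "- of_real (tb w) * w\<^sup>2 = of_real (- tb w) * cis (2 * \<theta>)" unfolding w2 by simp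
  have "Arg (of_real (- tb w) * cis (2 * \<theta>)) = 2 * \<theta>" by (rule scaled[OF k]) (use \<theta> in auto)
  then show "ang_a w = 2 * \<theta>" unfolding ang_a_def e1 using \<theta> by simp
  have e4: "\<epsilon> * \<epsilon> ^ 3 = 1" "\<epsilon> * \<epsilon> = 1" using \<epsilon> by auto
  have "of_real (ts w) * cnj (w ^ 3) = of_real (2 * cos \<theta>) * cis (pi - 3 * \<theta>)"
  proof -
    have "w ^ 3 = - (of_real (\<epsilon> ^ 3) * cis \<theta> ^ 3)" unfolding w by (simp add: power_mult_distrib)
    then have "cnj (w ^ 3) = - (of_real (\<epsilon> ^ 3) * cis (- (3 * \<theta>)))" unfolding Complex.DeMoivre by (simp add: cis_cnj)
    then have "of_real (ts w) * cnj (w ^ 3) = - (of_real (\<epsilon> * \<epsilon> ^ 3) * (of_real (2 * cos \<theta>) * cis (- (3 * \<theta>))))"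
      unfolding ts by simp
    also have "\<dots> = of_real (2 * cos \<theta>) * (cis pi * cis (- (3 * \<theta>)))" unfolding e4 by simp
    also have "cis pi * cis (- (3 * \<theta>)) = cis (pi - 3 * \<theta>)" unfolding cis_mult by simp
    finally show ?thesis .
  qed
  then show "ang_b w = pi - 3 * \<theta>" unfolding ang_b_def using scaled[of "2 * cos \<theta>" "pi - 3 * \<theta>"] \<theta> cos by simp
  have "of_real (ts w * tb w) * w = of_real (2 * cos \<theta> * (- tb w)) * cis \<theta>"
  proof -
    have "of_real (ts w * t) * w = of_real (\<epsilon> * \<epsilon> * (2 * cos \<theta> * (- t))) * cis \<theta>" for t
      unfolding ts by (simp add: w)
    from this[of "tb w"] show ?thesis unfolding e4 by simp
  qed
  moreover have "Arg (of_real (2 * cos \<theta> * (- tb w)) * cis \<theta>) = \<theta>"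
    by (rule scaled) (use mult_pos_pos[OF _ k, of "2 * cos \<theta>"] \<theta> cos in auto)
  ultimately show "ang_c w = \<theta>" unfolding ang_c_def using \<theta> by simp
qed

context angle_tiling begin

context
  assumes A0: "A = 0" and B1: "sgn B = 1"
begin

context
  fixes L :: "complex set" and F0
  assumes E0: "embedding L F0 \<omega>"
begin

text \<open>This is what the normalisation \<open>A = 0\<close>, \<open>sgn B = 1\<close> is for:
  side lengths are integer combinations of \<open>s\<close>, \<open>1 - s\<^sup>2\<close> and 1, and
  the corners turn directions by products of powers of \<omega> up to sign.\<close>

lemma vertices_in_L: "A \<in> L" "B \<in> L" "C \<in> L" "sgn (B - A) \<in> L" "sgn (C - B) \<in> L" "sgn (A - C) \<in> L"
proof -
  interpret E: embedding L F0 \<omega> by (rule E0)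
  interpret B: angle_tiling \<delta> I u v w B C A by (rule cyc)
  interpret C: angle_tiling \<delta> I u v w C A B by (rule B.cyc)
  have natL: "of_nat n \<in> L" for n by (induction n) (auto intro: E.L_zero E.L_one E.L_add)
  have sL: "of_real s \<in> L" "of_real (1 - s\<^sup>2) \<in> L" using E.L_ts E.L_tb unfolding ts_\<omega> tb_\<omega> by auto
  have sideL: "of_real Y \<in> L" if Y: "is_side Y" for Y
  proof -
    obtain P Q R where "Y = of_nat P * s + of_nat Q * (1 - s\<^sup>2) + of_nat R" using Y by (auto simp: is_side_def)
    then have Y': "of_real Y = of_nat P * of_real s + of_nat Q * of_real (1 - s\<^sup>2) + of_nat R"
      by (simp only: of_real_add of_real_mult of_real_of_nat_eq)
    show ?thesis unfolding Y' by (intro E.L_add E.L_mult natL sL)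
  qed
  have dirL: "(- (\<omega>\<^sup>2)) ^ p * (cnj (\<omega> ^ 3)) ^ q * \<omega> ^ r \<in> L" for p q r
    by (intro E.L_mult E.L_power E.L_uminus E.L_cnj E.L_\<omega>)
  show "A \<in> L" unfolding A0 by (rule E.L_zero)
  have dB: "sgn (B - A) = 1" using A0 B1 by simp
  then show s1: "sgn (B - A) \<in> L" using E.L_one by simp
  have "B = of_real (norm (B - A))" using norm_sgn_mult[of "B - A"] dB A0 by simp
  then show "B \<in> L" using sideL[OF side_A] by simp
  have sC: "sgn (C - A) \<in> L" unfolding dir_A by (rule E.L_mult[OF s1 dirL])
  then show "sgn (A - C) \<in> L" using E.L_uminus[OF sC] sgn_minus[of "C - A"] by simp
  have "C = of_real (norm (A - C)) * sgn (C - A)" using norm_sgn_mult[of "C - A"] A0 by (simp add: norm_minus_commute)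
  then show "C \<in> L" using E.L_mult[OF sideL[OF C.side_A] sC] by simp
  let ?z = "(- (\<omega>\<^sup>2)) ^ B.na B * (cnj (\<omega> ^ 3)) ^ B.nb B * \<omega> ^ B.nc B"
  have nz: "norm ?z = 1" by (simp add: norm_mult norm_power norm_\<omega>)
  have "sgn (A - B) * cnj ?z = sgn (C - B) * (?z * cnj ?z)" unfolding B.dir_A by (simp only: mult_ac)
  then have "sgn (C - B) = sgn (A - B) * cnj ?z" unfolding unit_cnj[OF nz] by simp
  moreover have "sgn (A - B) \<in> L" using E.L_uminus[OF s1] sgn_minus[of "B - A"] by simp
  ultimately show "sgn (C - B) \<in> L" using E.L_mult E.L_cnj dirL by metis
qed

lemma image_tiling:
  assumes F: "embedding L F \<omega>" and k: "- tb (F \<omega>) * Im ((F \<omega>)\<^sup>2) > 0"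
  defines "G \<equiv> embedding.good L I u v w"
  shows "weak_tiling G (\<lambda>i. F (u i)) (\<lambda>i. F (v i)) (\<lambda>i. F (w i)) (F A) (F B) (F C)"
    "\<And>i. i \<in> G \<Longrightarrow> tile_shape (F \<omega>) (F (u i)) (F (v i)) (F (w i))"
    "\<And>i. i \<in> G \<Longrightarrow> u i \<in> L \<and> v i \<in> L \<and> w i \<in> L"
proof -
  interpret E: embedding L F \<omega> by (rule F)
  show "weak_tiling G (\<lambda>i. F (u i)) (\<lambda>i. F (v i)) (\<lambda>i. F (w i)) (F A) (F B) (F C)"
    unfolding G_def
    by (rule E.weak_tiling_image(1)[OF T shape ts_pos tb_pos' vertices_in_L orient_sign k])
  show "\<And>i. i \<in> G \<Longrightarrow> tile_shape (F \<omega>) (F (u i)) (F (v i)) (F (w i))"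
    unfolding G_def
    by (rule E.weak_tiling_image(2)[OF T shape ts_pos tb_pos' vertices_in_L orient_sign k])
  show "\<And>i. i \<in> G \<Longrightarrow> u i \<in> L \<and> v i \<in> L \<and> w i \<in> L"
    unfolding G_def by (subst (asm) E.good_def[OF T _ ts_pos tb_pos' vertices_in_L]) (use shape in auto)
qed

text \<open>Only tiles visible in \<open>L\<close> are counted. The counts do not depend on the
  embedding, so one triple of totals satisfies the angle equations of all conjugates.\<close>

definition "ga X = card {i \<in> embedding.good L I u v w. u i = X}"
definition "gb X = card {i \<in> embedding.good L I u v w. v i = X}"
definition "gc X = card {i \<in> embedding.good L I u v w. w i = X}"

lemma image_corners:
  assumes F: "embedding L F \<omega>" and k: "- tb (F \<omega>) * Im ((F \<omega>)\<^sup>2) > 0"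
  shows "corner (F A) (F B) (F C) = real (ga A) * ang_a (F \<omega>) + real (gb A) * ang_b (F \<omega>) + real (gc A) * ang_c (F \<omega>)"
    "corner (F B) (F C) (F A) = real (ga B) * ang_a (F \<omega>) + real (gb B) * ang_b (F \<omega>) + real (gc B) * ang_c (F \<omega>)"
    "corner (F C) (F A) (F B) = real (ga C) * ang_a (F \<omega>) + real (gb C) * ang_b (F \<omega>) + real (gc C) * ang_c (F \<omega>)"
    "corner (F A) (F B) (F C) + corner (F B) (F C) (F A) + corner (F C) (F A) (F B) = pi"
proof -
  interpret E: embedding L F \<omega> by (rule F)
  let ?G = "embedding.good L I u v w"
  note W = image_tiling(1)[OF F k] and S = image_tiling(2)[OF F k] and inL = image_tiling(3)[OF F k]
  note W2 = weak_tiling_cyc[OF W]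
  note W3 = weak_tiling_cyc[OF W2]
  have nF: "norm (F \<omega>) = 1" by (rule E.F_unit[OF E.L_\<omega> E.norm_\<omega>])
  have k': "tb (F \<omega>) * Im ((F \<omega>)\<^sup>2) \<noteq> 0" using k by auto
  have eq: "{i \<in> ?G. F (u i) = F X} = {i \<in> ?G. u i = X}" "{i \<in> ?G. F (v i) = F X} = {i \<in> ?G. v i = X}"
    "{i \<in> ?G. F (w i) = F X} = {i \<in> ?G. w i = X}" if "X \<in> L" for X
    using inL E.F_eq[OF _ that] by blast+
  show "corner (F A) (F B) (F C) = real (ga A) * ang_a (F \<omega>) + real (gb A) * ang_b (F \<omega>) + real (gc A) * ang_c (F \<omega>)"
    using corner_count[OF W S nF k'] unfolding eq[OF vertices_in_L(1)] ga_def gb_def gc_def .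
  show "corner (F B) (F C) (F A) = real (ga B) * ang_a (F \<omega>) + real (gb B) * ang_b (F \<omega>) + real (gc B) * ang_c (F \<omega>)"
    using corner_count[OF W2 S nF k'] unfolding eq[OF vertices_in_L(2)] ga_def gb_def gc_def .
  show "corner (F C) (F A) (F B) = real (ga C) * ang_a (F \<omega>) + real (gb C) * ang_b (F \<omega>) + real (gc C) * ang_c (F \<omega>)"
    using corner_count[OF W3 S nF k'] unfolding eq[OF vertices_in_L(3)] ga_def gb_def gc_def .
  show "corner (F A) (F B) (F C) + corner (F B) (F C) (F A) + corner (F C) (F A) (F B) = pi"
    by (rule corner_sum[OF weak_orient_pos[OF W]])
qed

text \<open>With the identity, \<open>image_corners\<close> yields the angle equation of the
  original tile for the same restricted counts.\<close>

lemma embedding_id: "embedding L (\<lambda>x. x) \<omega>"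
proof -
  interpret E: embedding L F0 \<omega> by (rule E0)
  show ?thesis
    by unfold_locales (auto intro: E.L_one E.L_add E.L_uminus E.L_mult E.L_cnj E.L_\<omega> E.norm_\<omega>)
qed

end

text \<open>For \<open>\<bar>z\<bar> > 1\<close> the number \<open>tb\<close> is negative, so the
  unit number \<open>w\<close> over \<open>z\<close> must have a square in the upper half plane:
  \<open>w = sgn z * cis \<theta>\<close>.\<close>

lemma conj_equation:
  fixes z :: real
  assumes z: "1 < \<bar>z\<bar>" "\<bar>z\<bar> < 2" and ev: "\<And>p. ev p z = 0 \<longleftrightarrow> ev p (2 * Re \<omega>) = 0"
  defines "L \<equiv> zring \<omega>" and "\<theta> \<equiv> arccos (\<bar>z\<bar> / 2)"
  shows "0 < \<theta>" "\<theta> < pi / 3" "cos \<theta> = \<bar>z\<bar> / 2"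
    "real (ga L A + ga L B + ga L C) * (2 * \<theta>) + real (gb L A + gb L B + gb L C) * (pi - 3 * \<theta>)
      + real (gc L A + gc L B + gc L C) * \<theta> = pi"
    "\<exists>F. embedding L F \<omega>"
proof -
  show c: "cos \<theta> = \<bar>z\<bar> / 2" unfolding \<theta>_def using z by (intro cos_arccos) auto
  have pi3: "arccos (1 / 2) = pi / 3" using arccos_cos[of "pi / 3"] by (simp add: cos_60)
  show \<theta>: "0 < \<theta>" "\<theta> < pi / 3"
    unfolding \<theta>_def using z arccos_less_arccos[of "\<bar>z\<bar> / 2" 1] arccos_less_arccos[of "1 / 2" "\<bar>z\<bar> / 2"] pi3 by auto
  define \<epsilon> where "\<epsilon> = - sgn z"
  have \<epsilon>: "\<epsilon> = 1 \<or> \<epsilon> = -1" using z by (auto simp: \<epsilon>_def sgn_if)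
  define w where "w = - of_real \<epsilon> * cis \<theta>"
  have "sin \<theta> > 0" using \<theta> by (intro sin_gt_zero) auto
  then have Im: "Im w \<noteq> 0" using \<epsilon> by (auto simp: w_def)
  have Re: "2 * Re w = z" using c z by (auto simp: w_def \<epsilon>_def sgn_if abs_if split: if_splits)
  have Im\<omega>: "Im \<omega> \<noteq> 0" using c_pos by (simp add: \<omega>_def sin_add c_def)
  have nw: "norm w = 1" using \<epsilon> by (auto simp: w_def norm_mult)
  have "\<exists>F. embedding (zring \<omega>) F \<omega> \<and> F \<omega> = w"
    by (rule zring_embedding[OF norm_\<omega> nw Im\<omega> Im]) (simp only: Re ev)
  then obtain F where F: "embedding L F \<omega>" "F \<omega> = w" unfolding L_def by blast
  then show "\<exists>F. embedding L F \<omega>" by blast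
  note a = conjugate_tile_angles[OF \<epsilon> \<theta> w_def]
  have k: "- tb (F \<omega>) * Im ((F \<omega>)\<^sup>2) > 0" unfolding F(2) by (rule a(1))
  note ic = image_corners[OF F(1) F(1) k]
  show "real (ga L A + ga L B + ga L C) * (2 * \<theta>) + real (gb L A + gb L B + gb L C) * (pi - 3 * \<theta>)
      + real (gc L A + gc L B + gc L C) * \<theta> = pi"
    using ic(4) unfolding ic(1-3) F(2) a(2-4) by (simp add: algebra_simps)
qed

end

end

lemma golden_counts_mset:
  fixes a c x1 x2 x3 :: real and p1 q1 r1 p2 q2 r2 p3 q3 r3 :: nat
  assumes x: "x1 = real p1 * a + real q1 * a + real r1 * c" "x2 = real p2 * a + real q2 * a + real r2 * c"
      "x3 = real p3 * a + real q3 * a + real r3 * c"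
    and pos: "p1 + q1 + r1 > 0" "p2 + q2 + r2 > 0" "p3 + q3 + r3 > 0"
    and sum: "p1 + p2 + p3 + (q1 + q2 + q3) = 2" "r1 + r2 + r3 = 1"
  shows "{#x1, x2, x3#} = {#a, a, c#}"
proof -
  have 1: "p1 + q1 + r1 = 1" "p2 + q2 + r2 = 1" "p3 + q3 + r3 = 1" using pos sum by linarith+
  have c: "p = 1 \<and> q = 0 \<and> r = 0 \<or> p = 0 \<and> q = 1 \<and> r = 0 \<or> p = 0 \<and> q = 0 \<and> r = 1"
    if "p + q + r = 1" for p q r :: nat using that by auto
  show ?thesis
    using c[OF 1(1)] c[OF 1(2)] c[OF 1(3)] sum unfolding x by (elim disjE conjE) (simp_all add: add_mset_commute)
qed

context angle_tiling begin

text \<open>\<open>X\<close>, \<open>Y\<close> are the legs and \<open>Z\<close> is the hypotenuse;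
  \<open>r / 2\<close> is the sine of the acute corners in the area formula.\<close>

lemma no_right_isosceles_tiling:
  assumes r: "s\<^sup>2 = 2 - r" "r\<^sup>2 = 2" "r > 0" and pos: "X > 0" "Y > 0" "Z > 0"
    and D: "X * Y = real n / 2 * (2 - r)" "X * Z * (r / 2) = X * Y" "Y * Z * (r / 2) = X * Y"
    and sides: "is_side X" "is_side Z"
  shows False
proof -
  have "Z * (r / 2) = Y" "Z * (r / 2) = X" using D(2,3) pos by (simp_all add: field_simps)
  then have XY: "X = Y" "Z * r = 2 * X" by simp_all
  have rr: "r * r = 2" using r(2) by (simp only: power2_eq_square)
  have "Z * (r * r) = (Z * r) * r" by (simp only: mult_ac)
  then have Z: "Z = r * X" unfolding XY(2) rr by simp
  have *: "\<exists>p q. \<exists>t::int. W = of_nat p * s + of_nat q * r + of_int t" if W: "is_side W" for W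
  proof -
    obtain P Q R where "W = of_nat P * s + of_nat Q * (1 - s\<^sup>2) + of_nat R" using W by (auto simp: is_side_def)
    then have "W = of_nat P * s + of_nat Q * r + of_int (int R - int Q)" unfolding r(1) by (simp add: algebra_simps)
    then show ?thesis by blast
  qed
  obtain p q and t :: int where 1: "X = of_nat p * s + of_nat q * r + of_int t" using *[OF sides(1)] by blast
  obtain p' q' and t' :: int where 2: "Z = of_nat p' * s + of_nat q' * r + of_int t'" using *[OF sides(2)] by blast
  have "X\<^sup>2 = real n / 2 * (2 - r)" using D(1) XY(1) by (simp add: power2_eq_square)
  moreover have "real n / 2 \<in> \<rat>" by simp
  ultimately show False using no_right_isosceles[OF r(2,3,1) _ pos(1) 1 2[unfolded Z]] by blast
qed

text \<open>\<open>f1\<close>, \<open>f2\<close>, \<open>f3\<close> are the sines of the corners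
  opposite \<open>X\<close>, \<open>Y\<close>, \<open>Z\<close>. Multiplying the area formulas
  eliminates \<open>Y\<close> and \<open>Z\<close>, and a product of sines in the rational multiples
  of \<open>r\<close> leaves \<open>X\<^sup>2\<close> a rational multiple of
  \<open>3 - r\<close>.\<close>

lemma no_thirty_degrees_tiling:
  assumes r: "s\<^sup>2 = 2 - r" "r\<^sup>2 = 3" "r > 0" and pos: "X > 0" "Y > 0" "Z > 0"
    and D: "Y * Z * f1 = real n / 2 * (r - 1)" "Z * X * f2 = real n / 2 * (r - 1)" "X * Y * f3 = real n / 2 * (r - 1)"
    and f: "f1\<^sup>2 \<in> \<rat>" "f1 * f2 * f3 = k * r" "k \<in> \<rat>" "k \<noteq> 0"
    and side: "is_side X"
  shows False
proof -
  obtain P Q R where "X = of_nat P * s + of_nat Q * (1 - s\<^sup>2) + of_nat R" using side by (auto simp: is_side_def)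
  then have 1: "X = of_nat P * s + of_nat Q * r + of_int (int R - int Q)" unfolding r(1) by (simp add: algebra_simps)
  define D' where "D' = real n / 2 * (r - 1)"
  have f1: "f1 \<noteq> 0" using f r by auto
  have YZ: "Y * Z \<noteq> 0" using pos by simp
  have "X\<^sup>2 * (Y * Z * f1) * (f1 * f2 * f3) = f1\<^sup>2 * ((Z * X * f2) * (X * Y * f3))" by (simp add: power2_eq_square)
  then have "X\<^sup>2 * D' * (k * r) = f1\<^sup>2 * (D' * D')" unfolding D f(2) D'_def .
  moreover have "D' \<noteq> 0" using YZ f1 D(1) unfolding D'_def by (metis mult_eq_0_iff)
  ultimately have "X\<^sup>2 * (k * r) = f1\<^sup>2 * D'" by (simp add: field_simps)
  then have "X\<^sup>2 * (k * r) * r = f1\<^sup>2 * D' * r" by simp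
  then have "X\<^sup>2 * k * (r * r) = f1\<^sup>2 * real n / 2 * (r * r - r)" unfolding D'_def by (simp add: algebra_simps)
  moreover have "r * r = 3" using r(2) by (simp add: power2_eq_square)
  ultimately have "X\<^sup>2 * k * 3 = f1\<^sup>2 * real n / 2 * (3 - r)" by metis
  then have "X\<^sup>2 = (f1\<^sup>2 * real n / 2 / (3 * k)) * (3 - r)" using f(4) by (simp add: field_simps)
  moreover have "f1\<^sup>2 * real n / 2 / (3 * k) \<in> \<rat>" using f(1,3) by simp
  ultimately show False using no_thirty_degrees[OF r(2,3,1) _ pos(1) 1] by blast
qed


context
  assumes A0: "A = 0" and B1: "sgn B = 1"
begin

theorem root_case:
  assumes n: "n > 0" "\<omega> ^ n = 1"
  shows similar_corners
proof -
  interpret B: angle_tiling \<delta> I u v w B C A by (rule cyc)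
  interpret C: angle_tiling \<delta> I u v w C A B by (rule B.cyc)
  define y where "y = 2 * Re \<omega>"
  have ys: "y = - s" by (simp add: y_def \<omega>_def s_def cos_add)
  have y1: "-1 < y" "y < 0" using s_pos s_less_1 by (simp_all add: ys)
  obtain Z :: "real set" where Z: "finite Z" "y \<in> Z" "\<And>z. z \<in> Z \<Longrightarrow> \<bar>z\<bar> < 2 \<and> z \<noteq> 0 \<and> \<bar>z\<bar> \<noteq> 1"
    "\<And>z p. z \<in> Z \<Longrightarrow> ev p z = 0 \<longleftrightarrow> ev p y = 0" "\<And>z. (\<And>p. ev p z = 0 \<longleftrightarrow> ev p y = 0) \<Longrightarrow> z \<in> Z"
    "(\<Prod>z\<in>Z. z) \<in> \<int>" "(\<Prod>z\<in>Z. 1 - z) \<in> \<int>" "(\<Prod>z\<in>Z. 1 + z) \<in> \<int>"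
    by (rule conjugates_of_root_of_unity[OF n(1) norm_\<omega> n(2) y_def y1]) (use y_def in blast)
  have alt: "(\<exists>z1\<in>Z. \<exists>z2\<in>Z. \<bar>z1\<bar> > 1 \<and> \<bar>z2\<bar> > 1 \<and> \<bar>z1\<bar> \<noteq> \<bar>z2\<bar>) \<or>
    (\<exists>z\<in>Z. \<bar>z\<bar> > 1 \<and> (y\<^sup>2 * z\<^sup>2 = 1 \<and> y\<^sup>2 + z\<^sup>2 = 3 \<or> (y\<^sup>2 * z\<^sup>2 = 1 \<or> y\<^sup>2 * z\<^sup>2 = 2) \<and> y\<^sup>2 + z\<^sup>2 = 4))"
    by (rule conjugate_alternatives[OF Z(1,2) y1 Z(3) Z(4) Z(5) Z(6-8)])
  define L where "L = zring \<omega>"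
  define ta tb tc where "ta = (\<lambda>X. ga L X)" and "tb = (\<lambda>X. gb L X)" and "tc = (\<lambda>X. gc L X)"
  define P where "P = ta A + ta B + ta C"
  define Q where "Q = tb A + tb B + tb C"
  define R where "R = tc A + tc B + tc C"
  have evZ: "ev p z = 0 \<longleftrightarrow> ev p (2 * Re \<omega>) = 0" if "z \<in> Z" for z p using Z(4)[OF that] unfolding y_def .
  define \<theta> where "\<theta> = (\<lambda>z :: real. arccos (\<bar>z\<bar> / 2))"
  have \<theta>: "0 < \<theta> z \<and> \<theta> z < pi / 3 \<and> cos (\<theta> z) = \<bar>z\<bar> / 2 \<and>
      real P * (2 * \<theta> z) + real Q * (pi - 3 * \<theta> z) + real R * \<theta> z = pi"
    if z: "z \<in> Z" "\<bar>z\<bar> > 1" for z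
    using conj_equation[OF A0 B1 z(2) _ evZ[OF z(1)]] Z(3)[OF z(1)]
    unfolding L_def ta_def tb_def tc_def P_def Q_def R_def \<theta>_def by blast
  obtain z0 where z0: "z0 \<in> Z" "\<bar>z0\<bar> > 1" using alt by blast
  obtain F where F: "embedding L F \<omega>" using conj_equation(5)[OF A0 B1 z0(2) _ evZ[OF z0(1)]] Z(3)[OF z0(1)] unfolding L_def by blast
  note ic = image_corners[OF A0 B1 F embedding_id[OF A0 B1 F] orient_sign, folded ta_def tb_def tc_def]
  have pos: "ta A + tb A + tc A > 0" "ta B + tb B + tc B > 0" "ta C + tb C + tc C > 0"
  proof -
    have "corner A B C > 0" "corner B C A > 0" "corner C A B > 0"
      using orient_ABC B.orient_ABC C.orient_ABC by (intro corner_gt_0; simp)+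
    then show "ta A + tb A + tc A > 0" "ta B + tb B + tc B > 0" "ta C + tb C + tc C > 0"
      using ic(1-3) by (auto intro!: gr0I)
  qed
  have main: "real P * (2 * \<delta>) + real Q * (pi / 2 - 3 * \<delta>) + real R * (pi / 2 + \<delta>) = pi"
    using ic(4) unfolding ic(1-3) angs P_def Q_def R_def by (simp add: algebra_simps)
  have cosI: "x = y" if "cos x = cos y" "0 \<le> x \<and> x \<le> pi \<and> 0 \<le> y \<and> y \<le> pi" for x y :: real
    using that cos_inj_pi by blast
  have regroup: "p * (2 * d) + q * (h - 3 * d) + r * (h + d) = (2 * p - 3 * q + r) * d + (q + r) * h" for p q r d h :: real
    by (simp add: algebra_simps)
  from alt consider (distinct) z1 z2 where "z1 \<in> Z" "z2 \<in> Z" "\<bar>z1\<bar> > 1" "\<bar>z2\<bar> > 1" "\<bar>z1\<bar> \<noteq> \<bar>z2\<bar>"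
    | (golden) z where "z \<in> Z" "\<bar>z\<bar> > 1" "y\<^sup>2 * z\<^sup>2 = 1" "y\<^sup>2 + z\<^sup>2 = 3"
    | (four) z where "z \<in> Z" "\<bar>z\<bar> > 1" "y\<^sup>2 * z\<^sup>2 = 1 \<or> y\<^sup>2 * z\<^sup>2 = 2" "y\<^sup>2 + z\<^sup>2 = 4"
    by blast
  then show ?thesis
  proof cases
    case distinct
    note z = distinct
    note t1 = \<theta>[OF z(1,3)] and t2 = \<theta>[OF z(2,4)]
    have ne: "\<theta> z1 - \<theta> z2 \<noteq> 0" using t1 t2 z(5) by auto
    \<comment> \<open>Subtracting the equations of two conjugates removes the multiple of
      \<open>pi\<close>.\<close>
    have "(2 * real P - 3 * real Q + real R) * (\<theta> z1 - \<theta> z2) = 0" using t1 t2 by (simp add: algebra_simps)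
    then have K: "2 * real P - 3 * real Q + real R = 0" using ne by simp
    then have e: "2 * real P + real R = 3 * real Q" by simp
    have "(2 * real P - 3 * real Q + real R) * \<theta> z1 + real Q * pi = pi" using t1 by (simp add: algebra_simps)
    then have Q: "Q = 1" unfolding K by simp
    have "(2 * real P - 3 * real Q + real R) * \<delta> + (real Q + real R) * (pi / 2) = pi" using main unfolding regroup .
    then have "(real Q + real R) * (pi / 2) = 2 * (pi / 2)" unfolding K by simp
    then have "real Q + real R = 2" by (simp only: mult_cancel_right) simp
    then have R: "R = 1" using Q by simp
    then have "P = 1" using e Q by simp
    then show ?thesis
      unfolding similar_corners_def
      using unit_counts_mset[OF ic(1-3)[unfolded angs] pos] Q R unfolding P_def Q_def R_def by blast
  next
    case golden
    note z = golden(1,2) and e = golden(3,4)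
    note t = \<theta>[OF z]
    have yz: "s * \<bar>z\<bar> = 1"
    proof -
      have "(s * \<bar>z\<bar>)\<^sup>2 = 1" using e(1) by (simp add: ys power_mult_distrib)
      moreover have "s * \<bar>z\<bar> \<ge> 0" using s_pos by simp
      ultimately show ?thesis by (simp add: power2_eq_1_iff)
    qed
    have "(1 - s\<^sup>2)\<^sup>2 = s\<^sup>2"
    proof -
      have "z\<^sup>2 = 3 - s\<^sup>2" using e(2) by (simp add: ys)
      then have "s\<^sup>2 * (3 - s\<^sup>2) = 1" using e(1) by (simp add: ys)
      then show ?thesis by (simp add: power2_eq_square algebra_simps)
    qed
    \<comment> \<open>So \<open>s\<close> is the inverse golden ratio, and
      \<open>a = b\<close>.\<close>
    then have s2: "1 - s\<^sup>2 = s" by (rule power2_eq_imp_eq) (use s_pos tb_pos in simp_all)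
    have "cos (3 * \<delta>) = s * c" using cos_3\<delta> by (simp only: s2)
    also have "\<dots> = cos (pi / 2 - 2 * \<delta>)" by (simp add: cos_diff sin_2\<delta>)
    finally have "cos (3 * \<delta>) = cos (pi / 2 - 2 * \<delta>)" .
    then have "3 * \<delta> = pi / 2 - 2 * \<delta>" by (rule cosI) (use \<delta> in auto)
    then have \<delta>10: "pi = 10 * \<delta>" by simp
    have "s * (1 + s) = s + s\<^sup>2" by (simp add: algebra_simps power2_eq_square)
    also have "\<dots> = s * \<bar>z\<bar>" unfolding yz using s2 by linarith
    finally have zs: "\<bar>z\<bar> = 1 + s" using s_pos by simp
    have "cos (\<theta> z) = \<bar>z\<bar> / 2" using t by blast
    then have "2 * cos (\<theta> z) = 1 + s" unfolding zs by simp
    also have "1 + s = 2 * cos (2 * \<delta>)" unfolding cos_2\<delta> using s2 by linarith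
    finally have "cos (\<theta> z) = cos (2 * \<delta>)" by simp
    then have th: "\<theta> z = 2 * \<delta>" by (rule cosI) (use t \<delta> in auto)
    have "\<delta> * (4 * real P + 4 * real Q + 2 * real R) = \<delta> * 10" using t unfolding th \<delta>10 by (simp add: algebra_simps)
    then have 1: "2 * P + 2 * Q + R = 5" using \<delta> by simp
    have "\<delta> * (2 * real P + 2 * real Q + 6 * real R) = \<delta> * 10" using main unfolding \<delta>10 by (simp add: algebra_simps)
    then have 2: "P + Q + 3 * R = 5" using \<delta> by simp
    have PQR: "P + Q = 2" "R = 1" using 1 2 by linarith+
    have b: "pi / 2 - 3 * \<delta> = 2 * \<delta>" using \<delta>10 by simp
    show ?thesis
      unfolding similar_corners_def b
      using golden_counts_mset[OF ic(1-3)[unfolded angs b] pos] PQR unfolding P_def Q_def R_def by blast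
  next
    case four
    note z = four(1,2) and e = four(3,4)
    note t = \<theta>[OF z]
    define r where "r = 2 - s\<^sup>2"
    have r: "s\<^sup>2 = 2 - r" by (simp add: r_def)
    have r0: "r > 0" using tb_pos by (simp add: r_def)
    have zr: "z\<^sup>2 = 2 + r" using e(2) by (simp add: ys r_def)
    have "cos (\<theta> z) = cos \<delta>"
    proof (rule power2_eq_imp_eq)
      have "cos (\<theta> z) = \<bar>z\<bar> / 2" using t by blast
      then have "(cos (\<theta> z))\<^sup>2 = z\<^sup>2 / 4" by (simp only: power_divide power2_abs) simp
      also have "\<dots> = 1 - (sin \<delta>)\<^sup>2" unfolding zr r_def by (simp add: s_def power_mult_distrib)
      also have "\<dots> = (cos \<delta>)\<^sup>2" by (simp add: cos_squared_eq)
      finally show "(cos (\<theta> z))\<^sup>2 = (cos \<delta>)\<^sup>2" .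
    qed (use t c_pos in \<open>auto simp: c_def\<close>)
    \<comment> \<open>The conjugate tile thus has angles \<open>2 * \<delta>\<close>,
      \<open>pi - 3 * \<delta>\<close>, \<open>\<delta>\<close>. Comparison with the original
      equation gives \<open>R = Q\<close>.\<close>
    then have th: "\<theta> z = \<delta>" by (rule cosI) (use t \<delta> in auto)
    have t': "2 * real P * \<delta> - 3 * (real Q * \<delta>) + real R * \<delta> + real Q * pi = pi"
      using t unfolding th by (simp add: algebra_simps)
    have m': "2 * real P * \<delta> - 3 * (real Q * \<delta>) + real R * \<delta> + (real Q + real R) * (pi / 2) = pi"
      using main by (simp add: algebra_simps add_divide_distrib)
    have "(real Q + real R) * (pi / 2) = real Q * pi" using t' m' by linarith
    also have "\<dots> = (2 * real Q) * (pi / 2)" by simp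
    finally have "real Q + real R = 2 * real Q" by (simp only: mult_cancel_right) simp
    then have RQ: "R = Q" by simp
    have cos2: "cos (2 * \<delta>) = r / 2" using cos_2\<delta> by (simp add: r_def)
    have angle: "r\<^sup>2 = 3 \<and> 2 * \<delta> = pi / 6 \<or> r\<^sup>2 = 2 \<and> 2 * \<delta> = pi / 4"
    proof -
      have "y\<^sup>2 * z\<^sup>2 = 4 - r\<^sup>2" unfolding zr by (simp add: ys r) (simp add: algebra_simps power2_eq_square)
      then consider "r\<^sup>2 = 3" | "r\<^sup>2 = 2" using e(1) by fastforce
      then show ?thesis
      proof cases
        case 1
        then have "r = sqrt 3" using r0 by (simp add: real_sqrt_unique)
        then have "cos (2 * \<delta>) = cos (pi / 6)" using cos2 by (simp add: cos_30)
        then have "2 * \<delta> = pi / 6" by (rule cosI) (use \<delta> in auto)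
        with 1 show ?thesis by simp
      next
        case 2
        then have "r = sqrt 2" using r0 by (simp add: real_sqrt_unique)
        then have "cos (2 * \<delta>) = cos (pi / 4)" using cos2 by (simp add: cos_45)
        then have "2 * \<delta> = pi / 4" by (rule cosI) (use \<delta> in auto)
        with 2 show ?thesis by simp
      qed
    qed
    \<comment> \<open>\<open>k\<close> is \<open>pi / \<alpha>\<close>. The angle equation then
      reads \<open>P + Q * k = k + Q\<close>, which leaves only \<open>Q = 1\<close> and
      \<open>Q = 0\<close>.\<close>
    define k :: nat where "k = (if r\<^sup>2 = 3 then 6 else 4)"
    have pik: "pi = real k * (2 * \<delta>)" and k4: "k \<ge> 4" using angle by (auto simp: k_def)
    have "(2 * \<delta>) * (real P + real Q * real k) = (2 * \<delta>) * (real k + real Q)"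
      using t' unfolding RQ pik by (simp add: algebra_simps)
    then have "real P + real Q * real k = real k + real Q" using \<delta> by simp
    then have PQ: "P + Q * k = k + Q" by (simp only: of_nat_add[symmetric] of_nat_mult[symmetric] of_nat_eq_iff)
    have "Q < 2"
    proof (rule ccontr)
      assume "\<not> Q < 2"
      then obtain j where "Q = 2 + j" using le_Suc_ex[of 2 Q] by auto
      then have "P + k + j * k = j + 2" using PQ by simp
      moreover have "j \<le> j * k" using k4 by simp
      ultimately show False using k4 by linarith
    qed
    then consider "Q = 1" | "Q = 0" by linarith
    then show ?thesis
    proof cases
      case 1
      then have "P = 1" "R = 1" using PQ RQ by simp_all
      then show ?thesis
        unfolding similar_corners_def
        using unit_counts_mset[OF ic(1-3)[unfolded angs] pos] 1 unfolding P_def Q_def R_def by blast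
    next
      case 2
      have zero: "tb A = 0" "tb B = 0" "tb C = 0" "tc A = 0" "tc B = 0" "tc C = 0"
        using 2 RQ unfolding Q_def R_def by auto
      have Pk: "ta A + ta B + ta C = k" using PQ 2 unfolding P_def by simp
      have p: "ta A > 0" "ta B > 0" "ta C > 0" using pos unfolding zero by simp_all
      define X1 where "X1 = norm (C - B)"
      define X2 where "X2 = norm (A - C)"
      define X3 where "X3 = norm (B - A)"
      have X: "X1 > 0" "X2 > 0" "X3 > 0" using weak_neq[OF T] by (auto simp: X1_def X2_def X3_def)
      have sides: "is_side X1" "is_side X2" "is_side X3"
        using B.side_A C.side_A side_A by (simp_all add: X1_def X2_def X3_def)
      define f where "f = (\<lambda>j. sin (real j * (2 * \<delta>)))"
      have sinc: "sin (corner A B C) = f (ta A)" "sin (corner B C A) = f (ta B)" "sin (corner C A B) = f (ta C)"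
        using ic(1-3) unfolding angs zero f_def by simp_all
      have D: "orient A B C = real N * (r - 1) * sin (2 * \<delta>)" unfolding area r_def by simp
      have cycD: "orient B C A = orient A B C" "orient C A B = orient A B C" by (simp_all add: orient_cyc orient_cyc[of C A B])
      have areas: "X2 * X3 * f (ta A) = real N * (r - 1) * sin (2 * \<delta>)"
        "X3 * X1 * f (ta B) = real N * (r - 1) * sin (2 * \<delta>)"
        "X1 * X2 * f (ta C) = real N * (r - 1) * sin (2 * \<delta>)"
        using area_corner[OF orient_ABC] area_corner[OF B.orient_ABC] area_corner[OF C.orient_ABC]
        unfolding sinc cycD D X1_def X2_def X3_def by (simp_all add: norm_minus_commute mult_ac)
      from angle have False
      proof (elim disjE conjE)
        assume r3: "r\<^sup>2 = 3" and a: "2 * \<delta> = pi / 6"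
        then have rs: "r = sqrt 3" using r0 by (simp add: real_sqrt_unique)
        have "real 4 * (pi / 6) = pi - pi / 3" by simp
        then have f4: "f 4 = r / 2" unfolding f_def a rs by (simp only: sin_pi_minus sin_60)
        have fv: "f 1 = 1 / 2" "f 2 = r / 2" "f 3 = 1" "f 4 = r / 2"
          unfolding f4 unfolding f_def a rs by (simp_all add: sin_30 sin_60)
        have S: "ta A + ta B + ta C = 6" using Pk r3 by (simp add: k_def)
        have d: "j = 1 \<or> j = 2 \<or> j = 3 \<or> j = 4" if "j > 0" "j \<le> 4" for j :: nat using that by linarith
        have le: "ta A \<le> 4" "ta B \<le> 4" using S p by linarith+
        have rr: "r * r = 3" using r3 by (simp only: power2_eq_square)
        have sq: "(f (ta A))\<^sup>2 \<in> \<rat>"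
          using d[OF p(1) le(1)] by (elim disjE) (simp_all add: fv power_divide r3 del: One_nat_def)
        have "\<exists>q\<in>\<rat>. q \<noteq> 0 \<and> f (ta A) * f (ta B) * f (ta C) = q * r"
        proof -
          have c: "ta C = 6 - ta A - ta B" using S by simp
          have "ta A + ta B < 6" using S p by linarith
          \<comment> \<open>Even multiples of \<open>pi / 6\<close> have sine \<open>r / 2\<close>,
            odd ones a rational sine. Since the total 6 is even, one or three entries are even, so
            the product is a rational multiple of \<open>r\<close>.\<close>
          then have "(ta A, ta B) \<in> {(1,1), (1,2), (1,3), (1,4), (2,1), (2,2), (2,3), (3,1), (3,2), (4,1)}"
            using d[OF p(1) le(1)] d[OF p(2) le(2)] by (elim disjE) simp_all
          then have "f (ta A) * f (ta B) * f (ta C) = 1 / 8 * r \<or> f (ta A) * f (ta B) * f (ta C) = 1 / 4 * r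
              \<or> f (ta A) * f (ta B) * f (ta C) = 3 / 8 * r"
            unfolding c by (elim insertE emptyE; simp add: fv fv(1)[unfolded One_nat_def] rr)
          moreover have "1 / 8 \<in> (\<rat> :: real set)" "1 / 4 \<in> (\<rat> :: real set)" "3 / 8 \<in> (\<rat> :: real set)" by simp_all
          moreover have "1 / 8 \<noteq> (0::real)" "1 / 4 \<noteq> (0::real)" "3 / 8 \<noteq> (0::real)" by simp_all
          ultimately show ?thesis by blast
        qed
        then obtain q where q: "q \<in> \<rat>" "q \<noteq> 0" "f (ta A) * f (ta B) * f (ta C) = q * r" by blast
        have "real N * (r - 1) * sin (2 * \<delta>) = real N / 2 * (r - 1)" unfolding a by (simp add: sin_30)
        note ar = areas[unfolded this]
        show False by (rule no_thirty_degrees_tiling[OF r r3 r0 X ar sq q(3,1,2) sides(1)])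
      next
        assume r2: "r\<^sup>2 = 2" and a: "2 * \<delta> = pi / 4"
        then have rs: "r = sqrt 2" using r0 by (simp add: real_sqrt_unique)
        have fv: "f 1 = r / 2" "f 2 = 1"
          unfolding f_def a rs by (simp_all add: sin_45)
        have S: "ta A + ta B + ta C = 4" using Pk r2 by (simp add: k_def)
        have d: "j = 1 \<or> j = 2" if "j > 0" "j \<le> 2" for j :: nat using that by linarith
        have le: "ta A \<le> 2" "ta B \<le> 2" "ta C \<le> 2" using S p by linarith+
        have rr: "r * r = 2" using r2 by (simp only: power2_eq_square)
        have "f 1 = sin (2 * \<delta>)" by (simp add: f_def)
        then have "real N * (r - 1) * sin (2 * \<delta>) = real N / 2 * (r * r - r)" unfolding fv by (simp add: algebra_simps)
        then have DD: "real N * (r - 1) * sin (2 * \<delta>) = real N / 2 * (2 - r)" unfolding rr .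
        have "ta A = 2 \<and> ta B = 1 \<and> ta C = 1 \<or> ta A = 1 \<and> ta B = 2 \<and> ta C = 1 \<or> ta A = 1 \<and> ta B = 1 \<and> ta C = 2"
          using d[OF p(1) le(1)] d[OF p(2) le(2)] d[OF p(3) le(3)] S by (elim disjE) simp_all
        then show False
        proof (elim disjE conjE)
          assume "ta A = 2" "ta B = 1" "ta C = 1"
          note ar = areas[unfolded this fv DD]
          show False by (rule no_right_isosceles_tiling[where n = N, OF r r2 r0 X(2,3,1) _ _ _ sides(2,1)]) (use ar in \<open>simp_all add: mult_ac\<close>)
        next
          assume "ta A = 1" "ta B = 2" "ta C = 1"
          note ar = areas[unfolded this fv DD]
          show False by (rule no_right_isosceles_tiling[where n = N, OF r r2 r0 X(1,3,2) _ _ _ sides(1,2)]) (use ar in \<open>simp_all add: mult_ac\<close>)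
        next
          assume "ta A = 1" "ta B = 1" "ta C = 2"
          note ar = areas[unfolded this fv DD]
          show False by (rule no_right_isosceles_tiling[where n = N, OF r r2 r0 X _ _ _ sides(1,3)]) (use ar in \<open>simp_all add: mult_ac\<close>)
        qed
      qed
      then show ?thesis ..
    qed
  qed
qed

theorem irrational_similar:
  assumes "s \<notin> \<rat>"
  shows similar_corners
  using nonroot_case[OF assms] root_case by blast

end

end

section \<open>Transfer to the real plane\<close>

lemma scaling_convex_hull:
  fixes f :: "'a::euclidean_space \<Rightarrow> 'a"
  assumes "\<And>x y. dist (f x) (f y) = k * dist x y"
  shows "f ` (convex hull S) = convex hull (f ` S)"
proof -
  define g where "g = (\<lambda>x. f x - f 0)"
  have g: "linear g" by (rule scaling_linear[of g k]) (use assms in \<open>auto simp: g_def dist_norm\<close>)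
  have "f ` X = (\<lambda>x. f 0 + x) ` (g ` X)" for X by (simp add: g_def image_image)
  then show ?thesis by (simp only: convex_hull_translation convex_hull_linear_image[OF g])
qed

text \<open>Two circles centred at 0 and 1 meet in a pair of conjugate points.\<close>

lemma eq_or_eq_cnj:
  assumes "norm x = norm y" "norm (x - 1) = norm (y - 1)"
  shows "y = x \<or> y = cnj x"
proof -
  have n: "(Re x)\<^sup>2 + (Im x)\<^sup>2 = (Re y)\<^sup>2 + (Im y)\<^sup>2"
    using assms(1) by (simp only: cmod_power2[symmetric])
  have "(Re (x - 1))\<^sup>2 + (Im (x - 1))\<^sup>2 = (Re (y - 1))\<^sup>2 + (Im (y - 1))\<^sup>2"
    using assms(2) by (simp only: cmod_power2[symmetric])
  then have "(Re x)\<^sup>2 - 2 * Re x + (Im x)\<^sup>2 = (Re y)\<^sup>2 - 2 * Re y + (Im y)\<^sup>2"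
    by (simp add: power2_eq_square algebra_simps)
  then have re: "Re x = Re y" using n by linarith
  then have "(Im x)\<^sup>2 = (Im y)\<^sup>2" using n by simp
  then have "Im y = Im x \<or> Im y = - Im x" by (auto simp: power2_eq_iff)
  then show ?thesis using re by (auto simp: complex_eq_iff)
qed

text \<open>Moving the first side of each triangle to the segment from 0 to 1 reduces the claim to
  the third vertices, which are equal or conjugate. Conjugation is the reflected case.\<close>

lemma sss_similarity:
  fixes p q r p' q' r' :: complex
  assumes pq: "p \<noteq> q" and k: "k > 0"
    and d: "dist p' q' = k * dist p q" "dist q' r' = k * dist q r" "dist r' p' = k * dist r p"
  obtains h where "\<And>x y. dist (h x) (h y) = k * dist x y" "h p = p'" "h q = q'" "h r = r'"
proof -
  have pq': "p' \<noteq> q'" using d(1) pq k by auto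
  define e where "e = (q' - p') / (q - p)"
  define \<rho> where "\<rho> = (r - p) / (q - p)"
  define \<rho>' where "\<rho>' = (r' - p') / (q' - p')"
  have n: "norm (q' - p') = k * norm (q - p)" "norm (r' - q') = k * norm (r - q)" "norm (r' - p') = k * norm (r - p)"
    using d by (simp_all add: dist_norm norm_minus_commute)
  have ne: "norm e = k" unfolding e_def norm_divide n using pq by simp
  have 1: "\<rho> - 1 = (r - q) / (q - p)" "\<rho>' - 1 = (r' - q') / (q' - p')"
    using pq pq' by (simp_all add: \<rho>_def \<rho>'_def field_simps)
  have "norm \<rho> = norm \<rho>'" "norm (\<rho> - 1) = norm (\<rho>' - 1)"
    unfolding 1 unfolding \<rho>_def \<rho>'_def norm_divide n using k by simp_all
  from eq_or_eq_cnj[OF this] show ?thesis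
  proof
    assume \<rho>: "\<rho>' = \<rho>"
    show ?thesis
    proof (rule that[of "\<lambda>x. p' + e * (x - p)"])
      show "dist (p' + e * (x - p)) (p' + e * (y - p)) = k * dist x y" for x y
      proof -
        have "(p' + e * (x - p)) - (p' + e * (y - p)) = e * (x - y)" by (simp add: algebra_simps)
        then show ?thesis by (simp only: dist_norm norm_mult ne)
      qed
      have "p' + e * (r - p) = p' + (q' - p') * \<rho>" by (simp add: e_def \<rho>_def)
      then show "p' + e * (r - p) = r'" unfolding \<rho>[symmetric] \<rho>'_def using pq' by simp
      show "p' + e * (q - p) = q'" unfolding e_def using pq by simp
    qed simp
  next
    assume \<rho>: "\<rho>' = cnj \<rho>"
    show ?thesis
    proof (rule that[of "\<lambda>x. p' + (q' - p') * cnj ((x - p) / (q - p))"])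
      show "dist (p' + (q' - p') * cnj ((x - p) / (q - p))) (p' + (q' - p') * cnj ((y - p) / (q - p))) = k * dist x y" for x y
      proof -
        have "(p' + (q' - p') * cnj ((x - p) / (q - p))) - (p' + (q' - p') * cnj ((y - p) / (q - p)))
            = (q' - p') * cnj ((x - y) / (q - p))"
        proof -
          have "cnj ((x - p) / (q - p)) - cnj ((y - p) / (q - p)) = cnj ((x - y) / (q - p))"
            by (simp only: complex_cnj_diff[symmetric] diff_divide_distrib[symmetric]) simp
          moreover have "(p' + d * a) - (p' + d * b) = d * (a - b)" for a b d :: complex by (simp add: algebra_simps)
          ultimately show ?thesis by metis
        qed
        moreover have "norm ((q' - p') * cnj ((x - y) / (q - p))) = k * norm (x - y)"
          unfolding norm_mult complex_mod_cnj norm_divide n using pq by simp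
        ultimately show ?thesis by (simp only: dist_norm)
      qed
      show "p' + (q' - p') * cnj ((r - p) / (q - p)) = r'" unfolding \<rho>_def[symmetric] \<rho>[symmetric] \<rho>'_def using pq' by simp
      show "p' + (q' - p') * cnj ((q - p) / (q - p)) = q'" using pq by simp
    qed simp
  qed
qed

lemma orient_nonzero:
  assumes "\<not> collinear {A, B, C}" shows "orient A B C \<noteq> 0"
proof
  assume "orient A B C = 0"
  then have "Im ((C - A) * cnj (B - A)) = 0" by (simp only: Im_orient orient_cyc)
  then have "(C - A) / (B - A) \<in> \<real>"
    unfolding complex_div_cnj[of "C - A"] complex_is_Real_iff by simp
  then have "collinear {0, B - A, C - A}" by (simp only: collinear_iff_Reals)
  then have "collinear {B, A, C}" by (simp add: collinear_3[of B A C])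
  then show False using assms by (simp add: insert_commute)
qed

lemma normalising_similarity:
  assumes ABC: "orient A B C \<noteq> 0" and c: "c > 0"
  obtains h where "\<And>x y. dist (h x) (h y) = 1 / c * dist x y" "h A = 0" "sgn (h B) = 1"
    "orient (h A) (h B) (h C) > 0"
proof -
  have ne: "A \<noteq> B" using orient_nonzero_neq[OF ABC] by blast
  define j where "j = cnj (sgn (B - A)) / of_real c"
  have j: "norm j = 1 / c" using ne c by (simp add: j_def norm_divide norm_sgn)
  define q where "q = (B - A) * j"
  define r where "r = (C - A) * j"
  have qr: "q = of_real (norm (B - A) / c)"
  proof -
    have "B - A = of_real (norm (B - A)) * sgn (B - A)" by (rule norm_sgn_mult)
    then have "q = of_real (norm (B - A)) * (sgn (B - A) * cnj (sgn (B - A))) / of_real c"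
      unfolding q_def j_def by (metis mult.assoc times_divide_eq_right)
    then show ?thesis using unit_cnj[of "sgn (B - A)"] ne by (simp add: norm_sgn)
  qed
  have q0: "norm (B - A) / c > 0" using ne c by simp
  \<comment> \<open>Reflecting in the real axis if necessary makes the orientation positive without
    moving \<open>A\<close> and \<open>B\<close>.\<close>
  define r' where "r' = (if Im r > 0 then r else cnj r)"
  have "cnj q * r = (cnj (B - A) * (C - A)) * (j * cnj j)" unfolding q_def r_def by simp
  also have "j * cnj j = of_real ((1 / c)\<^sup>2)" using j by (metis complex_norm_square)
  finally have "Im (cnj q * r) = orient A B C * (1 / c)\<^sup>2"
    unfolding orient_def crs_alt by (simp only: Im_complex_of_real Re_complex_of_real times_complex.sel mult_zero_right add_0_left)
  then have "Im r \<noteq> 0" using ABC c unfolding qr by auto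
  then have r': "Im r' > 0" by (auto simp: r'_def)
  have d: "dist 0 q = 1 / c * dist A B" "dist r 0 = 1 / c * dist C A" "dist q r = 1 / c * dist B C"
  proof -
    have "q - r = (B - C) * j" by (simp add: q_def r_def algebra_simps)
    then show "dist q r = 1 / c * dist B C" by (simp add: dist_norm norm_mult j)
  qed (simp_all add: q_def r_def dist_norm norm_mult j norm_minus_commute)
  have cq: "cnj q = q" by (simp add: qr)
  have "dist q (cnj r) = dist q r"
    by (metis cq complex_cnj_diff complex_mod_cnj dist_norm)
  then have d': "dist r' 0 = 1 / c * dist C A" "dist q r' = 1 / c * dist B C"
    using d by (simp_all add: r'_def dist_norm)
  obtain h where h: "\<And>x y. dist (h x) (h y) = 1 / c * dist x y" "h A = 0" "h B = q" "h C = r'"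
    using sss_similarity[OF ne _ d(1) d'(2,1)] c by auto
  have "orient 0 q r' > 0" using mult_pos_pos[OF q0 r'] by (simp add: orient_def crs_def qr)
  moreover have "sgn q = 1" using q0 unfolding qr by (simp only: sgn_of_real sgn_pos of_real_1)
  ultimately show ?thesis using that[of h] h by simp
qed

text \<open>With \<open>u\<close> at 0 and \<open>v\<close> at 1, the third vertex has the same
  distances to both as the standard tile, so it is the standard one or its mirror image.\<close>

lemma (in tile_angle) tile_shapeI:
  assumes "norm (v - u) = 1" "norm (w - v) = s" "norm (u - w) = 1 - s\<^sup>2"
  shows "tile_shape \<omega> u v w"
proof -
  define e where "e = v - u"
  have e: "norm e = 1" using assms(1) by (simp add: e_def)
  have e0: "e \<noteq> 0" using e by auto
  define x where "x = (w - u) / e"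
  define y where "y = - of_real (tb \<omega>) * \<omega>\<^sup>2"
  have w: "w = u + x * e" using e0 by (simp add: x_def)
  have x1: "x - 1 = (w - v) / e" using e0 by (simp add: x_def e_def field_simps)
  have y1: "y - 1 = - (of_real (ts \<omega>) * \<omega> ^ 3)"
    unfolding y_def tile_closing[OF norm_\<omega>, symmetric] by (simp add: algebra_simps)
  have "norm y = norm x" unfolding y_def x_def norm_divide e
    using assms(3) tb_pos by (simp add: norm_mult norm_power norm_\<omega> norm_minus_commute tb_\<omega> del: of_real_diff of_real_power)
  moreover have "norm (y - 1) = norm (x - 1)" unfolding x1 y1 norm_divide e
    using assms(2) s_pos by (simp add: norm_mult norm_power norm_\<omega> ts_\<omega>)
  ultimately have "x = y \<or> x = cnj y" by (rule eq_or_eq_cnj)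
  then obtain \<rho> where "\<rho> = \<omega> \<or> \<rho> = cnj \<omega>" "x = - of_real (tb \<omega>) * \<rho>\<^sup>2" unfolding y_def by auto
  moreover from this have "w = u - of_real (tb \<omega>) * \<rho>\<^sup>2 * e" using w by simp
  ultimately show ?thesis unfolding tile_shape_def using e by (intro exI[of _ e] exI[of _ \<rho>]) (simp add: e_def)
qed

lemma (in angle_tiling) similar_sides:
  assumes similar_corners
  shows "\<exists>k>0. {#k * norm (C - B), k * norm (A - C), k * norm (B - A)#} = {#s, 1 - s\<^sup>2, 1#}"
proof -
  define D where "D = orient A B C"
  have D: "D > 0" "orient B C A = D" "orient C A B = D"
    using orient_ABC by (simp_all add: D_def orient_cyc orient_cyc[of C A B])
  define X1 X2 X3 where "X1 = norm (C - B)" and "X2 = norm (A - C)" and "X3 = norm (B - A)"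
  have X: "X1 > 0" "X2 > 0" "X3 > 0" using weak_neq[OF T] by (auto simp: X1_def X2_def X3_def)
  have ar: "X3 * X2 * sin (corner A B C) = D" "X1 * X3 * sin (corner B C A) = D" "X2 * X1 * sin (corner C A B) = D"
    using area_corner[of A B C] area_corner[of B C A] area_corner[of C A B] D
    by (simp_all add: X1_def X2_def X3_def D_def norm_minus_commute)
  \<comment> \<open>Chosen so that each scaled side is the sine of the opposite corner over
    \<open>cos \<delta>\<close>; the sines of the tile angles are \<open>s * c\<close>,
    \<open>(1 - s\<^sup>2) * c\<close> and \<open>c\<close>.\<close>
  define k where "k = D / (X1 * X2 * X3 * c)"
  have k: "k > 0" using X D c_pos by (simp add: k_def)
  have kX: "k * X1 = sin (corner A B C) / c" "k * X2 = sin (corner B C A) / c" "k * X3 = sin (corner C A B) / c"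
  proof -
    have "k * X1 = D / (X2 * X3) / c" using X by (simp add: k_def field_simps)
    then show "k * X1 = sin (corner A B C) / c" unfolding ar(1)[symmetric] using X by simp
    have "k * X2 = D / (X1 * X3) / c" using X by (simp add: k_def field_simps)
    then show "k * X2 = sin (corner B C A) / c" unfolding ar(2)[symmetric] using X by simp
    have "k * X3 = D / (X1 * X2) / c" using X by (simp add: k_def field_simps)
    then show "k * X3 = sin (corner C A B) / c" unfolding ar(3)[symmetric] using X by simp
  qed
  have "{#k * X1, k * X2, k * X3#} = image_mset (\<lambda>x. sin x / c) {#corner A B C, corner B C A, corner C A B#}"
    by (simp add: kX)
  also have "\<dots> = {#sin (2 * \<delta>) / c, sin (pi / 2 - 3 * \<delta>) / c, sin (pi / 2 + \<delta>) / c#}"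
    using assms unfolding similar_corners_def by simp
  also have "sin (2 * \<delta>) / c = s" unfolding sin_2\<delta> using c_pos by simp
  also have "sin (pi / 2 - 3 * \<delta>) / c = 1 - s\<^sup>2"
    using c_pos cos_3\<delta> by (simp add: sin_diff)
  also have "sin (pi / 2 + \<delta>) / c = 1" using c_pos by (simp add: sin_add c_def)
  finally show ?thesis using k unfolding X1_def X2_def X3_def by blast
qed

lemma angle_at_props:
  assumes "\<not> collinear {P, Q, R}"
  shows "P \<noteq> Q" "R \<noteq> Q" "0 < angle_at P Q R" "angle_at P Q R < pi"
    "norm (P - Q) * norm (R - Q) * cos (angle_at P Q R) = (P - Q) \<bullet> (R - Q)"
proof -
  have nc: "\<not> collinear {0, P - Q, R - Q}" using assms by (simp add: collinear_3[of P Q R])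
  then show ne: "P \<noteq> Q" "R \<noteq> Q" by (auto simp: insert_commute)
  define t where "t = ((P - Q) \<bullet> (R - Q)) / (norm (P - Q) * norm (R - Q))"
  have n: "norm (P - Q) * norm (R - Q) > 0" using ne by simp
  have "\<bar>(P - Q) \<bullet> (R - Q)\<bar> \<noteq> norm (P - Q) * norm (R - Q)" using nc by (simp only: norm_cauchy_schwarz_equal not_False_eq_True)
  moreover have "\<bar>(P - Q) \<bullet> (R - Q)\<bar> \<le> norm (P - Q) * norm (R - Q)" by (rule Cauchy_Schwarz_ineq2)
  ultimately have "\<bar>t\<bar> < 1" unfolding t_def using n by (simp add: abs_mult)
  then have t: "-1 < t" "t < 1" by auto
  have a: "angle_at P Q R = arccos t" by (simp add: angle_at_def t_def)
  show "0 < angle_at P Q R" "angle_at P Q R < pi" unfolding a using arccos_lt_bounded[OF t] by auto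
  have "cos (angle_at P Q R) = t" unfolding a using t by (intro cos_arccos) auto
  then show "norm (P - Q) * norm (R - Q) * cos (angle_at P Q R) = (P - Q) \<bullet> (R - Q)" using n by (simp add: t_def)
qed

text \<open>The law of sines for the tile is derived from its altitude on the side \<open>c\<close>:
  the feet give \<open>base\<close>, the two expressions for the altitude give
  \<open>height\<close>, and solving both yields the sides in terms of
  \<open>\<delta>\<close>.\<close>

lemma tile_sides:
  assumes UVW: "\<not> collinear {U, V, W}" and rel: "3 * angle_at V U W + 2 * angle_at W V U = pi"
  defines "\<delta> \<equiv> angle_at V U W / 2"
  shows "0 < \<delta>" "\<delta> < pi / 6" "dist V W = dist U V * (2 * sin \<delta>)" "dist W U = dist U V * (1 - (2 * sin \<delta>)\<^sup>2)"
proof -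
  have nc: "\<not> collinear {V, U, W}" "\<not> collinear {W, V, U}" using UVW by (simp_all add: insert_commute)
  note A = angle_at_props[OF nc(1)] and B = angle_at_props[OF nc(2)]
  have \<alpha>: "angle_at V U W = 2 * \<delta>" by (simp add: \<delta>_def)
  have \<beta>: "angle_at W V U = pi / 2 - 3 * \<delta>" using rel unfolding \<delta>_def by simp
  show \<delta>: "0 < \<delta>" "\<delta> < pi / 6" using A(3) B(3) unfolding \<alpha> \<beta> by auto
  interpret tile_angle \<delta> by unfold_locales (rule \<delta>)+
  define a b c' where "a = norm (W - V)" and "b = norm (W - U)" and "c' = norm (V - U)"
  have pos: "a > 0" "b > 0" "c' > 0" using A B by (auto simp: a_def b_def c'_def)
  have cosA: "c' * b * cos (2 * \<delta>) = (V - U) \<bullet> (W - U)" using A(5) unfolding \<alpha> a_def b_def c'_def .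
  have cosB: "a * c' * cos (pi / 2 - 3 * \<delta>) = (W - V) \<bullet> (U - V)"
    using B(5) unfolding \<beta> a_def c'_def by (simp add: norm_minus_commute)
  have sq: "a\<^sup>2 = (W - V) \<bullet> (W - V)" "b\<^sup>2 = (W - U) \<bullet> (W - U)" "c'\<^sup>2 = (V - U) \<bullet> (V - U)"
    by (simp_all add: a_def b_def c'_def power2_norm_eq_inner)
  have "c' * (b * cos (2 * \<delta>) + a * sin (3 * \<delta>)) = c' * c'"
    using cosA cosB sq by (simp add: cos_diff inner_diff_left inner_diff_right inner_commute power2_eq_square algebra_simps)
  then have base: "b * cos (2 * \<delta>) + a * sin (3 * \<delta>) = c'" using pos by simp
  have "b\<^sup>2 - a\<^sup>2 = c' * b * cos (2 * \<delta>) - a * c' * cos (pi / 2 - 3 * \<delta>)"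
    unfolding cosA cosB sq by (simp add: inner_diff_left inner_diff_right inner_commute algebra_simps)
  also have "\<dots> = c' * (b * cos (2 * \<delta>) - a * sin (3 * \<delta>))" by (simp add: cos_diff algebra_simps)
  also have "\<dots> = (b * cos (2 * \<delta>))\<^sup>2 - (a * sin (3 * \<delta>))\<^sup>2"
    unfolding base[symmetric] by (simp add: power2_eq_square algebra_simps)
  finally have "b\<^sup>2 * (1 - (cos (2 * \<delta>))\<^sup>2) = a\<^sup>2 * (1 - (sin (3 * \<delta>))\<^sup>2)"
    by (simp add: power_mult_distrib algebra_simps)
  then have "(b * sin (2 * \<delta>))\<^sup>2 = (a * cos (3 * \<delta>))\<^sup>2"
    unfolding sin_squared_eq[symmetric] cos_squared_eq[symmetric] by (simp only: power_mult_distrib)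
  moreover have "b * sin (2 * \<delta>) \<ge> 0" "a * cos (3 * \<delta>) \<ge> 0"
    unfolding sin_2\<delta> cos_3\<delta> using pos s_pos c_pos tb_pos by simp_all
  ultimately have height: "b * sin (2 * \<delta>) = a * cos (3 * \<delta>)" using power2_eq_imp_eq by blast
  have "c' * cos (3 * \<delta>) = b * (cos (2 * \<delta>) * cos (3 * \<delta>)) + (a * cos (3 * \<delta>)) * sin (3 * \<delta>)"
    unfolding base[symmetric] by (simp add: algebra_simps)
  also have "\<dots> = b * cos (3 * \<delta> - 2 * \<delta>)" unfolding height[symmetric] cos_diff by (simp add: algebra_simps)
  also have "\<dots> = b * c" by (simp add: c_def)
  finally have b: "b = c' * (1 - s\<^sup>2)" unfolding cos_3\<delta> using c_pos by simp
  have "a * ((1 - s\<^sup>2) * c) = c' * s * ((1 - s\<^sup>2) * c)" using height unfolding cos_3\<delta> sin_2\<delta> b by (auto simp: mult_ac)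
  then have a: "a = c' * s" using tb_pos c_pos by simp
  show "dist V W = dist U V * (2 * sin \<delta>)" "dist W U = dist U V * (1 - (2 * sin \<delta>)\<^sup>2)"
    using a b unfolding a_def b_def c'_def s_def by (simp_all add: dist_norm norm_minus_commute)
qed


lemma plane_isometry:
  obtains z :: "real^2 \<Rightarrow> complex" and z'
  where "linear z" "\<And>x y. dist (z x) (z y) = dist x y" "\<And>x y. dist (z' x) (z' y) = dist x y"
    "\<And>x. z' (z x) = x" "\<And>x. z (z' x) = x"
proof -
  have "DIM(real^2) = DIM(complex)" by simp
  then obtain z :: "real^2 \<Rightarrow> complex" and z' where z: "linear z" "linear z'" "\<And>x. norm (z x) = norm x"
    "\<And>y. norm (z' y) = norm y" "\<And>x. z' (z x) = x" "\<And>y. z (z' y) = y"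
    by (rule isomorphisms_UNIV_UNIV) metis
  show ?thesis
    by (rule that[OF z(1) _ _ z(5,6)]) (simp_all add: dist_norm z(3,4) linear_diff[OF z(1), symmetric] linear_diff[OF z(2), symmetric])
qed

lemma similar_sss:
  assumes ne: "A \<noteq> B" and k: "k > 0"
    and d: "dist U V = k * dist A B" "dist V W = k * dist B C" "dist W U = k * dist C A"
  shows "similar_sets (triangle_region A B C) (triangle_region U V W)"
proof -
  obtain z :: "real^2 \<Rightarrow> complex" and z' where z: "linear z" "\<And>x y. dist (z x) (z y) = dist x y"
    "\<And>x y. dist (z' x) (z' y) = dist x y" "\<And>x. z' (z x) = x" "\<And>x. z (z' x) = x"
    using plane_isometry by metis
  have "z A \<noteq> z B" using ne z(4) by metis
  then obtain h where h: "\<And>x y. dist (h x) (h y) = k * dist x y" "h (z A) = z U" "h (z B) = z V" "h (z C) = z W"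
    using sss_similarity[of "z A" "z B" k "z U" "z V" "z W" "z C"] k d z(2) by metis
  define f where "f = (\<lambda>x. z' (h (z x)))"
  have f: "dist (f x) (f y) = k * dist x y" for x y by (simp add: f_def z h)
  have "f ` triangle_region A B C = triangle_region U V W"
    unfolding triangle_region_def scaling_convex_hull[of f, OF f] by (simp add: f_def h z)
  then show ?thesis unfolding similar_sets_def using k f by blast
qed

lemma mset_triple_eq:
  assumes "{#x, y, z#} = {#x', y', z'#}"
  shows "x = x' \<and> y = y' \<and> z = z' \<or> x = x' \<and> y = z' \<and> z = y' \<or> x = y' \<and> y = x' \<and> z = z'
    \<or> x = y' \<and> y = z' \<and> z = x' \<or> x = z' \<and> y = x' \<and> z = y' \<or> x = z' \<and> y = y' \<and> z = x'"
  using assms by (auto simp: add_eq_conv_ex)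

lemma similar_of_sides:
  assumes ne: "A \<noteq> B" and k: "k > 0"
    and d: "{#k * dist B C, k * dist C A, k * dist A B#} = {#dist V W, dist W U, dist U V#}"
  shows "similar_sets (triangle_region A B C) (triangle_region U V W)"
proof -
  have p: "triangle_region W V U = triangle_region U V W" "triangle_region V W U = triangle_region U V W"
    "triangle_region W U V = triangle_region U V W" "triangle_region U W V = triangle_region U V W"
    "triangle_region V U W = triangle_region U V W"
    by (simp_all add: triangle_region_def insert_commute)
  have c: "dist V U = dist U V" "dist W V = dist V W" "dist U W = dist W U" by (simp_all only: dist_commute)
  note s = similar_sss[OF ne k]
  note s' = s[of U V W C] s[of W V U C, unfolded c] s[of V W U C] s[of W U V C] s[of U W V C, unfolded c] s[of V U W C, unfolded c]
  have "similar_sets (triangle_region A B C) (triangle_region U V W) \<or>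
    similar_sets (triangle_region A B C) (triangle_region W V U) \<or>
    similar_sets (triangle_region A B C) (triangle_region V W U) \<or>
    similar_sets (triangle_region A B C) (triangle_region W U V) \<or>
    similar_sets (triangle_region A B C) (triangle_region U W V) \<or>
    similar_sets (triangle_region A B C) (triangle_region V U W)"
    using mset_triple_eq[OF d[symmetric]] s' by blast
  then show ?thesis unfolding p by blast
qed

lemma continuous_scaling:
  assumes "\<And>x y. dist (f x) (f y) = k * dist x y" "k > 0"
  shows "continuous_on UNIV f"
  unfolding continuous_on_iff
proof (intro ballI allI impI)
  fix x and e :: real assume e: "e > 0"
  show "\<exists>d>0. \<forall>y\<in>UNIV. dist y x < d \<longrightarrow> dist (f y) (f x) < e"
    using e assms by (intro exI[of _ "e / k"]) (simp add: field_simps)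
qed


theorem theorem3:
  fixes A B C U V W :: "real^2"
    and a b c \<alpha> \<beta> \<gamma> :: real
    and N :: nat
  assumes ABC: "is_triangle A B C"
    and tile: "is_triangle U V W"
    and sides: "a = dist V W" "b = dist W U" "c = dist U V"
    and angles: "\<alpha> = angle_at V U W" "\<beta> = angle_at W V U" "\<gamma> = angle_at U W V"
    and tiled: "N_tiled_by N (triangle_region A B C) (triangle_region U V W)"
    and angle_relation: "3 * \<alpha> + 2 * \<beta> = pi"
    and not_similar: "\<not> similar_sets (triangle_region A B C) (triangle_region U V W)"
  shows "rational_sides a b c \<and> a / c \<in> \<rat> \<and> b / c \<in> \<rat>"
proof -
  define \<delta> where "\<delta> = angle_at V U W / 2"
  have UVW: "\<not> collinear {U, V, W}" using tile by (simp add: is_triangle_def)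
  have rel: "3 * angle_at V U W + 2 * angle_at W V U = pi" using angle_relation unfolding angles .
  note ts = tile_sides[OF UVW rel, folded \<delta>_def]
  interpret t: tile_angle \<delta> by unfold_locales (rule ts(1,2))+
  have "U \<noteq> V" using UVW by auto
  then have c: "c > 0" by (simp add: sides)
  have ab: "a = c * t.s" "b = c * (1 - t.s\<^sup>2)" using ts(3,4) by (simp_all add: sides t.s_def)
  have "t.s \<in> \<rat>"
  proof (rule ccontr)
    assume irr: "t.s \<notin> \<rat>"
    obtain \<T> where \<T>: "finite \<T>" "\<And>K. K \<in> \<T> \<Longrightarrow> congruent_sets (triangle_region U V W) K"
      "pairwise (\<lambda>K L. K \<inter> L \<subseteq> frontier K \<inter> frontier L) \<T>" "\<Union>\<T> = triangle_region A B C"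
      using tiled by (auto simp: N_tiled_by_def is_tiling_def)
    have "\<forall>K\<in>\<T>. \<exists>f. (\<forall>x y. dist (f x) (f y) = dist x y) \<and> f ` triangle_region U V W = K"
      using \<T>(2) unfolding congruent_sets_def by blast
    from bchoice[OF this] obtain f where "\<forall>K\<in>\<T>. (\<forall>x y. dist (f K x) (f K y) = dist x y) \<and> f K ` triangle_region U V W = K" ..
    then have f: "dist (f K x) (f K y) = dist x y" "f K ` triangle_region U V W = K" if "K \<in> \<T>" for K x y
      using that by simp_all
    have K: "K = triangle_region (f K U) (f K V) (f K W)" if "K \<in> \<T>" for K
      using f(2)[OF that] scaling_convex_hull[of "f K" 1] f(1)[OF that] by (simp add: triangle_region_def)
    obtain z :: "real^2 \<Rightarrow> complex" and z' where z: "linear z" "\<And>x y. dist (z x) (z y) = dist x y"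
      "\<And>x y. dist (z' x) (z' y) = dist x y" "\<And>x. z' (z x) = x" "\<And>x. z (z' x) = x"
      using plane_isometry by metis
    have AB: "A \<noteq> B" and ABC': "\<not> collinear {A, B, C}" using ABC by (auto simp: is_triangle_def)
    have "\<not> collinear {z A, z B, z C}"
      using ABC' unfolding collinear_between_cases between z(2) .
    from normalising_similarity[OF orient_nonzero[OF this] c]
    obtain h where h: "\<And>x y. dist (h x) (h y) = 1 / c * dist x y" "h (z A) = 0" "sgn (h (z B)) = 1"
      "orient (h (z A)) (h (z B)) (h (z C)) > 0" by metis
    \<comment> \<open>An isometry onto the complex plane followed by the similarity that makes
      \<open>c = 1\<close>, sends \<open>A\<close> to 0, places \<open>B\<close> on the positive
      real axis and orients \<open>ABC\<close> positively.\<close>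
    define g where "g = (\<lambda>x. h (z x))"
    have gd: "dist (g x) (g y) = 1 / c * dist x y" for x y by (simp add: g_def h(1) z(2))
    have g_inj: "g x = g y \<longleftrightarrow> x = y" for x y using gd[of x y] c by (metis dist_eq_0_iff divide_eq_0_iff mult_eq_0_iff less_irrefl zero_neq_one)
    have g_cont: "continuous_on UNIV g" by (rule continuous_scaling[OF gd]) (use c in simp)
    have g_tri: "g ` triangle_region P Q R = tri (g P) (g Q) (g R)" for P Q R
    proof -
      have "g ` triangle_region P Q R = h ` (z ` (convex hull {P, Q, R}))" by (simp add: g_def image_image triangle_region_def)
      also have "\<dots> = convex hull (h ` (z ` {P, Q, R}))"
        by (simp only: convex_hull_linear_image[OF z(1)] scaling_convex_hull[of h, OF h(1)])
      finally show ?thesis by (simp add: g_def tri_def)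
    qed
    define u v w where "u = (\<lambda>K. g (f K U))" and "v = (\<lambda>K. g (f K V))" and "w = (\<lambda>K. g (f K W))"
    have gK: "g ` K = tri (u K) (v K) (w K)" if "K \<in> \<T>" for K
      using K[OF that] g_tri[of "f K U" "f K V" "f K W"] unfolding u_def v_def w_def by simp
    have shape: "tile_shape t.\<omega> (u K) (v K) (w K)" if "K \<in> \<T>" for K
    proof (rule t.tile_shapeI)
      have n: "norm (g (f K P) - g (f K Q)) = dist P Q / c" for P Q
        using gd[of "f K P" "f K Q"] f(1)[OF that] by (simp add: dist_norm)
      show "norm (v K - u K) = 1" "norm (w K - v K) = t.s" "norm (u K - w K) = 1 - t.s\<^sup>2"
        unfolding u_def v_def w_def n using c ab sides by (simp_all add: dist_commute field_simps)
    qed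
    have nz: "orient (u K) (v K) (w K) \<noteq> 0" if KT: "K \<in> \<T>" for K
    proof -
      obtain e \<rho> where e: "norm e = 1" and \<rho>: "\<rho> = t.\<omega> \<or> \<rho> = cnj t.\<omega>" and v: "v K = u K + e"
        and w: "w K = u K - of_real (tb t.\<omega>) * \<rho>\<^sup>2 * e"
        using shape[OF KT] by (auto simp: tile_shape_def)
      show ?thesis using tile_orient[OF t.norm_\<omega> e \<rho>, of "u K"] t.orient_sign unfolding v[symmetric] w[symmetric] by auto
    qed
    \<comment> \<open>The preimage of a common interior part is an open set inside both tiles, while
      two tiles share only frontier points.\<close>
    have disj: "interior (g ` K) \<inter> interior (g ` L) = {}" if KL: "K \<in> \<T>" "L \<in> \<T>" "K \<noteq> L" for K L
    proof (rule ccontr)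
      assume "interior (g ` K) \<inter> interior (g ` L) \<noteq> {}"
      then obtain y where "y \<in> interior (g ` K) \<inter> interior (g ` L)" by (metis ex_in_conv)
      then have y: "y \<in> interior (g ` K)" "y \<in> interior (g ` L)" by simp_all
      define O' where "O' = g -` (interior (g ` K) \<inter> interior (g ` L))"
      have "open O'" unfolding O'_def by (intro open_vimage open_Int open_interior g_cont)
      have "interior (g ` K) \<subseteq> g ` K" "interior (g ` L) \<subseteq> g ` L" by (rule interior_subset)+
      then have sub: "O' \<subseteq> K" "O' \<subseteq> L" unfolding O'_def by (auto simp: g_inj)
      obtain x where "y = g x" "x \<in> K" using interior_subset[THEN subsetD, OF y(1)] by (elim imageE)
      then have x: "x \<in> O'" using y by (simp add: O'_def)
      then have "x \<in> interior K" using interior_maximal[OF sub(1) \<open>open O'\<close>] by blast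
      moreover have "x \<in> frontier K" using pairwiseD[OF \<T>(3) KL] sub x by blast
      ultimately show False by (simp add: frontier_def)
    qed
    have T: "tiling \<T> u v w (g A) (g B) (g C)"
      unfolding tiling_def
    proof (intro conjI ballI impI)
      show "finite \<T>" by (rule \<T>)
      show "orient (g A) (g B) (g C) > 0" using h(4) by (simp add: g_def)
      have "(\<Union>K\<in>\<T>. tri (u K) (v K) (w K)) = (\<Union>K\<in>\<T>. g ` K)" by (rule SUP_cong[OF refl]) (simp only: gK)
      also have "\<dots> = g ` \<Union>\<T>" by (rule image_Union[symmetric])
      finally have "(\<Union>K\<in>\<T>. tri (u K) (v K) (w K)) = g ` \<Union>\<T>" .
      then show "(\<Union>K\<in>\<T>. tri (u K) (v K) (w K)) = tri (g A) (g B) (g C)" unfolding \<T>(4) g_tri .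
      show "orient (u K) (v K) (w K) \<noteq> 0" if "K \<in> \<T>" for K by (rule nz[OF that])
      show "interior (tri (u K) (v K) (w K)) \<inter> interior (tri (u L) (v L) (w L)) = {}"
        if "K \<in> \<T>" "L \<in> \<T>" "K \<noteq> L" for K L
        using disj[OF that] gK that by simp
    qed
    interpret a: angle_tiling \<delta> \<T> u v w "g A" "g B" "g C"
      by unfold_locales (fact tiling_weak[OF T], fact shape)
    have "g A = 0" "sgn (g B) = 1" using h(2,3) by (simp_all add: g_def)
    from a.similar_sides[OF a.irrational_similar[OF this irr]]
    obtain k where k: "k > 0" "{#k * norm (g C - g B), k * norm (g A - g C), k * norm (g B - g A)#} = {#t.s, 1 - t.s\<^sup>2, 1#}"
      by blast
    have n: "norm (g P - g Q) = dist P Q / c" for P Q using gd[of P Q] by (simp add: dist_norm)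
    have "image_mset (\<lambda>x. c * x) {#k * norm (g C - g B), k * norm (g A - g C), k * norm (g B - g A)#} = {#a, b, c#}"
      unfolding k(2) by (simp add: ab)
    then have "{#k * dist B C, k * dist C A, k * dist A B#} = {#dist V W, dist W U, dist U V#}"
      unfolding n using c by (simp add: sides dist_commute)
    from similar_of_sides[OF AB k(1) this] not_similar show False by blast
  qed
  moreover have "a / c = t.s" "b / c = 1 - t.s\<^sup>2" using c by (simp_all add: ab)
  moreover have "a / b = t.s / (1 - t.s\<^sup>2)" using c by (simp add: ab)
  ultimately show ?thesis unfolding rational_sides_def by simp
qed

end
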